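(* Let $\{P_{Y_iX_i}\}_{i\in[1:m]}$ and $\{Q_{Y_j^n}\}_{j\in[1:k]}$, $\{Q_{X_t^n}\}_{t\in[1:r]}$ satisfy the standing assumption (A) or (B) of the context. Let $\nu_i>0$, $\sum_{i=1}^m\nu_i=1$, and let $\tau_{jt}\ge 0$, $\sum_{j,t}\tau_{jt}=1$, be such that $\tau_{j_i^\star t_s^\star}>0$ for every $s$ and every $i\in\mathfrak F_s$. For each $n$ put $$P_{Y^nX^n}=\sum_{i=1}^m\nu_iP_{Y_iX_i}^{\otimes n},\qquad Q_{Y^nX^n}=\sum_{j,t}\tau_{jt}\,Q_{Y_j^n}\times Q_{X_t^n}.$$ Let $E^\star_{\mathrm{mix},\epsilon}(R_c)$ be the maximum $\epsilon$-achievable error exponent at rate $R_c$ for testing $P_{Y^nX^n}$ against $Q_{Y^nX^n}$ with one-sided compression, and $E^\star_{\mathrm{comp},\epsilon}(R_c)$ the one for the compound problem of testing $\{P_{Y_iX_i}^{\otimes n}\}_i$ against $\{Q_{Y_j^n}\times Q_{X_t^n}\}_{j,t}$ (both defined in the context). Then for every compression rate $R_c\ge 0$, $$E^\star_{\mathrm{mix},0}(R_c)=E^\star_{\mathrm{comp},0}(R_c)=\min_{s\in[1:|\mathcal P_{\mathcal X}|]}\theta_s(R_c).$$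
   Context: Conventions: all alphabets are finite, $\log$ is natural, $[a:b]=\{a,\dots,b\}$, $P^{\otimes n}$ is the $n$-fold product, $P\ll Q$ is absolute continuity, $D(\cdot\Vert\cdot)$ is relative entropy ($+\infty$ if $P\not\ll Q$), $I$ is mutual information. Data: $P_{Y_iX_i}$, $i\in[1:m]$, are distributions on $\mathcal Y\times\mathcal X$ with marginals $P_{Y_i},P_{X_i}$; for each $n$, $Q_{Y_j^n}$ ($j\in[1:k]$) are distributions on $\mathcal Y^n$ and $Q_{X_t^n}$ ($t\in[1:r]$) distributions on $\mathcal X^n$. $\mathcal P_{\mathcal X}=\{P_{\mathcal X,1},\dots,P_{\mathcal X,|\mathcal P_{\mathcal X}|}\}$ is the set of distinct distributions among the $P_{X_i}$, and $\mathfrak F_s=\{i: P_{X_i}=P_{\mathcal X,s}\}$. Standing assumption: one of the following holds. (A) $Q_{X_t^n}=Q_{X_t}^{\otimes n}$ and $Q_{Y_j^n}=Q_{Y_j}^{\otimes n}$ for all $t,j$; $\min_jD(P_{Y_i}\Vert Q_{Y_j})<\infty$ for all $i$; $\min_tD(P_{\mathcal X,s}\Vert Q_{X_t})<\infty$ for all $s$. Define $j_i^\star=\arg\min_jD(P_{Y_i}\Vert Q_{Y_j})$, $d_i^{\mathrm y}=D(P_{Y_i}\Vert Q_{Y_{j_i^\star}})$, $t_s^\star=\arg\min_tD(P_{\mathcal X,s}\Vert Q_{X_t})$, $d_s^{\mathrm x}=D(P_{\mathcal X,s}\Vert Q_{X_{t_s^\star}})$. (B) For all $t,j$, $(Q_{X_t^n})_n$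 and $(Q_{Y_j^n})_n$ are the $n$-dimensional marginals of Markov processes of finite order with stationary (time-invariant) transition probabilities; for all $n$, $P_{\mathcal X,s}^{\otimes n}\ll Q_{X_t^n}$ for all $(s,t)$ and $P_{Y_i}^{\otimes n}\ll Q_{Y_j^n}$ for all $(i,j)$. Let $A_X^{(st)}=\lim_n[D(P_{\mathcal X,s}^{\otimes(n+1)}\Vert Q_{X_t^{n+1}})-D(P_{\mathcal X,s}^{\otimes n}\Vert Q_{X_t^n})]$ and $A_Y^{(ij)}=\lim_n[D(P_{Y_i}^{\otimes(n+1)}\Vert Q_{Y_j^{n+1}})-D(P_{Y_i}^{\otimes n}\Vert Q_{Y_j^n})]$ (these limits exist); assume $\min_jA_Y^{(ij)}<\infty$ for all $i$ and $\min_tA_X^{(st)}<\infty$ for all $s$. Define $j_i^\star=\arg\min_jA_Y^{(ij)}$, $d_i^{\mathrm y}=A_Y^{(ij_i^\star)}$, $t_s^\star=\arg\min_tA_X^{(st)}$, $d_s^{\mathrm x}=A_X^{(st_s^\star)}$. In both cases $\arg\min$ returns the first minimizer. Put $d_{is}^{\mathrm{yx}}=d_i^{\mathrm y}+d_s^{\mathrm x}$ for $i\in\mathfrak F_s$. Rate function: for $i\in\mathfrak F_s$ let $(\bar Y_i,\bar X_s)\sim P_{Y_i|X_i}\times P_{\mathcal X,s}$ (i.e. $P_{Y_iX_i}$); a kernel $P_{U|\bar X_s}$ (with $U$ in a finite alphabet) defines $U$ with $\bar Y_i-\bar X_s-U$ Markov. Then $$\theta_s(R_c)=\max_{P_{U|\bar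 X_s}:\,I(\bar X_s;U)\le R_c}\ \min_{i\in\mathfrak F_s}[I(\bar Y_i;U)+d_{is}^{\mathrm{yx}}].$$ Testing schemes: a testing scheme is a pair $(\phi_n,\psi_n)$ with $\phi_n:\mathcal X^n\to\mathcal M$ ($\mathcal M=\mathcal M_n$ a finite set, $|\phi_n|:=|\mathcal M|$) and a possibly randomized decision map $\psi_n:\mathcal Y^n\times\mathcal M\to\{0,1\}$ (output $0$ means deciding the null hypothesis). For a distribution $P$ on $\mathcal Y^n\times\mathcal M$, $P(\psi_n)$ is the probability that $\psi_n$ outputs $0$ and $P(1-\psi_n)=1-P(\psi_n)$. A subscript such as $P_{Y^n\phi_n(X^n)}$ denotes the law of $(Y^n,\phi_n(X^n))$ under $P_{Y^nX^n}$; $P_{Y_i^n\phi_n(X_i^n)}$ is the law under $P_{Y_iX_i}^{\otimes n}$; $Q_{\phi_n(X_t^n)}$ is the image of $Q_{X_t^n}$ under $\phi_n$. Mixture problem: $\alpha_n=P_{Y^n\phi_n(X^n)}(1-\psi_n)$, $\beta_n=Q_{Y^n\phi_n(X^n)}(\psi_n)$. Compound problem: $\alpha_n=\max_iP_{Y_i^n\phi_n(X_i^n)}(1-\psi_n)$, $\beta_n=\max_{j,t}Q_{Y_j^n}\times Q_{\phi_n(X_t^n)}(\psi_n)$. In either problem, for $\epsilon\in[0,1)$, $E$ is $\epsilon$-achievable at rate $R_c$ if there is a sequence of testing schemes with $\limsup_n\alpha_n\le\epsilon$, $\liminf_n\frac1n\log\frac1{\beta_n}\ge E$, $\limsup_n\frac1n\log|\phi_n|\le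 R_c$; the maximum $\epsilon$-achievable error exponent is the supremum of $\epsilon$-achievable $E$. *)

theory Defs
  imports "HOL-Probability.Probability"
begin

section \<open>Information measures (natural logarithm)\<close>

text \<open>
  The library's \<^const>\<open>KL_divergence\<close> takes the reference measure first, is real-valued, and does
  not signal a failure of absolute continuity; hence the explicit infinite case. All laws below
  have finite support, so the integral inside \<^const>\<open>KL_divergence\<close> is then a finite sum.
\<close>

definition rel_entropy :: "'a pmf \<Rightarrow> 'a pmf \<Rightarrow> ereal" where
  "rel_entropy p q =
     (if absolutely_continuous (measure_pmf q) (measure_pmf p)
      then ereal (KL_divergence (exp 1) (measure_pmf q) (measure_pmf p)) else \<infinity>)"

definition mutual_info :: "('a \<times> 'b) pmf \<Rightarrow> ereal" where
  "mutual_info J = rel_entropy J (pair_pmf (map_pmf fst J) (map_pmf snd J))"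

text \<open>The extended-real value of \<open>log (1/b)\<close> (recall \<open>ln 0 = 0\<close> in the library).\<close>

definition log_recip :: "real \<Rightarrow> ereal" where
  "log_recip b = (if b = 0 then \<infinity> else ereal (ln (1 / b)))"

section \<open>Sources\<close>

text \<open>
  Distributions on \<open>n\<close>-tuples are \<open>pmf\<close>s on lists of length \<open>n\<close>.
  The \<open>n\<close>-fold product of a joint law is regarded as a law on pairs of \<open>n\<close>-tuples.
\<close>

definition iid_pairs :: "nat \<Rightarrow> ('y \<times> 'x) pmf \<Rightarrow> ('y list \<times> 'x list) pmf" where
  "iid_pairs n p = map_pmf (\<lambda>zs. (map fst zs, map snd zs)) (replicate_pmf n p)"

definition finite_order_markov :: "(nat \<Rightarrow> 'a) measure \<Rightarrow> bool" where
  "finite_order_markov M \<longleftrightarrow>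
     prob_space M \<and> sets M = sets (PiM UNIV (\<lambda>_. count_space UNIV)) \<and>
     (\<exists>l. \<exists>K :: 'a list \<Rightarrow> 'a pmf. \<forall>n\<ge>l. \<forall>xs a.
        length xs = n \<longrightarrow> \<P>(\<omega> in M. map \<omega> [0..<n] = xs) > 0 \<longrightarrow>
        \<P>(\<omega> in M. \<omega> n = a \<bar> map \<omega> [0..<n] = xs) = pmf (K (drop (n - l) xs)) a)"

definition markov_marginals :: "(nat \<Rightarrow> 'a list pmf) \<Rightarrow> bool" where
  "markov_marginals Q \<longleftrightarrow>
     (\<exists>M. finite_order_markov M \<and>
        (\<forall>n. measure_pmf (Q n) = distr M (count_space UNIV) (\<lambda>\<omega>. map \<omega> [0..<n])))"

definition margY :: "(nat \<Rightarrow> ('y \<times> 'x) pmf) \<Rightarrow> nat \<Rightarrow> 'y pmf" where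
  "margY P i = map_pmf fst (P i)"

definition margX :: "(nat \<Rightarrow> ('y \<times> 'x) pmf) \<Rightarrow> nat \<Rightarrow> 'x pmf" where
  "margX P i = map_pmf snd (P i)"

text \<open>
  The distinct \<open>X\<close>-marginals; the classes \<open>s\<close> are indexed by these distributions themselves
  rather than by an enumeration of them.
\<close>

definition PXs :: "(nat \<Rightarrow> ('y \<times> 'x) pmf) \<Rightarrow> nat \<Rightarrow> 'x pmf set" where
  "PXs P m = margX P ` {1..m}"

definition cls :: "(nat \<Rightarrow> ('y \<times> 'x) pmf) \<Rightarrow> nat \<Rightarrow> 'x pmf \<Rightarrow> nat set" where
  "cls P m s = {i \<in> {1..m}. margX P i = s}"

text \<open>
  In both settings \<open>cY i j\<close> and \<open>cX s t\<close> are the per-letter divergences that are minimised over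
  \<open>j\<close> and \<open>t\<close>: single-letter divergences in the memoryless setting, limits of divergence
  increments in the Markov setting.
\<close>

definition memoryless_setting ::
  "nat \<Rightarrow> nat \<Rightarrow> nat \<Rightarrow> (nat \<Rightarrow> ('y \<times> 'x) pmf) \<Rightarrow>
   (nat \<Rightarrow> nat \<Rightarrow> 'y list pmf) \<Rightarrow> (nat \<Rightarrow> nat \<Rightarrow> 'x list pmf) \<Rightarrow>
   (nat \<Rightarrow> nat \<Rightarrow> ereal) \<Rightarrow> ('x pmf \<Rightarrow> nat \<Rightarrow> ereal) \<Rightarrow> bool" where
  "memoryless_setting m k r P QY QX cY cX \<longleftrightarrow>
     (\<exists>qY qX.
        (\<forall>j\<in>{1..k}. \<forall>n. QY j n = replicate_pmf n (qY j)) \<and>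
        (\<forall>t\<in>{1..r}. \<forall>n. QX t n = replicate_pmf n (qX t)) \<and>
        (\<forall>i\<in>{1..m}. \<forall>j\<in>{1..k}. cY i j = rel_entropy (margY P i) (qY j)) \<and>
        (\<forall>s\<in>PXs P m. \<forall>t\<in>{1..r}. cX s t = rel_entropy s (qX t))) \<and>
     (\<forall>i\<in>{1..m}. Min (cY i ` {1..k}) < \<infinity>) \<and>
     (\<forall>s\<in>PXs P m. Min (cX s ` {1..r}) < \<infinity>)"

definition divergence_increment :: "'a pmf \<Rightarrow> (nat \<Rightarrow> 'a list pmf) \<Rightarrow> nat \<Rightarrow> ereal" where
  "divergence_increment p Q n =
     rel_entropy (replicate_pmf (n + 1) p) (Q (n + 1)) - rel_entropy (replicate_pmf n p) (Q n)"

definition markov_setting ::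
  "nat \<Rightarrow> nat \<Rightarrow> nat \<Rightarrow> (nat \<Rightarrow> ('y \<times> 'x) pmf) \<Rightarrow>
   (nat \<Rightarrow> nat \<Rightarrow> 'y list pmf) \<Rightarrow> (nat \<Rightarrow> nat \<Rightarrow> 'x list pmf) \<Rightarrow>
   (nat \<Rightarrow> nat \<Rightarrow> ereal) \<Rightarrow> ('x pmf \<Rightarrow> nat \<Rightarrow> ereal) \<Rightarrow> bool" where
  "markov_setting m k r P QY QX cY cX \<longleftrightarrow>
     (\<forall>j\<in>{1..k}. markov_marginals (QY j)) \<and>
     (\<forall>t\<in>{1..r}. markov_marginals (QX t)) \<and>
     (\<forall>n. \<forall>i\<in>{1..m}. \<forall>j\<in>{1..k}.
        absolutely_continuous (measure_pmf (QY j n)) (measure_pmf (replicate_pmf n (margY P i)))) \<and>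
     (\<forall>n. \<forall>s\<in>PXs P m. \<forall>t\<in>{1..r}.
        absolutely_continuous (measure_pmf (QX t n)) (measure_pmf (replicate_pmf n s))) \<and>
     (\<forall>i\<in>{1..m}. \<forall>j\<in>{1..k}. cY i j = lim (divergence_increment (margY P i) (QY j))) \<and>
     (\<forall>s\<in>PXs P m. \<forall>t\<in>{1..r}. cX s t = lim (divergence_increment s (QX t))) \<and>
     (\<forall>i\<in>{1..m}. Min (cY i ` {1..k}) < \<infinity>) \<and>
     (\<forall>s\<in>PXs P m. Min (cX s ` {1..r}) < \<infinity>)"

definition first_argmin :: "nat \<Rightarrow> (nat \<Rightarrow> ereal) \<Rightarrow> nat" where
  "first_argmin N f = (LEAST j. j \<in> {1..N} \<and> (\<forall>j'\<in>{1..N}. f j \<le> f j'))"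

section \<open>The rate function\<close>

text \<open>
  \<open>W\<close> is the kernel of \<open>U\<close> given \<open>X\<close>; a finite alphabet for \<open>U\<close> is a finite set of naturals.
  Drawing \<open>U\<close> from \<open>W x\<close> alone makes \<open>Y - X - U\<close> a Markov chain.
\<close>

definition law_XU :: "'x pmf \<Rightarrow> ('x \<Rightarrow> nat pmf) \<Rightarrow> ('x \<times> nat) pmf" where
  "law_XU p W = bind_pmf p (\<lambda>x. map_pmf (\<lambda>u. (x, u)) (W x))"

definition law_YU :: "('y \<times> 'x) pmf \<Rightarrow> ('x \<Rightarrow> nat pmf) \<Rightarrow> ('y \<times> nat) pmf" where
  "law_YU p W = bind_pmf p (\<lambda>(y, x). map_pmf (\<lambda>u. (y, u)) (W x))"

text \<open>
  \<^const>\<open>Greatest\<close> expresses an attained maximum.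
\<close>

definition theta ::
  "nat \<Rightarrow> nat \<Rightarrow> nat \<Rightarrow> (nat \<Rightarrow> ('y \<times> 'x::finite) pmf) \<Rightarrow>
   (nat \<Rightarrow> nat \<Rightarrow> ereal) \<Rightarrow> ('x pmf \<Rightarrow> nat \<Rightarrow> ereal) \<Rightarrow> 'x pmf \<Rightarrow> real \<Rightarrow> ereal" where
  "theta m k r P cY cX s R =
     (GREATEST v. \<exists>W. (\<exists>A. finite A \<and> (\<forall>x. set_pmf (W x) \<subseteq> A)) \<and>
        mutual_info (law_XU s W) \<le> ereal R \<and>
        v = Min ((\<lambda>i. mutual_info (law_YU (P i) W) +
                      (cY i (first_argmin k (cY i)) + cX s (first_argmin r (cX s)))) ` cls P m s))"

section \<open>Testing with one-sided compression\<close>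

text \<open>
  Messages are coded as naturals. \<open>Accept_Null\<close> is the output \<open>0\<close>, \<open>Reject_Null\<close> the output \<open>1\<close>.
\<close>

datatype decision = Accept_Null | Reject_Null

type_synonym 'x encoder = "'x list \<Rightarrow> nat"
type_synonym 'y test = "'y list \<times> nat \<Rightarrow> decision pmf"

definition accept_prob :: "('y list \<times> nat) pmf \<Rightarrow> 'y test \<Rightarrow> real" where
  "accept_prob L \<psi> = pmf (bind_pmf L \<psi>) Accept_Null"

definition compressed :: "'x encoder \<Rightarrow> ('y list \<times> 'x list) pmf \<Rightarrow> ('y list \<times> nat) pmf" where
  "compressed \<phi> L = map_pmf (\<lambda>(ys, xs). (ys, \<phi> xs)) L"

text \<open>A testing problem is given by its two error probabilities at every block length.\<close>

type_synonym ('y, 'x) error = "nat \<Rightarrow> 'x encoder \<Rightarrow> 'y test \<Rightarrow> real"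

definition achievable ::
  "('y, 'x) error \<Rightarrow> ('y, 'x) error \<Rightarrow> real \<Rightarrow> real \<Rightarrow> real \<Rightarrow> bool" where
  "achievable \<alpha> \<beta> \<epsilon> R E \<longleftrightarrow>
     (\<exists>(M :: nat \<Rightarrow> nat set) \<phi> \<psi>.
        (\<forall>n. finite (M n) \<and> (\<forall>xs. length xs = n \<longrightarrow> \<phi> n xs \<in> M n)) \<and>
        limsup (\<lambda>n. ereal (\<alpha> n (\<phi> n) (\<psi> n))) \<le> ereal \<epsilon> \<and>
        liminf (\<lambda>n. ereal (1 / real n) * log_recip (\<beta> n (\<phi> n) (\<psi> n))) \<ge> ereal E \<and>
        limsup (\<lambda>n. ereal (1 / real n * ln (real (card (M n))))) \<le> ereal R)"

definition max_exponent ::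
  "('y, 'x) error \<Rightarrow> ('y, 'x) error \<Rightarrow> real \<Rightarrow> real \<Rightarrow> ereal" where
  "max_exponent \<alpha> \<beta> \<epsilon> R = (SUP E \<in> {E. achievable \<alpha> \<beta> \<epsilon> R E}. ereal E)"

definition simple_alpha :: "(nat \<Rightarrow> ('y list \<times> 'x list) pmf) \<Rightarrow> ('y, 'x) error" where
  "simple_alpha PP n \<phi> \<psi> = 1 - accept_prob (compressed \<phi> (PP n)) \<psi>"

definition simple_beta :: "(nat \<Rightarrow> ('y list \<times> 'x list) pmf) \<Rightarrow> ('y, 'x) error" where
  "simple_beta QQ n \<phi> \<psi> = accept_prob (compressed \<phi> (QQ n)) \<psi>"

definition compound_alpha ::
  "nat \<Rightarrow> (nat \<Rightarrow> ('y \<times> 'x) pmf) \<Rightarrow> ('y, 'x) error" where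
  "compound_alpha m P n \<phi> \<psi> =
     Max ((\<lambda>i. 1 - accept_prob (compressed \<phi> (iid_pairs n (P i))) \<psi>) ` {1..m})"

definition compound_beta ::
  "nat \<Rightarrow> nat \<Rightarrow> (nat \<Rightarrow> nat \<Rightarrow> 'y list pmf) \<Rightarrow> (nat \<Rightarrow> nat \<Rightarrow> 'x list pmf) \<Rightarrow> ('y, 'x) error" where
  "compound_beta k r QY QX n \<phi> \<psi> =
     Max ((\<lambda>(j, t). accept_prob (pair_pmf (QY j n) (map_pmf \<phi> (QX t n))) \<psi>) `
          ({1..k} \<times> {1..r}))"

text \<open>The weights of the mixtures are the probability mass functions \<open>\<nu>\<close> and \<open>\<tau>\<close>.\<close>

definition mixture_null ::
  "nat pmf \<Rightarrow> (nat \<Rightarrow> ('y \<times> 'x) pmf) \<Rightarrow> nat \<Rightarrow> ('y list \<times> 'x list) pmf" where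
  "mixture_null \<nu> P n = bind_pmf \<nu> (\<lambda>i. iid_pairs n (P i))"

definition mixture_alt ::
  "(nat \<times> nat) pmf \<Rightarrow> (nat \<Rightarrow> nat \<Rightarrow> 'y list pmf) \<Rightarrow> (nat \<Rightarrow> nat \<Rightarrow> 'x list pmf) \<Rightarrow>
   nat \<Rightarrow> ('y list \<times> 'x list) pmf" where
  "mixture_alt \<tau> QY QX n = bind_pmf \<tau> (\<lambda>(j, t). pair_pmf (QY j n) (QX t n))"

abbreviation mixture_exponent where
  "mixture_exponent \<nu> P \<tau> QY QX \<equiv>
     max_exponent (simple_alpha (mixture_null \<nu> P)) (simple_beta (mixture_alt \<tau> QY QX))"

abbreviation compound_exponent where
  "compound_exponent m P k r QY QX \<equiv>
     max_exponent (compound_alpha m P) (compound_beta k r QY QX)"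

end

theory Submission
  imports Defs
begin

text \<open>
  Achievability. The encoder identifies the class \<open>s\<close> by maximum likelihood and checks that
  \<open>x\<close> is typical in the sense that all \<open>Q\<^bsub>X\<^sub>t\<^esub>(x)\<close> are small compared with its product
  probability; it then sends a codeword \<open>u\<close> of a covering code of rate \<open>I(X; U)\<close>, or an error flag.
  The decoder accepts if \<open>y\<close> is typical in the same sense for some \<open>i\<close> of the class and has a
  large likelihood ratio between the conditional law given \<open>u\<close> and its product law; this ratio
  contributes \<open>I(Y\<^sub>i; U)\<close> to the exponent by Markov's inequality.

  Converse. For a single \<open>i\<close>, data processing bounds the exponent by the mutual information
  between \<open>Y\<^sup>n\<close> and the message plus the two divergences. Both this mutual information and the
  entropy of the message split letter by letter, conditioning on the first letter of \<open>x\<close>, and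
  the pieces are joint tables of \<open>(X, U)\<close>, one kernel serving all \<open>i\<close> of a class. Compactness of
  these tables, with the alphabet of \<open>U\<close> bounded by Caratheodory's argument, removes the slack
  in the rate and shows that the maximum defining the rate function is attained.

  The mixture problem is easier than the compound problem, and the converse needs only the
  components \<open>(j\<^sup>\<star>, t\<^sup>\<star>)\<close> of the mixture, so the two exponents agree.
\<close>

section \<open>Expectations and divergences of finitely supported laws\<close>

text \<open>The two halves ask for different facts about the \<open>Q\<close> sources. Achievability
  needs a one-sided statement: under the product law each \<open>Q\<close> likelihood is
  exponentially small relative to the product probability. It makes sense even for an infinite
  divergence and is required for every \<open>j\<close> and \<open>t\<close>, since the test has to
  withstand all of them. The converse needs a linear upper bound on the divergence, but only at the
  minimisers, where the rate is finite. Packaging these facts lets both settings share everything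
  else; in the Markov setting they come from a weak law for overlapping windows. Typicality is
  phrased by likelihoods because frequencies of single letters would not determine the likelihood
  under a Markov source. The obstacle in the code is that one codeword, chosen from \<open>x\<close>
  alone, must suit all \<open>i\<close> of a class although \<open>y\<close> depends on
  \<open>i\<close>; hence the condition on conditional failure probabilities imposed on the
  codebook. The converse is a weak one: it works because the first error vanishes, and so concerns
  error level 0 only.\<close>

abbreviation expect :: "'a pmf \<Rightarrow> ('a \<Rightarrow> real) \<Rightarrow> real" where
  "expect \<equiv> measure_pmf.expectation"

abbreviation Pr :: "'a pmf \<Rightarrow> 'a set \<Rightarrow> real" where
  "Pr \<equiv> measure_pmf.prob"

lemma expectation_cong_set:
  fixes f g :: "'a \<Rightarrow> real"
  assumes "\<And>x. x \<in> set_pmf p \<Longrightarrow> f x = g x"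
  shows "expect p f = expect p g"
  using assms by (intro integral_cong_AE) (auto simp: AE_measure_pmf_iff)

lemma expectation_mono_set:
  fixes f g :: "'a \<Rightarrow> real"
  assumes "finite (set_pmf p)" "\<And>x. x \<in> set_pmf p \<Longrightarrow> f x \<le> g x"
  shows "expect p f \<le> expect p g"
  using assms by (intro integral_mono_AE integrable_measure_pmf_finite) (auto simp: AE_measure_pmf_iff)

lemma expectation_bind_finite:
  fixes h :: "'b \<Rightarrow> real"
  assumes "finite (set_pmf p)" "\<And>x. x \<in> set_pmf p \<Longrightarrow> finite (set_pmf (f x))"
  shows "expect (bind_pmf p f) h
       = expect p (\<lambda>x. expect (f x) h)"
  using assms pmf_expectation_bind[of "set_pmf p" f p h]
    integral_measure_pmf_real[of "set_pmf p" p "\<lambda>x. expect (f x) h"]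
  by (simp add: mult.commute)

lemma expectation_sum_finite:
  fixes h :: "'b \<Rightarrow> 'a \<Rightarrow> real"
  assumes "finite (set_pmf p)"
  shows "expect p (\<lambda>x. \<Sum>i\<in>I. h i x) = (\<Sum>i\<in>I. expect p (h i))"
  using assms by (intro Bochner_Integration.integral_sum integrable_measure_pmf_finite)

lemma expectation_add_finite:
  fixes f g :: "'a \<Rightarrow> real"
  assumes "finite (set_pmf p)"
  shows "expect p (\<lambda>x. f x + g x)
       = expect p f + expect p g"
  using assms by (intro Bochner_Integration.integral_add integrable_measure_pmf_finite)

lemma expectation_diff_finite:
  fixes f g :: "'a \<Rightarrow> real"
  assumes "finite (set_pmf p)"
  shows "expect p (\<lambda>x. f x - g x)
       = expect p f - expect p g"
  using assms by (intro Bochner_Integration.integral_diff integrable_measure_pmf_finite)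

lemma prob_eq_expectation:
  "Pr p A = expect p (\<lambda>x. if x \<in> A then 1 else 0)"
proof -
  have "expect p (\<lambda>x. if x \<in> A then 1 else 0)
      = expect p (indicator A :: _ \<Rightarrow> real)"
    by (intro expectation_cong_set) (auto simp: indicator_def)
  then show ?thesis by simp
qed

lemma prob_mono_set:
  assumes "\<And>x. x \<in> set_pmf p \<Longrightarrow> x \<in> A \<Longrightarrow> x \<in> B"
  shows "Pr p A \<le> Pr p B"
  using assms by (intro measure_pmf.finite_measure_mono_AE) (auto simp: AE_measure_pmf_iff)

text \<open>Jensen's inequality for \<open>ln\<close>, reduced to \<open>ln t <= t - 1\<close>. Data
  processing, the entropy bound, the Donsker--Varadhan bound and the chain inequality of the
  converse all apply it to a likelihood ratio of mean at most one.\<close>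

lemma expectation_ln_le_0:
  fixes f :: "'a \<Rightarrow> real"
  assumes fin: "finite (set_pmf p)" and pos: "\<And>x. x \<in> set_pmf p \<Longrightarrow> 0 < f x"
    and le: "expect p f \<le> 1"
  shows "expect p (\<lambda>x. ln (f x)) \<le> 0"
proof -
  have "expect p (\<lambda>x. ln (f x)) \<le> expect p (\<lambda>x. f x - 1)"
    using fin pos by (intro expectation_mono_set) (auto intro: ln_le_minus_one)
  also have "\<dots> = expect p f - 1"
    using fin by (simp add: expectation_diff_finite)
  finally show ?thesis using le by simp
qed

lemma absolutely_continuous_pmf_iff:
  "absolutely_continuous (measure_pmf q) (measure_pmf p) \<longleftrightarrow> set_pmf p \<subseteq> set_pmf q"
proof -
  have null: "N \<in> null_sets (measure_pmf r) \<longleftrightarrow> set_pmf r \<inter> N = {}" for r :: "'a pmf" and N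
    by (simp add: null_sets_def measure_pmf.emeasure_eq_measure measure_pmf_zero_iff)
  show ?thesis
    unfolding absolutely_continuous_def by (auto simp: null subset_iff disjoint_iff)
qed

text \<open>Equals the relative entropy only under support inclusion; otherwise a point missed by
  \<open>q\<close> silently contributes \<open>ln 0 = 0\<close>. Hence the support hypotheses that
  accompany it.\<close>

definition kl :: "'a pmf \<Rightarrow> 'a pmf \<Rightarrow> real" where
  "kl p q = expect p (\<lambda>x. ln (pmf p x / pmf q x))"

lemma measure_pmf_density:
  assumes "set_pmf p \<subseteq> set_pmf q"
  shows "measure_pmf p = density (measure_pmf q) (\<lambda>x. ennreal (pmf p x / pmf q x))"
proof -
  have "density (measure_pmf q) (\<lambda>x. ennreal (pmf p x / pmf q x))
      = density (density (count_space UNIV) (pmf q)) (\<lambda>x. ennreal (pmf p x / pmf q x))"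
    by (simp flip: measure_pmf_eq_density)
  also have "\<dots> = density (count_space UNIV) (\<lambda>x. ennreal (pmf q x) * ennreal (pmf p x / pmf q x))"
    by (subst density_density_eq) auto
  also have "\<dots> = density (count_space UNIV) (pmf p)"
  proof -
    have "ennreal (pmf q x) * ennreal (pmf p x / pmf q x) = ennreal (pmf p x)" for x
      using assms by (cases "x \<in> set_pmf q") (auto simp: ennreal_mult'[symmetric] pmf_eq_0_set_pmf)
    then show ?thesis by simp
  qed
  finally show ?thesis by (simp add: measure_pmf_eq_density)
qed

lemma KL_divergence_pmf:
  assumes "set_pmf p \<subseteq> set_pmf q"
  shows "KL_divergence (exp 1) (measure_pmf q) (measure_pmf p) = kl p q"
proof -
  have [simp]: "log (exp 1) x = ln x" for x by (simp add: log_def)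
  let ?f = "\<lambda>x. pmf p x / pmf q x"
  have "KL_divergence (exp 1) (measure_pmf q) (measure_pmf p)
      = expect q (\<lambda>x. ?f x * log (exp 1) (?f x))"
    by (subst measure_pmf_density[OF assms], rule sigma_finite_measure.KL_density[OF measure_pmf.sigma_finite_measure_axioms]) auto
  also have "\<dots> = integral\<^sup>L (density (measure_pmf q) (\<lambda>x. ennreal (?f x))) (\<lambda>x. ln (?f x))"
    by (subst integral_real_density) auto
  also have "\<dots> = kl p q"
    by (simp add: kl_def measure_pmf_density[OF assms, symmetric])
  finally show ?thesis .
qed

lemma rel_entropy_eq:
  "rel_entropy p q = (if set_pmf p \<subseteq> set_pmf q then ereal (kl p q) else \<infinity>)"
  by (simp add: rel_entropy_def absolutely_continuous_pmf_iff KL_divergence_pmf)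

lemma set_pmf_subset_marginals:
  "set_pmf J \<subseteq> set_pmf (pair_pmf (map_pmf fst J) (map_pmf snd J))"
  by (auto simp: image_iff) force+

lemma mutual_info_eq:
  "mutual_info J = ereal (expect J
      (\<lambda>(a, b). ln (pmf J (a, b) / (pmf (map_pmf fst J) a * pmf (map_pmf snd J) b))))"
  using set_pmf_subset_marginals[of J]
  unfolding mutual_info_def rel_entropy_eq kl_def
  by (auto simp: pmf_pair intro!: arg_cong[where f="expect J"])

text \<open>Strictness is what matters: it gives distinct \<open>X\<close> marginals a positive
  exponent, so that maximum likelihood can separate the classes.\<close>

lemma kl_pos:
  assumes fin: "finite (set_pmf p)" and sub: "set_pmf p \<subseteq> set_pmf q" and ne: "p \<noteq> q"
  shows "0 < kl p q"
proof -
  interpret information_space "measure_pmf q" "exp 1" by standard simp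
  let ?f = "\<lambda>x. pmf p x / pmf q x"
  have d: "density (measure_pmf q) (\<lambda>x. ennreal (?f x)) = measure_pmf p"
    by (simp add: measure_pmf_density[OF sub, symmetric])
  have "0 < KL_divergence (exp 1) (measure_pmf q) (density (measure_pmf q) (\<lambda>x. ennreal (?f x)))"
  proof (rule KL_gt_0)
    show "prob_space (density (measure_pmf q) (\<lambda>x. ennreal (?f x)))"
      unfolding d by (rule prob_space_measure_pmf)
    show "integrable (measure_pmf q) (\<lambda>x. ?f x * log (exp 1) (?f x))"
      by (subst integrable_real_density[symmetric])
         (auto simp: d intro: integrable_measure_pmf_finite[OF fin])
    show "density (measure_pmf q) (\<lambda>x. ennreal (?f x)) \<noteq> measure_pmf q"
      unfolding d using ne by (simp add: measure_pmf_inject)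
  qed auto
  then show ?thesis by (simp add: d KL_divergence_pmf[OF sub])
qed

section \<open>A weak law for sliding windows\<close>

lemma finite_set_replicate_pmf [simp]:
  assumes "finite (set_pmf p)"
  shows "finite (set_pmf (replicate_pmf n p))"
  using assms finite_lists_length_eq[of "set_pmf p" n]
  by (simp add: set_replicate_pmf lists_eq_set Collect_conj_eq[symmetric] conj_commute Int_def)

lemma replicate_pmf_Suc_snoc:
  "replicate_pmf (Suc n) p
   = bind_pmf (replicate_pmf n p) (\<lambda>xs. bind_pmf p (\<lambda>x. return_pmf (xs @ [x])))"
  using replicate_pmf_distrib[of n 1 p]
  by (simp add: replicate_pmf_1 map_pmf_def bind_assoc_pmf bind_return_pmf)

text \<open>The shape of a log-likelihood ratio against a Markov source of order \<open>l\<close>: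
  the window ending at position \<open>k\<close> contains that letter together with the
  \<open>l\<close> letters it is conditioned on. Positions before \<open>l\<close> have no full past
  and are left out.\<close>

definition window_sum :: "nat \<Rightarrow> ('a list \<Rightarrow> real) \<Rightarrow> 'a list \<Rightarrow> real" where
  "window_sum l g xs = (\<Sum>k\<in>{l..<length xs}. g (take (Suc l) (drop (k - l) xs)))"

lemma window_sum_snoc:
  "window_sum l g (xs @ [x])
   = window_sum l g xs + (if l \<le> length xs then g (drop (length xs - l) xs @ [x]) else 0)"
proof (cases "l \<le> length xs")
  case True
  have "(\<Sum>k\<in>{l..<length xs}. g (take (Suc l) (drop (k - l) (xs @ [x]))))
      = (\<Sum>k\<in>{l..<length xs}. g (take (Suc l) (drop (k - l) xs)))"
    by (intro sum.cong refl arg_cong[where f=g]) (auto simp: take_append)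
  then show ?thesis using True by (simp add: window_sum_def)
next
  case False
  then show ?thesis by (simp add: window_sum_def)
qed

lemma window_sum_append_bound:
  assumes C: "\<And>w. \<bar>g w\<bar> \<le> C"
  shows "\<bar>window_sum l g (ys @ zs) - window_sum l g ys\<bar> \<le> real (length zs) * C"
proof (induction zs rule: rev_induct)
  case (snoc z zs)
  have "C \<ge> 0" using C[of undefined] by linarith
  have "window_sum l g (ys @ zs @ [z]) - window_sum l g ys
      = (window_sum l g (ys @ zs) - window_sum l g ys) +
        (if l \<le> length (ys @ zs) then g (drop (length (ys @ zs) - l) (ys @ zs) @ [z]) else 0)"
    using window_sum_snoc[of l g "ys @ zs" z] by simp
  also have "\<bar>\<dots>\<bar> \<le> real (length zs) * C + C"
    using snoc C \<open>C \<ge> 0\<close> by (intro order_trans[OF abs_triangle_ineq] add_mono) auto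
  finally show ?case by (simp add: algebra_simps)
qed simp

lemma window_sum_diff_const:
  "window_sum l (\<lambda>w. g w - c) xs = window_sum l g xs - real (length xs - l) * c"
  by (simp add: window_sum_def sum_subtractf)

text \<open>Windows are dependent only when they overlap. The cross term of a new window with the
  old sum is handled by forgetting the last \<open>l\<close> letters: this changes the sum by at
  most \<open>l * C\<close>, and what is left is independent of the centred new window. Each letter
  thus adds at most \<open>2 * l * C^2 + C^2\<close>.\<close>

lemma window_sum_second_moment:
  assumes fin: "finite (set_pmf p)" and C: "\<And>w. \<bar>g w\<bar> \<le> C"
    and mean: "expect (replicate_pmf (Suc l) p) g = 0"
  shows "expect (replicate_pmf n p) (\<lambda>xs. (window_sum l g xs)\<^sup>2)
         \<le> real n * (2 * real l + 1) * C\<^sup>2"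
proof (induction n)
  case 0
  show ?case by (simp add: window_sum_def)
next
  case (Suc n)
  let ?E = expect and ?S = "window_sum l g"
  have C0: "C \<ge> 0" using C[of undefined] by linarith
  show ?case
  proof (cases "l \<le> n")
    case False
    have "?E (replicate_pmf (Suc n) p) (\<lambda>xs. (?S xs)\<^sup>2) = ?E (replicate_pmf (Suc n) p) (\<lambda>xs. 0)"
      using False by (intro expectation_cong_set) (auto simp: set_replicate_pmf window_sum_def)
    then show ?thesis using C0 by (simp add: zero_le_mult_iff)
  next
    case True
    let ?G = "\<lambda>xs x. g (drop (n - l) xs @ [x])"
    have "?E (replicate_pmf (Suc n) p) (\<lambda>xs. (?S xs)\<^sup>2)
        = ?E (replicate_pmf n p) (\<lambda>xs. ?E p (\<lambda>x. (?S (xs @ [x]))\<^sup>2))"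
      using fin by (simp only: replicate_pmf_Suc_snoc) (simp add: expectation_bind_finite)
    also have "\<dots> = ?E (replicate_pmf n p) (\<lambda>xs. ?E p (\<lambda>x. (?S xs + ?G xs x)\<^sup>2))"
      using True by (intro expectation_cong_set) (auto simp: set_replicate_pmf window_sum_snoc)
    also have "\<dots> = ?E (replicate_pmf n p) (\<lambda>xs. (?S xs)\<^sup>2 + ?E p (\<lambda>x. 2 * (?S xs * ?G xs x) + (?G xs x)\<^sup>2))"
      using fin by (simp add: power2_sum expectation_add_finite add.assoc add.commute mult.assoc)
    also have "\<dots> = ?E (replicate_pmf n p) (\<lambda>xs. (?S xs)\<^sup>2)
        + 2 * ?E (replicate_pmf n p) (\<lambda>xs. ?E p (\<lambda>x. ?S xs * ?G xs x))
        + ?E (replicate_pmf n p) (\<lambda>xs. ?E p (\<lambda>x. (?G xs x)\<^sup>2))"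
      using fin by (simp add: expectation_add_finite)
    finally have eq: "?E (replicate_pmf (Suc n) p) (\<lambda>xs. (?S xs)\<^sup>2) = \<dots>" .
    have G2: "?E (replicate_pmf n p) (\<lambda>xs. ?E p (\<lambda>x. (?G xs x)\<^sup>2)) \<le> C\<^sup>2"
    proof -
      have "?E (replicate_pmf n p) (\<lambda>xs. ?E p (\<lambda>x. (?G xs x)\<^sup>2))
          \<le> ?E (replicate_pmf n p) (\<lambda>xs. ?E p (\<lambda>x. C\<^sup>2))"
        using fin C C0 by (intro expectation_mono_set) (auto simp: abs_le_square_iff[symmetric])
      then show ?thesis by simp
    qed
    \<comment> \<open>Expose the last \<open>l\<close> letters \<open>zs\<close> as an independent
      block: \<open>?S ys\<close> does not see them, and they form the past of the new
      window.\<close>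
    have nl: "replicate_pmf n p
      = bind_pmf (replicate_pmf (n - l) p) (\<lambda>ys. map_pmf (\<lambda>zs. ys @ zs) (replicate_pmf l p))"
      using replicate_pmf_distrib[of "n - l" l p] True by (simp add: map_pmf_def)
    have "?E (replicate_pmf n p) (\<lambda>xs. ?E p (\<lambda>x. ?S xs * ?G xs x))
        = ?E (replicate_pmf (n - l) p) (\<lambda>ys. ?E (replicate_pmf l p) (\<lambda>zs. ?E p (\<lambda>x. ?S (ys @ zs) * ?G (ys @ zs) x)))"
      using fin by (subst nl) (simp add: expectation_bind_finite)
    also have "\<dots> \<le> ?E (replicate_pmf (n - l) p) (\<lambda>ys. ?E (replicate_pmf l p) (\<lambda>zs.
        ?E p (\<lambda>x. ?S ys * g (zs @ [x]) + real l * C\<^sup>2)))"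
    proof (intro expectation_mono_set)
      fix ys zs x
      assume "ys \<in> set_pmf (replicate_pmf (n - l) p)" "zs \<in> set_pmf (replicate_pmf l p)"
      then have len: "length ys = n - l" "length zs = l" by (auto simp: set_replicate_pmf)
      have "(?S (ys @ zs) - ?S ys) * g (zs @ [x]) \<le> \<bar>?S (ys @ zs) - ?S ys\<bar> * \<bar>g (zs @ [x])\<bar>"
        by (metis abs_ge_self abs_mult)
      also have "\<dots> \<le> (real (length zs) * C) * C"
        using C C0 by (intro mult_mono window_sum_append_bound) auto
      finally show "?S (ys @ zs) * ?G (ys @ zs) x \<le> ?S ys * g (zs @ [x]) + real l * C\<^sup>2"
        using len by (simp add: algebra_simps power2_eq_square)
    qed (use fin in auto)
    also have "\<dots> = ?E (replicate_pmf (n - l) p) (\<lambda>ys. ?S ys * ?E (replicate_pmf l p) (\<lambda>zs. ?E p (\<lambda>x. g (zs @ [x])))) + real l * C\<^sup>2"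
      using fin by (simp add: expectation_add_finite)
    also have "?E (replicate_pmf l p) (\<lambda>zs. ?E p (\<lambda>x. g (zs @ [x]))) = 0"
      using mean fin by (simp only: replicate_pmf_Suc_snoc) (simp add: expectation_bind_finite)
    finally have SG: "?E (replicate_pmf n p) (\<lambda>xs. ?E p (\<lambda>x. ?S xs * ?G xs x)) \<le> real l * C\<^sup>2"
      by simp
    show ?thesis
      unfolding eq using Suc.IH SG G2 by (simp add: algebra_simps)
  qed
qed

text \<open>Chebyshev's inequality. Only \<open>n - l\<close> windows fit into \<open>n\<close>
  letters, so centring shifts the sum by up to \<open>l * \<bar>\<mu>\<bar>\<close>; half of
  \<open>\<delta>\<close> absorbs this shift and the other half is the deviation.\<close>

lemma window_weak_law:
  assumes fin: "finite (set_pmf p)" and C: "\<And>w. \<bar>g w\<bar> \<le> C" and "\<delta> > 0"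
    and mu: "expect (replicate_pmf (Suc l) p) g = \<mu>"
  shows "(\<lambda>n. Pr (replicate_pmf n p) {xs. window_sum l g xs \<le> real n * (\<mu> - \<delta>)}) \<longlonglongrightarrow> 0"
proof -
  let ?E = expect and ?S = "window_sum l (\<lambda>w. g w - \<mu>)"
  define K where "K = (2 * real l + 1) * (C + \<bar>\<mu>\<bar>)\<^sup>2 / (\<delta> / 2)\<^sup>2"
  have "\<forall>\<^sub>F n in sequentially.
      Pr (replicate_pmf n p) {xs. window_sum l g xs \<le> real n * (\<mu> - \<delta>)} \<le> K / real n"
  proof -
    have "\<forall>\<^sub>F n in sequentially. real n \<ge> real l * \<bar>\<mu>\<bar> / (\<delta> / 2)"
      by (rule eventually_sequentiallyI[of "nat \<lceil>real l * \<bar>\<mu>\<bar> / (\<delta> / 2)\<rceil>"]) linarith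
    then show ?thesis
      using eventually_gt_at_top[of 0] eventually_ge_at_top[of l]
    proof eventually_elim
      case (elim n)
      have big: "real l * \<bar>\<mu>\<bar> \<le> real n * (\<delta> / 2)"
        using elim \<open>\<delta> > 0\<close> by (simp add: field_simps)
      have a2: "0 < (real n * (\<delta> / 2))\<^sup>2" using elim \<open>\<delta> > 0\<close> by simp
      have "Pr (replicate_pmf n p) {xs. window_sum l g xs \<le> real n * (\<mu> - \<delta>)}
          = ?E (replicate_pmf n p) (\<lambda>xs. if xs \<in> {xs. window_sum l g xs \<le> real n * (\<mu> - \<delta>)} then 1 else 0)"
        by (rule prob_eq_expectation)
      also have "\<dots> \<le> ?E (replicate_pmf n p) (\<lambda>xs. (?S xs)\<^sup>2 / (real n * (\<delta> / 2))\<^sup>2)"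
      proof (rule expectation_mono_set)
        fix xs assume "xs \<in> set_pmf (replicate_pmf n p)"
        then have len: "length xs = n" by (auto simp: set_replicate_pmf)
        show "(if xs \<in> {xs. window_sum l g xs \<le> real n * (\<mu> - \<delta>)} then 1 else 0)
              \<le> (?S xs)\<^sup>2 / (real n * (\<delta> / 2))\<^sup>2"
        proof (cases "window_sum l g xs \<le> real n * (\<mu> - \<delta>)")
          case True
          have "real l * \<mu> \<le> real l * \<bar>\<mu>\<bar>"
            by (intro mult_left_mono) auto
          then have "real n * \<mu> - real (n - l) * \<mu> \<le> real l * \<bar>\<mu>\<bar>"
            using elim by (simp add: of_nat_diff algebra_simps)
          then have "?S xs \<le> - (real n * (\<delta> / 2))"
            using True big len by (simp add: window_sum_diff_const algebra_simps)
          then have "(real n * (\<delta> / 2))\<^sup>2 \<le> (?S xs)\<^sup>2"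
            using elim \<open>\<delta> > 0\<close> abs_le_square_iff[of "real n * (\<delta> / 2)" "?S xs"] by auto
          then show ?thesis using True a2 by simp
        qed simp
      qed (use fin in simp)
      also have "\<dots> = ?E (replicate_pmf n p) (\<lambda>xs. (?S xs)\<^sup>2) / (real n * (\<delta> / 2))\<^sup>2"
        by simp
      also have "\<dots> \<le> (real n * (2 * real l + 1) * (C + \<bar>\<mu>\<bar>)\<^sup>2) / (real n * (\<delta> / 2))\<^sup>2"
      proof (intro divide_right_mono window_sum_second_moment fin)
        show "\<bar>g w - \<mu>\<bar> \<le> C + \<bar>\<mu>\<bar>" for w using C[of w] by linarith
        show "?E (replicate_pmf (Suc l) p) (\<lambda>w. g w - \<mu>) = 0"
          using fin mu by (subst expectation_diff_finite) (auto simp del: replicate_pmf.simps)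
      qed simp
      also have "\<dots> = K / real n"
        using elim \<open>\<delta> > 0\<close> by (simp add: K_def power2_eq_square field_simps)
      finally show ?case .
    qed
  qed
  then show ?thesis
    by (intro tendsto_sandwich[OF _ _ tendsto_const lim_const_over_n[of K]]) auto
qed

lemma window_sum_0: "window_sum 0 g xs = (\<Sum>x\<leftarrow>xs. g [x])"
  by (induction xs rule: rev_induct) (auto simp: window_sum_snoc, simp add: window_sum_def)

lemma iid_weak_law:
  fixes h :: "'a \<Rightarrow> real"
  assumes fin: "finite (set_pmf p)" and "\<delta> > 0"
  shows "(\<lambda>n. Pr (replicate_pmf n p)
           {xs. (\<Sum>x\<leftarrow>xs. h x) \<le> real n * (expect p h - \<delta>)}) \<longlonglongrightarrow> 0"
proof -
  \<comment> \<open>\<open>h\<close> may be unbounded off the support, whereas the weak law wants a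
    bounded function; the change affects only sequences of probability zero.\<close>
  define g where "g w = (if hd w \<in> set_pmf p then h (hd w) else 0)" for w
  define C where "C = (\<Sum>x\<in>set_pmf p. \<bar>h x\<bar>)"
  have C: "\<bar>g w\<bar> \<le> C" for w
    using fin by (auto simp: g_def C_def sum_nonneg intro!: member_le_sum[where f = "\<lambda>x. \<bar>h x\<bar>"])
  have "expect (replicate_pmf (Suc 0) p) g = expect p (\<lambda>x. g [x])"
    using replicate_pmf_1[of p] by simp
  also have "\<dots> = expect p h"
    by (intro expectation_cong_set) (simp add: g_def)
  finally have "(\<lambda>n. Pr (replicate_pmf n p)
      {xs. window_sum 0 g xs \<le> real n * (expect p h - \<delta>)}) \<longlonglongrightarrow> 0"
    by (intro window_weak_law[OF fin C \<open>\<delta> > 0\<close>])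
  moreover have "Pr (replicate_pmf n p)
      {xs. window_sum 0 g xs \<le> real n * (expect p h - \<delta>)}
    = Pr (replicate_pmf n p)
      {xs. (\<Sum>x\<leftarrow>xs. h x) \<le> real n * (expect p h - \<delta>)}" for n
  proof (rule antisym)
    have eq: "window_sum 0 g xs = (\<Sum>x\<leftarrow>xs. h x)" if "xs \<in> set_pmf (replicate_pmf n p)" for xs
      using that by (auto simp: window_sum_0 g_def set_replicate_pmf lists_eq_set intro!: arg_cong[where f=sum_list])
    show "Pr (replicate_pmf n p)
      {xs. window_sum 0 g xs \<le> real n * (expect p h - \<delta>)}
    \<le> Pr (replicate_pmf n p)
      {xs. (\<Sum>x\<leftarrow>xs. h x) \<le> real n * (expect p h - \<delta>)}"
     "Pr (replicate_pmf n p)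
      {xs. (\<Sum>x\<leftarrow>xs. h x) \<le> real n * (expect p h - \<delta>)}
    \<le> Pr (replicate_pmf n p)
      {xs. window_sum 0 g xs \<le> real n * (expect p h - \<delta>)}"
      by (intro prob_mono_set; use eq in simp)+
  qed
  ultimately show ?thesis by simp
qed

section \<open>Exponents of product laws under memoryless and Markov references\<close>

declare replicate_pmf.simps(2) [simp del]

lemma replicate_pmf_Suc_map:
  "replicate_pmf (Suc n) p = map_pmf (\<lambda>(x, xs). x # xs) (pair_pmf p (replicate_pmf n p))"
  by (simp add: replicate_pmf.simps pair_pmf_def map_bind_pmf)

lemma pmf_replicate_pmf:
  "pmf (replicate_pmf n p) xs = (if length xs = n then (\<Prod>x\<leftarrow>xs. pmf p x) else 0)"
proof (induction n arbitrary: xs)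
  case (Suc n)
  have inj: "inj (\<lambda>(x :: 'a, xs). x # xs)" by (auto simp: inj_def)
  show ?case
  proof (cases xs)
    case Nil
    have "[] \<notin> (\<lambda>(x, xs). x # xs) ` set_pmf (pair_pmf p (replicate_pmf n p))" by auto
    then show ?thesis using Nil by (simp add: replicate_pmf_Suc_map pmf_map_outside)
  next
    case (Cons x xs')
    then show ?thesis
      using pmf_map_inj'[OF inj, of "pair_pmf p (replicate_pmf n p)" "(x, xs')"] Suc.IH[of xs']
      by (simp add: replicate_pmf_Suc_map pmf_pair)
  qed
qed (auto simp: indicator_def)

lemma pmf_replicate_snoc:
  "length xs = n \<Longrightarrow> pmf (replicate_pmf (Suc n) p) (xs @ [x]) = pmf (replicate_pmf n p) xs * pmf p x"
  by (simp add: pmf_replicate_pmf)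

text \<open>The half of the asymptotic equipartition property on which the test relies. Quantifying
  over real \<open>D\<close> below \<open>c\<close> covers an infinite divergence too.\<close>

definition aep_lower :: "'a pmf \<Rightarrow> (nat \<Rightarrow> 'a list pmf) \<Rightarrow> ereal \<Rightarrow> bool" where
  "aep_lower p Q c \<longleftrightarrow> (\<forall>D. ereal D < c \<longrightarrow>
     (\<lambda>n. Pr (replicate_pmf n p)
        {xs. pmf (Q n) xs > exp (- (real n * D)) * pmf (replicate_pmf n p) xs}) \<longlonglongrightarrow> 0)"

text \<open>The constant \<open>C\<close> leaves room for the initial segment of a Markov source, on
  which the divergence does not yet grow by a fixed amount per letter.\<close>

definition kl_upper :: "'a pmf \<Rightarrow> (nat \<Rightarrow> 'a list pmf) \<Rightarrow> real \<Rightarrow> bool" where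
  "kl_upper p Q c \<longleftrightarrow> (\<exists>C. \<forall>\<^sub>F n in sequentially.
     set_pmf (replicate_pmf n p) \<subseteq> set_pmf (Q n) \<and> kl (replicate_pmf n p) (Q n) \<le> real n * c + C)"

text \<open>\<open>S\<close> obeys a weak law with mean \<open>\<mu>\<close> and, up to the constant
  \<open>ln B\<close>, bounds the log-likelihood ratio from below.\<close>

lemma aep_lower_step:
  fixes S :: "'a list \<Rightarrow> real"
  assumes lim: "\<And>\<delta>. \<delta> > 0 \<Longrightarrow>
      (\<lambda>n. Pr (replicate_pmf n p) {xs. S xs \<le> real n * (\<mu> - \<delta>)}) \<longlonglongrightarrow> 0"
    and bound: "\<forall>\<^sub>F n in sequentially. \<forall>xs\<in>set_pmf (replicate_pmf n p).
      pmf (Q n) xs * exp (S xs) \<le> B * pmf (replicate_pmf n p) xs"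
    and "B > 0" "D < \<mu>"
  shows "(\<lambda>n. Pr (replicate_pmf n p)
        {xs. pmf (Q n) xs > exp (- (real n * D)) * pmf (replicate_pmf n p) xs}) \<longlonglongrightarrow> 0"
proof -
  \<comment> \<open>Half of the gap between \<open>D\<close> and \<open>\<mu>\<close> goes to the
    deviation of \<open>S\<close>, the other half absorbs the factor \<open>B\<close>.\<close>
  define \<delta> where "\<delta> = (\<mu> - D) / 2"
  have \<delta>: "\<delta> > 0" "\<mu> - \<delta> = D + \<delta>" using \<open>D < \<mu>\<close> by (auto simp: \<delta>_def field_simps)
  have "\<forall>\<^sub>F n in sequentially. real n \<ge> ln B / \<delta>"
    by (rule eventually_sequentiallyI[of "nat \<lceil>ln B / \<delta>\<rceil>"]) linarith
  then have "\<forall>\<^sub>F n in sequentially. Pr (replicate_pmf n p)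
        {xs. pmf (Q n) xs > exp (- (real n * D)) * pmf (replicate_pmf n p) xs}
      \<le> Pr (replicate_pmf n p) {xs. S xs \<le> real n * (\<mu> - \<delta>)}"
    using bound
  proof eventually_elim
    case (elim n)
    have Bn: "B \<le> exp (real n * \<delta>)"
    proof -
      have "ln B \<le> real n * \<delta>" using elim(1) \<delta> by (simp add: field_simps)
      then have "exp (ln B) \<le> exp (real n * \<delta>)" by (rule exp_le_cancel_iff[THEN iffD2])
      then show ?thesis using \<open>B > 0\<close> by simp
    qed
    show ?case
    proof (rule prob_mono_set)
      fix xs assume xs: "xs \<in> set_pmf (replicate_pmf n p)"
        and bad: "xs \<in> {xs. pmf (Q n) xs > exp (- (real n * D)) * pmf (replicate_pmf n p) xs}"
      show "xs \<in> {xs. S xs \<le> real n * (\<mu> - \<delta>)}"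
      proof (rule ccontr)
        assume "\<not> ?thesis"
        then have S: "exp (real n * (D + \<delta>)) \<le> exp (S xs)" using \<delta> by simp
        have "pmf (Q n) xs * exp (real n * (D + \<delta>)) \<le> pmf (Q n) xs * exp (S xs)"
          using S by (intro mult_left_mono) auto
        also have "\<dots> \<le> B * pmf (replicate_pmf n p) xs" using elim(2) xs by auto
        also have "\<dots> \<le> exp (real n * \<delta>) * pmf (replicate_pmf n p) xs"
          using Bn by (intro mult_right_mono) auto
        finally have "pmf (Q n) xs * exp (real n * D) \<le> pmf (replicate_pmf n p) xs"
          by (simp add: ring_distribs exp_add)
        then have "pmf (Q n) xs \<le> exp (- (real n * D)) * pmf (replicate_pmf n p) xs"
          by (simp add: exp_minus field_simps)
        then show False using bad by simp
      qed
    qed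
  qed
  then show ?thesis
    by (intro tendsto_sandwich[OF _ _ tendsto_const lim[OF \<delta>(1)]]) auto
qed

text \<open>
  If \<open>p\<close> charges a letter outside the support of \<open>q\<close>, the log-likelihood ratio of such a letter
  is replaced by a large constant.
\<close>

lemma memoryless_aep_lower:
  assumes fin: "finite (set_pmf p)" and Q: "\<And>n. Q n = replicate_pmf n q"
  shows "aep_lower p Q (rel_entropy p q)"
  unfolding aep_lower_def
proof (intro allI impI)
  fix D assume D: "ereal D < rel_entropy p q"
  let ?f = "\<lambda>x. if x \<in> set_pmf q then ln (pmf p x / pmf q x) else 0"
  define L where "L C x = ?f x + C * (if x \<in> - set_pmf q then 1 else 0)" for C x
  have EL: "expect p (L C)
      = expect p ?f + C * Pr p (- set_pmf q)" for C
    unfolding L_def prob_eq_expectation using fin by (subst expectation_add_finite) auto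
  obtain C where C: "D < expect p (L C)"
  proof (cases "set_pmf p \<subseteq> set_pmf q")
    case True
    have "expect p (L 0) = kl p q"
      unfolding kl_def using True by (intro expectation_cong_set) (auto simp: L_def)
    then show ?thesis using True D that[of 0] by (simp add: rel_entropy_eq)
  next
    case False
    then have pos: "Pr p (- set_pmf q) > 0"
      using measure_pmf_zero_iff[of p "- set_pmf q"] by (auto simp: zero_less_measure_iff)
    \<comment> \<open>This constant raises the mean of \<open>L C\<close> to exactly
      \<open>D + 1\<close>.\<close>
    show ?thesis
      by (rule that[of "(D + 1 - expect p ?f) / Pr p (- set_pmf q)"])
        (use pos in \<open>simp add: EL\<close>)
  qed
  show "(\<lambda>n. Pr (replicate_pmf n p)
        {xs. pmf (Q n) xs > exp (- (real n * D)) * pmf (replicate_pmf n p) xs}) \<longlonglongrightarrow> 0"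
  proof (rule aep_lower_step[where S = "\<lambda>xs. \<Sum>x\<leftarrow>xs. L C x" and B = 1, OF _ _ _ C])
    show "(\<lambda>n. Pr (replicate_pmf n p)
        {xs. (\<Sum>x\<leftarrow>xs. L C x) \<le> real n * (expect p (L C) - \<delta>)}) \<longlonglongrightarrow> 0"
      if "\<delta> > 0" for \<delta>
      using iid_weak_law[OF fin that] .
    have le: "(\<Prod>x\<leftarrow>xs. pmf q x) * exp (\<Sum>x\<leftarrow>xs. L C x) \<le> (\<Prod>x\<leftarrow>xs. pmf p x)"
      if "set xs \<subseteq> set_pmf p" for xs
      using that
    proof (induction xs)
      case (Cons x xs)
      have "pmf q x * exp (L C x) \<le> pmf p x"
        using Cons.prems by (auto simp: L_def set_pmf_iff)
      then have "(pmf q x * exp (L C x)) * ((\<Prod>x\<leftarrow>xs. pmf q x) * exp (\<Sum>x\<leftarrow>xs. L C x))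
          \<le> pmf p x * (\<Prod>x\<leftarrow>xs. pmf p x)"
        using Cons by (intro mult_mono) (auto intro!: mult_nonneg_nonneg prod_list_nonneg)
      then show ?case by (simp add: exp_add mult_ac)
    qed simp
    show "\<forall>\<^sub>F n in sequentially. \<forall>xs\<in>set_pmf (replicate_pmf n p).
        pmf (Q n) xs * exp (\<Sum>x\<leftarrow>xs. L C x) \<le> 1 * pmf (replicate_pmf n p) xs"
      using le by (intro always_eventually) (auto simp: Q pmf_replicate_pmf set_replicate_pmf lists_eq_set)
  qed simp
qed

text \<open>The chain rule of relative entropy with the last letter split off. The factor
  \<open>K\<close> may depend on the past, so memoryless and Markov references are treated alike.
  Support inclusion makes both factors positive, which allows the logarithm to split.\<close>

lemma kl_replicate_Suc:
  assumes fin: "finite (set_pmf p)"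
    and Q: "\<And>xs x. length xs = n \<Longrightarrow> pmf Q' (xs @ [x]) = pmf Q xs * K xs x"
    and sub: "set_pmf (replicate_pmf (Suc n) p) \<subseteq> set_pmf Q'"
  shows "kl (replicate_pmf (Suc n) p) Q' = kl (replicate_pmf n p) Q
    + expect (replicate_pmf n p) (\<lambda>xs. expect p (\<lambda>x. ln (pmf p x / K xs x)))"
proof -
  let ?E = expect
  have "kl (replicate_pmf (Suc n) p) Q'
      = ?E (replicate_pmf n p) (\<lambda>xs. ?E p (\<lambda>x. ln (pmf (replicate_pmf (Suc n) p) (xs @ [x]) / pmf Q' (xs @ [x]))))"
    using fin unfolding kl_def
    by (subst replicate_pmf_Suc_snoc) (simp add: expectation_bind_finite)
  also have "\<dots> = ?E (replicate_pmf n p) (\<lambda>xs. ?E p (\<lambda>x. ln (pmf (replicate_pmf n p) xs / pmf Q xs) + ln (pmf p x / K xs x)))"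
  proof (intro expectation_cong_set)
    fix xs x assume xs: "xs \<in> set_pmf (replicate_pmf n p)" and x: "x \<in> set_pmf p"
    then have len: "length xs = n" by (auto simp: set_replicate_pmf)
    have "xs @ [x] \<in> set_pmf (replicate_pmf (Suc n) p)"
      using xs x by (subst replicate_pmf_Suc_snoc) auto
    then have "0 < pmf Q xs * K xs x"
      using sub Q[OF len] by (auto simp: pmf_positive_iff simp flip: Q[OF len])
    then have "0 < pmf Q xs" "0 < K xs x"
      using pmf_nonneg[of Q xs] by (auto simp: zero_less_mult_iff)
    then have "ln (pmf (replicate_pmf n p) xs * pmf p x / (pmf Q xs * K xs x))
        = ln (pmf (replicate_pmf n p) xs / pmf Q xs) + ln (pmf p x / K xs x)"
      using pmf_positive[OF xs] pmf_positive[OF x] by (subst ln_mult_pos[symmetric]) auto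
    then show "ln (pmf (replicate_pmf (Suc n) p) (xs @ [x]) / pmf Q' (xs @ [x]))
        = ln (pmf (replicate_pmf n p) xs / pmf Q xs) + ln (pmf p x / K xs x)"
      using len by (simp add: pmf_replicate_snoc Q)
  qed
  also have "\<dots> = kl (replicate_pmf n p) Q + ?E (replicate_pmf n p) (\<lambda>xs. ?E p (\<lambda>x. ln (pmf p x / K xs x)))"
    using fin by (simp add: expectation_add_finite kl_def)
  finally show ?thesis .
qed

lemma memoryless_kl_upper:
  assumes fin: "finite (set_pmf p)" and Q: "\<And>n. Q n = replicate_pmf n q" and c: "rel_entropy p q = ereal c"
  shows "kl_upper p Q c"
proof -
  have sub: "set_pmf p \<subseteq> set_pmf q" and c: "c = kl p q"
    using c by (auto simp: rel_entropy_eq split: if_splits)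
  have sub': "set_pmf (replicate_pmf n p) \<subseteq> set_pmf (replicate_pmf n q)" for n
    using sub by (auto simp: set_replicate_pmf)
  have "kl (replicate_pmf n p) (replicate_pmf n q) = real n * kl p q" for n
  proof (induction n)
    case (Suc n)
    have "kl (replicate_pmf (Suc n) p) (replicate_pmf (Suc n) q) = kl (replicate_pmf n p) (replicate_pmf n q) + kl p q"
      using kl_replicate_Suc[OF fin, of n "replicate_pmf (Suc n) q" "replicate_pmf n q" "\<lambda>_. pmf q"] sub'[of "Suc n"]
      by (simp add: pmf_replicate_snoc kl_def)
    then show ?case using Suc by (simp add: algebra_simps)
  qed (simp add: kl_def)
  then show ?thesis using sub' unfolding kl_upper_def Q c by (intro exI[of _ 0]) simp
qed

text \<open>Turns the conditional probabilities of the process into a recursion for its marginals.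
  Pasts of probability zero are covered as well, since both sides vanish there.\<close>

lemma markov_marginals_kernel:
  fixes Q :: "nat \<Rightarrow> 'a::finite list pmf"
  assumes "markov_marginals Q"
  obtains l K where "\<And>n xs x. l \<le> n \<Longrightarrow> length xs = n \<Longrightarrow>
     pmf (Q (Suc n)) (xs @ [x]) = pmf (Q n) xs * pmf (K (drop (n - l) xs)) x"
proof -
  obtain M where M: "finite_order_markov M"
    and QM: "\<And>n. measure_pmf (Q n) = distr M (count_space UNIV) (\<lambda>\<omega>. map \<omega> [0..<n])"
    using assms unfolding markov_marginals_def by blast
  from M obtain l and K :: "'a list \<Rightarrow> 'a pmf" where "prob_space M"
    and sets: "sets M = sets (PiM UNIV (\<lambda>_. count_space UNIV))"
    and K: "\<And>n xs a. n \<ge> l \<Longrightarrow> length xs = n \<Longrightarrow> \<P>(\<omega> in M. map \<omega> [0..<n] = xs) > 0 \<Longrightarrow>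
        \<P>(\<omega> in M. \<omega> n = a \<bar> map \<omega> [0..<n] = xs) = pmf (K (drop (n - l) xs)) a"
    unfolding finite_order_markov_def by blast
  interpret prob_space M by fact
  have comp: "(\<lambda>\<omega>. \<omega> i) \<in> M \<rightarrow>\<^sub>M count_space UNIV" for i
    using measurable_component_singleton[of i UNIV "\<lambda>_. count_space (UNIV :: 'a set)"]
    by (simp add: measurable_cong_sets[OF sets refl])
  have meas: "{\<omega> \<in> space M. map \<omega> [0..<n] = xs} \<in> sets M" for n xs
  proof (cases "length xs = n")
    case True
    have "{\<omega> \<in> space M. map \<omega> [0..<n] = xs} = {\<omega> \<in> space M. \<forall>i\<in>{..<n}. \<omega> i = xs ! i}"
      using True by (auto simp: list_eq_iff_nth_eq)
    also have "\<dots> \<in> sets M"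
    proof (rule sets.sets_Collect_finite_All)
      fix i assume "i \<in> {..<n}"
      have "(\<lambda>\<omega>. \<omega> i) -` {xs ! i} \<inter> space M \<in> sets M"
        by (rule measurable_sets[OF comp]) simp
      also have "(\<lambda>\<omega>. \<omega> i) -` {xs ! i} \<inter> space M = {\<omega> \<in> space M. \<omega> i = xs ! i}" by auto
      finally show "{\<omega> \<in> space M. \<omega> i = xs ! i} \<in> sets M" .
    qed auto
    finally show ?thesis .
  next
    case False
    then have "{\<omega> \<in> space M. map \<omega> [0..<n] = xs} = {}" by auto
    then show ?thesis by (simp only: sets.empty_sets)
  qed
  have mapm: "(\<lambda>\<omega>. map \<omega> [0..<n]) \<in> M \<rightarrow>\<^sub>M count_space UNIV" for n
  proof (subst measurable_count_space_eq2_countable)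
    show "(\<lambda>\<omega>. map \<omega> [0..<n]) \<in> space M \<rightarrow> UNIV \<and>
      (\<forall>a\<in>UNIV. (\<lambda>\<omega>. map \<omega> [0..<n]) -` {a} \<inter> space M \<in> sets M)"
      using meas[of n] by (auto simp: vimage_def Int_def conj_commute)
  qed
  have pQ: "pmf (Q n) xs = \<P>(\<omega> in M. map \<omega> [0..<n] = xs)" for n xs
  proof -
    have "pmf (Q n) xs = measure (distr M (count_space UNIV) (\<lambda>\<omega>. map \<omega> [0..<n])) {xs}"
      by (simp add: measure_pmf_single flip: QM)
    also have "\<dots> = measure M ((\<lambda>\<omega>. map \<omega> [0..<n]) -` {xs} \<inter> space M)"
      by (rule measure_distr[OF mapm]) simp
    finally show ?thesis by (simp add: vimage_def Int_def conj_commute)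
  qed
  show thesis
  proof (rule that[of l K])
    fix n and xs :: "'a list" and x assume n: "l \<le> n" "length xs = n"
    have eq: "{\<omega> \<in> space M. map \<omega> [0..<Suc n] = xs @ [x]}
        = {\<omega> \<in> space M. \<omega> n = x \<and> map \<omega> [0..<n] = xs}" using n by (intro Collect_cong) auto
    show "pmf (Q (Suc n)) (xs @ [x]) = pmf (Q n) xs * pmf (K (drop (n - l) xs)) x"
    proof (cases "pmf (Q n) xs > 0")
      case True
      then have pos: "\<P>(\<omega> in M. map \<omega> [0..<n] = xs) > 0" by (simp only: pQ)
      have "\<P>(\<omega> in M. \<omega> n = x \<and> map \<omega> [0..<n] = xs) / \<P>(\<omega> in M. map \<omega> [0..<n] = xs)
          = pmf (K (drop (n - l) xs)) x"
        using K[OF n pos, of x] by (simp only: cond_prob_def)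
      moreover have "a = b * c" if "a / b = c" "b > 0" for a b c :: real
        using that by auto
      ultimately show ?thesis
        using pos unfolding pQ eq by blast
    next
      case False
      then have 0: "pmf (Q n) xs = 0" using pmf_pos[of "Q n" xs] by blast
      have "pmf (Q (Suc n)) (xs @ [x]) \<le> pmf (Q n) xs"
        unfolding pQ eq by (rule finite_measure_mono[OF _ meas]) auto
      then have "pmf (Q (Suc n)) (xs @ [x]) = 0"
        using 0 by simp
      then show ?thesis using 0 by simp
    qed
  qed
qed

text \<open>From block length \<open>l\<close> on, each further letter adds the same amount
  \<open>c\<close>: under the product law the last \<open>l\<close> letters always have the same
  distribution, whatever came before. The increments are therefore eventually constant, and up to a
  bounded factor the likelihood ratio is the exponential of a window sum with mean \<open>c\<close>
  per letter.\<close>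

lemma markov_source:
  fixes Q :: "nat \<Rightarrow> 'a::finite list pmf"
  assumes "markov_marginals Q" and sub: "\<And>n. set_pmf (replicate_pmf n p) \<subseteq> set_pmf (Q n)"
  obtains c where "lim (divergence_increment p Q) = ereal c" "aep_lower p Q (ereal c)" "kl_upper p Q c"
proof -
  let ?E = expect
  obtain l K where K: "\<And>n xs x. l \<le> n \<Longrightarrow> length xs = n \<Longrightarrow>
     pmf (Q (Suc n)) (xs @ [x]) = pmf (Q n) xs * pmf (K (drop (n - l) xs)) x"
    using markov_marginals_kernel[OF assms(1)] by blast
  have fin: "finite (set_pmf p)" by simp
  define G where "G w = ln (pmf p (last w) / pmf (K (butlast w)) (last w))" for w
  \<comment> \<open>Only finitely many words have length \<open>Suc l\<close>, so cutting off the
    other lengths makes \<open>g\<close> bounded.\<close>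
  define g where "g w = (if length w = Suc l then G w else 0)" for w
  define c where "c = ?E (replicate_pmf (Suc l) p) g"
  define C where "C = (\<Sum>w\<in>{w. length w = Suc l}. \<bar>G w\<bar>)"
  have finw: "finite {w :: 'a list. length w = Suc l}"
    using finite_lists_length_eq[of "UNIV :: 'a set" "Suc l"] by simp
  have C: "\<bar>g w\<bar> \<le> C" for w
    using finw by (auto simp: g_def C_def sum_nonneg intro!: member_le_sum[where f = "\<lambda>x. \<bar>G x\<bar>"])
  have gG: "g (drop (n - l) xs @ [x]) = ln (pmf p x / pmf (K (drop (n - l) xs)) x)"
    if "l \<le> n" "length xs = n" for n xs x
    using that by (simp add: g_def G_def)
  have step: "kl (replicate_pmf (Suc n) p) (Q (Suc n)) = kl (replicate_pmf n p) (Q n) + c" if "l \<le> n" for n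
  proof -
    have nl: "replicate_pmf n p
      = bind_pmf (replicate_pmf (n - l) p) (\<lambda>ys. map_pmf (\<lambda>zs. ys @ zs) (replicate_pmf l p))"
      using replicate_pmf_distrib[of "n - l" l p] that by (simp add: map_pmf_def)
    have "kl (replicate_pmf (Suc n) p) (Q (Suc n)) = kl (replicate_pmf n p) (Q n)
        + ?E (replicate_pmf n p) (\<lambda>xs. ?E p (\<lambda>x. ln (pmf p x / pmf (K (drop (n - l) xs)) x)))"
      using K[OF that] sub by (intro kl_replicate_Suc[OF fin]) auto
    also have "?E (replicate_pmf n p) (\<lambda>xs. ?E p (\<lambda>x. ln (pmf p x / pmf (K (drop (n - l) xs)) x)))
        = ?E (replicate_pmf n p) (\<lambda>xs. ?E p (\<lambda>x. g (drop (n - l) xs @ [x])))"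
      using gG[OF that] by (intro expectation_cong_set) (auto simp: set_replicate_pmf)
    also have "\<dots> = ?E (replicate_pmf (n - l) p) (\<lambda>ys. ?E (replicate_pmf l p) (\<lambda>zs. ?E p (\<lambda>x. g (drop (n - l) (ys @ zs) @ [x]))))"
      by (subst nl) (simp add: expectation_bind_finite)
    also have "\<dots> = ?E (replicate_pmf (n - l) p) (\<lambda>ys. ?E (replicate_pmf l p) (\<lambda>zs. ?E p (\<lambda>x. g (zs @ [x]))))"
      by (intro expectation_cong_set) (auto simp: set_replicate_pmf)
    also have "\<dots> = c"
      unfolding c_def by (simp only: replicate_pmf_Suc_snoc) (simp add: expectation_bind_finite)
    finally show ?thesis .
  qed
  have "divergence_increment p Q n = ereal c" if "l \<le> n" for n
    using step[OF that] sub[of n] sub[of "Suc n"]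
    by (simp add: divergence_increment_def rel_entropy_eq)
  then have "divergence_increment p Q \<longlonglongrightarrow> ereal c"
    by (intro tendsto_eventually eventually_sequentiallyI[of l])
  then have 1: "lim (divergence_increment p Q) = ereal c" by (rule limI)
  have kl_add: "kl (replicate_pmf (l + d) p) (Q (l + d)) = kl (replicate_pmf l p) (Q l) + real d * c" for d
    by (induction d) (auto simp: step algebra_simps)
  have kl_eq: "kl (replicate_pmf n p) (Q n) = kl (replicate_pmf l p) (Q l) + real (n - l) * c" if "l \<le> n" for n
    using that kl_add[of "n - l"] by simp
  have 2: "kl_upper p Q c"
    unfolding kl_upper_def
  proof (intro exI eventually_sequentiallyI[of l] conjI sub)
    fix n assume "l \<le> n"
    then show "kl (replicate_pmf n p) (Q n) \<le> real n * c + (kl (replicate_pmf l p) (Q l) - real l * c)"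
      using kl_eq by (simp add: of_nat_diff algebra_simps)
  qed
  \<comment> \<open>The window sum ignores the first \<open>l\<close> letters. Their
    \<open>Q\<close> probability is at most 1, while \<open>B\<close> times their product
    probability is at least 1.\<close>
  define B where "B = (\<Sum>xs\<in>set_pmf (replicate_pmf l p). 1 / pmf (replicate_pmf l p) xs)"
  have B0: "B > 0"
    unfolding B_def using fin set_pmf_not_empty by (intro sum_pos) (auto simp: pmf_positive_iff)
  have bound: "pmf (Q (l + d)) xs * exp (window_sum l g xs) \<le> B * pmf (replicate_pmf (l + d) p) xs"
    if "xs \<in> set_pmf (replicate_pmf (l + d) p)" for d xs
    using that
  proof (induction d arbitrary: xs)
    case 0
    then have xs: "xs \<in> set_pmf (replicate_pmf l p)" "length xs = l" by (auto simp: set_replicate_pmf)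
    have "1 / pmf (replicate_pmf l p) xs \<le> B"
      unfolding B_def using xs fin by (intro member_le_sum) auto
    then have "1 \<le> B * pmf (replicate_pmf l p) xs"
      using xs by (simp add: pmf_positive_iff field_simps)
    then show ?case using xs pmf_le_1[of "Q l" xs] by (simp add: window_sum_def)
  next
    case (Suc d)
    let ?n = "l + d"
    obtain ys x where xs: "xs = ys @ [x]" and ys: "ys \<in> set_pmf (replicate_pmf ?n p)" and x: "x \<in> set_pmf p"
      using Suc.prems by (simp only: add_Suc_right replicate_pmf_Suc_snoc) auto
    have len: "length ys = ?n" using ys by (auto simp: set_replicate_pmf)
    have "xs \<in> set_pmf (Q (Suc ?n))" using Suc.prems sub[of "Suc ?n"] by auto
    then have "pmf (Q (Suc ?n)) (ys @ [x]) > 0" by (simp add: xs pmf_positive_iff)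
    then have Kpos: "pmf (K (drop (?n - l) ys)) x > 0"
      using K[of ?n ys x] len by (auto simp: zero_less_mult_iff)
    have ppos: "pmf p x > 0" using x by (simp add: pmf_positive_iff)
    have "pmf (Q (Suc ?n)) xs * exp (window_sum l g xs)
        = (pmf (Q ?n) ys * exp (window_sum l g ys)) * (pmf (K (drop (?n - l) ys)) x * exp (g (drop (?n - l) ys @ [x])))"
      using len K[of ?n ys x] by (simp add: xs window_sum_snoc exp_add)
    also have "pmf (K (drop (?n - l) ys)) x * exp (g (drop (?n - l) ys @ [x])) = pmf p x"
      using gG[of ?n ys x] len Kpos ppos by simp
    also have "(pmf (Q ?n) ys * exp (window_sum l g ys)) * pmf p x \<le> (B * pmf (replicate_pmf ?n p) ys) * pmf p x"
      using Suc.IH[OF ys] by (intro mult_right_mono) auto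
    also have "\<dots> = B * pmf (replicate_pmf (Suc ?n) p) xs"
      using len by (simp add: xs pmf_replicate_snoc)
    finally show ?case by simp
  qed
  have 3: "aep_lower p Q (ereal c)"
    unfolding aep_lower_def
  proof (intro allI impI)
    fix D assume "ereal D < ereal c"
    then have D: "D < c" by simp
    show "(\<lambda>n. Pr (replicate_pmf n p)
        {xs. pmf (Q n) xs > exp (- (real n * D)) * pmf (replicate_pmf n p) xs}) \<longlonglongrightarrow> 0"
    proof (rule aep_lower_step[OF window_weak_law[OF fin C _ c_def[symmetric]] _ B0 D])
      show "\<forall>\<^sub>F n in sequentially. \<forall>xs\<in>set_pmf (replicate_pmf n p).
          pmf (Q n) xs * exp (window_sum l g xs) \<le> B * pmf (replicate_pmf n p) xs"
      proof (intro eventually_sequentiallyI[of l] ballI)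
        fix n xs assume "l \<le> n" "xs \<in> set_pmf (replicate_pmf n p)"
        then show "pmf (Q n) xs * exp (window_sum l g xs) \<le> B * pmf (replicate_pmf n p) xs"
          using bound[of xs "n - l"] by simp
      qed
    qed
  qed
  show thesis using that 1 2 3 by blast
qed

section \<open>Covering codes\<close>

lemma prob_le_ratio:
  assumes "c \<ge> 0" and le: "\<And>x. x \<in> A \<Longrightarrow> pmf p x \<le> c * pmf q x"
  shows "Pr p A \<le> c * Pr q A"
proof -
  have "emeasure (measure_pmf p) A = (\<integral>\<^sup>+ x. ennreal (pmf p x) * indicator A x \<partial>count_space UNIV)"
    by (simp flip: nn_integral_measure_pmf)
  also have "\<dots> \<le> (\<integral>\<^sup>+ x. ennreal c * (ennreal (pmf q x) * indicator A x) \<partial>count_space UNIV)"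
    using le \<open>c \<ge> 0\<close> by (intro nn_integral_mono) (auto simp: indicator_def ennreal_mult[symmetric])
  also have "\<dots> = ennreal c * emeasure (measure_pmf q) A"
    by (subst nn_integral_cmult) (auto simp flip: nn_integral_measure_pmf)
  finally have "ennreal (Pr p A) \<le> ennreal (c * Pr q A)"
    using \<open>c \<ge> 0\<close> by (simp add: measure_pmf.emeasure_eq_measure ennreal_mult)
  then show ?thesis using \<open>c \<ge> 0\<close> by simp
qed

lemma expectation_swap:
  fixes f :: "'a \<Rightarrow> 'b \<Rightarrow> real"
  assumes "finite (set_pmf p)" "finite (set_pmf q)"
  shows "expect p (\<lambda>x. expect q (f x))
       = expect q (\<lambda>y. expect p (\<lambda>x. f x y))"
proof -
  have 1: "expect p g = (\<Sum>x\<in>set_pmf p. g x * pmf p x)" for g :: "'a \<Rightarrow> real"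
    using assms by (intro integral_measure_pmf_real) auto
  have 2: "expect q g = (\<Sum>x\<in>set_pmf q. g x * pmf q x)" for g :: "'b \<Rightarrow> real"
    using assms by (intro integral_measure_pmf_real) auto
  show ?thesis
    unfolding 1 2 sum_distrib_right by (subst sum.swap) (simp add: mult_ac)
qed

lemma exists_le_expectation:
  fixes f :: "'a \<Rightarrow> real"
  assumes fin: "finite (set_pmf p)"
  obtains x where "x \<in> set_pmf p" "f x \<le> expect p f"
proof -
  have ne: "f ` set_pmf p \<noteq> {}" "finite (f ` set_pmf p)" using fin set_pmf_not_empty by auto
  obtain x where x: "x \<in> set_pmf p" "f x = Min (f ` set_pmf p)" using Min_in[OF ne(2,1)] by force
  then have "expect p (\<lambda>_. f x) \<le> expect p f"
    using ne by (intro expectation_mono_set fin) auto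
  then show thesis using that x by simp
qed

text \<open>Random coding, derandomised. Codewords from \<open>q\<close> are fixed one at a time,
  each no worse than average for the mass expected to remain uncovered after the draws still to
  come. Arbitrary weights \<open>w\<close> allow the induction to delete points already
  covered.\<close>

lemma greedy_cover:
  fixes w :: "'a \<Rightarrow> real" and q :: "'b pmf"
  assumes fin: "finite A" "finite (set_pmf q)" and w: "\<And>a. a \<in> A \<Longrightarrow> 0 \<le> w a"
  shows "\<exists>B. finite B \<and> card B \<le> M \<and>
    (\<Sum>a\<in>A. if \<forall>b\<in>B. (a, b) \<notin> G then w a else 0) \<le> (\<Sum>a\<in>A. w a * (1 - Pr q {b. (a, b) \<in> G}) ^ M)"
  using w
proof (induction M arbitrary: w)
  case 0
  then show ?case by (intro exI[of _ "{}"]) simp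
next
  case (Suc M)
  let ?r = "\<lambda>a. Pr q {b. (a, b) \<in> G}"
  let ?f = "\<lambda>b. \<Sum>a\<in>A. w a * (1 - ?r a) ^ M * (if (a, b) \<in> - G then 1 else 0)"
  obtain b where b: "?f b \<le> expect q ?f"
    by (rule exists_le_expectation[OF fin(2), of ?f])
  have "expect q ?f
      = (\<Sum>a\<in>A. w a * (1 - ?r a) ^ M * expect q (\<lambda>b. if b \<in> - {b. (a, b) \<in> G} then 1 else 0))"
    using fin by (subst expectation_sum_finite) auto
  also have "\<dots> = (\<Sum>a\<in>A. w a * (1 - ?r a) ^ Suc M)"
    unfolding prob_eq_expectation[symmetric]
    by (simp add: measure_pmf.prob_compl[of "{b. (a, b) \<in> G}" for a, simplified] Compl_eq_Diff_UNIV mult_ac)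
  finally have fb: "?f b \<le> (\<Sum>a\<in>A. w a * (1 - ?r a) ^ Suc M)" using b by simp
  let ?w = "\<lambda>a. if (a, b) \<in> G then 0 else w a"
  have "\<exists>B. finite B \<and> card B \<le> M \<and>
    (\<Sum>a\<in>A. if \<forall>b\<in>B. (a, b) \<notin> G then ?w a else 0) \<le> (\<Sum>a\<in>A. ?w a * (1 - ?r a) ^ M)"
    by (rule Suc.IH) (use Suc.prems in simp)
  then obtain B where B: "finite B" "card B \<le> M"
    "(\<Sum>a\<in>A. if \<forall>b\<in>B. (a, b) \<notin> G then ?w a else 0) \<le> (\<Sum>a\<in>A. ?w a * (1 - ?r a) ^ M)"
    by (elim exE conjE)
  have "(\<Sum>a\<in>A. ?w a * (1 - ?r a) ^ M) = ?f b"
    by (intro sum.cong) auto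
  moreover have "(\<Sum>a\<in>A. if \<forall>b\<in>insert b B. (a, b) \<notin> G then w a else 0)
      = (\<Sum>a\<in>A. if \<forall>b\<in>B. (a, b) \<notin> G then ?w a else 0)"
    by (intro sum.cong) auto
  ultimately show ?case
    using B fb by (intro exI[of _ "insert b B"]) (auto simp: card_insert_if)
qed

text \<open>The estimate \<open>(1 - x * y)^M <= 1 - x + exp (- M * y)\<close> of the covering
  lemma, with \<open>x = r\<close> and \<open>y = 1 / c\<close>. It comes from
  \<open>1 - t <= exp (- t)\<close> and convexity of the exponential.\<close>

lemma one_minus_power_le:
  fixes r t c :: real
  assumes "0 \<le> r" "r \<le> 1" "r \<le> c * t" "t \<le> 1" "c > 0"
  shows "(1 - t) ^ M \<le> 1 - r + exp (- (real M / c))"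
proof -
  have "(1 - t) ^ M \<le> exp (- t) ^ M"
    using assms exp_ge_add_one_self[of "- t"] by (intro power_mono) auto
  also have "\<dots> = exp (- (real M * t))" by (simp add: exp_of_nat_mult[symmetric])
  also have "\<dots> \<le> exp (- (real M * (r / c)))"
    using assms by (simp only: exp_le_cancel_iff neg_le_iff_le)
      (intro mult_left_mono; simp add: divide_le_eq mult.commute)
  also have "\<dots> = exp ((1 - r) *\<^sub>R 0 + r *\<^sub>R (- (real M / c)))" by simp
  also have "\<dots> \<le> (1 - r) * exp 0 + r * exp (- (real M / c))"
    using assms exp_convex by (intro convex_onD[OF exp_convex]) auto
  also have "\<dots> \<le> 1 - r + exp (- (real M / c))"
    using assms mult_right_mono[of r 1 "exp (- (real M / c))"] by simp
  finally show ?thesis .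
qed

abbreviation joint :: "'a pmf \<Rightarrow> ('a \<Rightarrow> 'b pmf) \<Rightarrow> ('a \<times> 'b) pmf" where
  "joint p W \<equiv> bind_pmf p (\<lambda>a. map_pmf (Pair a) (W a))"

text \<open>On \<open>G\<close> the density ratio is at most \<open>c\<close>, so a draw from
  \<open>q\<close> falls into the section of \<open>G\<close> at \<open>a\<close> with at least
  \<open>1 / c\<close> times its probability under \<open>W a\<close>. A codebook somewhat larger
  than \<open>c\<close> therefore fails with little more than the probability of
  \<open>- G\<close>.\<close>

lemma covering:
  fixes p :: "'a pmf" and q :: "'b pmf" and W :: "'a \<Rightarrow> 'b pmf"
  assumes fin: "finite (set_pmf p)" "finite (set_pmf q)" "\<And>a. finite (set_pmf (W a))"
    and c: "c > 0" "\<And>a b. (a, b) \<in> G \<Longrightarrow> pmf (W a) b \<le> c * pmf q b"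
  obtains B where "finite B" "card B \<le> M"
    "Pr p {a. \<forall>b\<in>B. (a, b) \<notin> G} \<le> Pr (joint p W) (- G) + exp (- (real M / c))"
proof -
  let ?t = "\<lambda>a. Pr q {b. (a, b) \<in> G}" and ?r = "\<lambda>a. Pr (W a) {b. (a, b) \<in> G}"
  obtain B where B: "finite B" "card B \<le> M"
    "(\<Sum>a\<in>set_pmf p. if \<forall>b\<in>B. (a, b) \<notin> G then pmf p a else 0) \<le> (\<Sum>a\<in>set_pmf p. pmf p a * (1 - ?t a) ^ M)"
    using greedy_cover[OF fin(1,2), of "pmf p" M G] by auto
  have "Pr p {a. \<forall>b\<in>B. (a, b) \<notin> G} = (\<Sum>a\<in>set_pmf p. if \<forall>b\<in>B. (a, b) \<notin> G then pmf p a else 0)"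
    unfolding prob_eq_expectation using fin
    by (subst integral_measure_pmf_real[where A = "set_pmf p"]) (auto intro!: sum.cong)
  also have "\<dots> \<le> (\<Sum>a\<in>set_pmf p. pmf p a * (1 - ?t a) ^ M)" by fact
  also have "\<dots> \<le> (\<Sum>a\<in>set_pmf p. pmf p a * (1 - ?r a + exp (- (real M / c))))"
    using c by (intro sum_mono mult_left_mono one_minus_power_le prob_le_ratio) auto
  also have "\<dots> = (\<Sum>a\<in>set_pmf p. pmf p a * (1 - ?r a)) + exp (- (real M / c))"
    using sum_pmf_eq_1[OF fin(1)] by (simp add: distrib_left sum.distrib flip: sum_distrib_right)
  also have "(\<Sum>a\<in>set_pmf p. pmf p a * (1 - ?r a)) = Pr (joint p W) (- G)"
  proof -
    have "Pr (joint p W) (- G) = expect p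
       (\<lambda>a. expect (W a) (\<lambda>b. if b \<in> - {b. (a, b) \<in> G} then 1 else 0))"
      unfolding prob_eq_expectation using fin by (simp add: expectation_bind_finite)
    also have "\<dots> = expect p (\<lambda>a. 1 - ?r a)"
      unfolding prob_eq_expectation[symmetric]
      by (simp add: measure_pmf.prob_compl[of "{b. (a, b) \<in> G}" for a, simplified] Compl_eq_Diff_UNIV)
    also have "\<dots> = (\<Sum>a\<in>set_pmf p. (1 - ?r a) * pmf p a)"
      using fin by (intro integral_measure_pmf_real) auto
    finally show ?thesis by (simp add: mult.commute)
  qed
  finally show thesis using that B by blast
qed

text \<open>
  Markov's inequality with respect to \<open>y\<close>: it transfers an estimate for \<open>(y, u)\<close>, with \<open>u\<close>
  drawn at random from \<open>W x\<close>, to every \<open>u\<close> that is good for \<open>x\<close>, however it was chosen.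
\<close>

lemma markov_split:
  fixes R :: "('b \<times> 'a) pmf" and W :: "'a \<Rightarrow> 'u pmf"
  assumes fin: "finite (set_pmf R)" "\<And>a. finite (set_pmf (W a))" and "\<eta> > 0"
  shows "Pr (joint (map_pmf snd R) W)
      {(x, u). Pr R {(y, x'). x' = x \<and> (y, u) \<in> N} > \<eta> * pmf (map_pmf snd R) x}
    \<le> Pr (joint R (\<lambda>z. W (snd z))) {(z, u). (fst z, u) \<in> N} / \<eta>"
proof -
  let ?E = expect and ?s = "map_pmf snd R"
  let ?b = "\<lambda>x u. Pr R {(y, x'). x' = x \<and> (y, u) \<in> N}"
  let ?i = "\<lambda>x z u. if snd z = x \<and> (fst z, u) \<in> N then 1 else 0 :: real"
  have b: "?b x u = ?E R (\<lambda>z. ?i x z u)" for x u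
    unfolding prob_eq_expectation by (intro expectation_cong_set) (auto simp: case_prod_beta)
  have fs: "finite (set_pmf ?s)" using fin by simp
  have "Pr (joint ?s W) {(x, u). ?b x u > \<eta> * pmf ?s x}
      = ?E ?s (\<lambda>x. ?E (W x) (\<lambda>u. if ?b x u > \<eta> * pmf ?s x then 1 else 0))"
    unfolding prob_eq_expectation[of "joint ?s W"] using fs fin(2) by (subst expectation_bind_finite) auto
  also have "\<dots> = (\<Sum>x\<in>set_pmf ?s. ?E (W x) (\<lambda>u. if ?b x u > \<eta> * pmf ?s x then 1 else 0) * pmf ?s x)"
    using fs by (intro integral_measure_pmf_real) auto
  also have "\<dots> \<le> (\<Sum>x\<in>set_pmf ?s. ?E (W x) (\<lambda>u. ?b x u / \<eta>))"
  proof (rule sum_mono)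
    fix x
    have "?E (W x) (\<lambda>u. if ?b x u > \<eta> * pmf ?s x then 1 else 0) * pmf ?s x
        = ?E (W x) (\<lambda>u. (if ?b x u > \<eta> * pmf ?s x then 1 else 0) * pmf ?s x)"
      by simp
    also have "\<dots> \<le> ?E (W x) (\<lambda>u. ?b x u / \<eta>)"
      using fin(2) \<open>\<eta> > 0\<close> by (intro expectation_mono_set) (auto simp: field_simps)
    finally show "?E (W x) (\<lambda>u. if ?b x u > \<eta> * pmf ?s x then 1 else 0) * pmf ?s x \<le> \<dots>" .
  qed
  also have "\<dots> = (\<Sum>x\<in>set_pmf ?s. ?E (W x) (\<lambda>u. ?E R (\<lambda>z. ?i x z u))) / \<eta>"
    by (simp add: b sum_divide_distrib)
  also have "(\<Sum>x\<in>set_pmf ?s. ?E (W x) (\<lambda>u. ?E R (\<lambda>z. ?i x z u)))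
      = ?E R (\<lambda>z. \<Sum>x\<in>set_pmf ?s. ?E (W x) (\<lambda>u. ?i x z u))"
    using fin by (subst expectation_sum_finite) (auto intro!: sum.cong expectation_swap)
  also have "\<dots> = ?E R (\<lambda>z. ?E (W (snd z)) (\<lambda>u. if (fst z, u) \<in> N then 1 else 0))"
  proof (rule expectation_cong_set)
    fix z assume z: "z \<in> set_pmf R"
    have "(\<Sum>x\<in>set_pmf ?s. ?E (W x) (\<lambda>u. ?i x z u))
        = (\<Sum>x\<in>set_pmf ?s. if snd z = x then ?E (W x) (\<lambda>u. if (fst z, u) \<in> N then 1 else 0) else 0)"
      by (intro sum.cong) auto
    also have "\<dots> = ?E (W (snd z)) (\<lambda>u. if (fst z, u) \<in> N then 1 else 0)"
      using z fs by (subst sum.delta') auto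
    finally show "(\<Sum>x\<in>set_pmf ?s. ?E (W x) (\<lambda>u. ?i x z u)) = \<dots>" .
  qed
  also have "\<dots> = Pr (joint R (\<lambda>z. W (snd z))) {(z, u). (fst z, u) \<in> N}"
    unfolding prob_eq_expectation using fin by (simp add: expectation_bind_finite)
  finally show ?thesis .
qed

section \<open>Product kernels, information densities and source codes\<close>

fun kernel_list :: "('a \<Rightarrow> 'b pmf) \<Rightarrow> 'a list \<Rightarrow> 'b list pmf" where
  "kernel_list W [] = return_pmf []"
| "kernel_list W (x # xs) = map_pmf (\<lambda>(u, us). u # us) (pair_pmf (W x) (kernel_list W xs))"

lemma finite_set_kernel_list:
  "(\<And>x. finite (set_pmf (W x))) \<Longrightarrow> finite (set_pmf (kernel_list W xs))"
  by (induction xs) auto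

lemma pmf_kernel_list_Cons:
  "pmf (kernel_list W (x # xs)) (u # us) = pmf (W x) u * pmf (kernel_list W xs) us"
proof -
  have "inj (\<lambda>(x :: 'a, xs). x # xs)" by (auto simp: inj_def)
  from pmf_map_inj'[OF this, of "pair_pmf (W x) (kernel_list W xs)" "(u, us)"]
  show ?thesis by (simp add: pmf_pair)
qed

text \<open>Drawing independent pairs amounts to drawing the source block first and passing it
  through the kernel letter by letter. The map \<open>f\<close> lets the kernel see only part of a
  source letter, as when \<open>u\<close> is generated from the \<open>x\<close> of a pair
  \<open>(y, x)\<close>.\<close>

lemma replicate_joint:
  "map_pmf (\<lambda>zs. (map fst zs, map snd zs)) (replicate_pmf n (joint p (\<lambda>a. W (f a))))
   = joint (replicate_pmf n p) (\<lambda>as. kernel_list W (map f as))"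
proof (induction n)
  case (Suc n)
  let ?J = "joint p (\<lambda>a. W (f a))"
  have "map_pmf (\<lambda>zs. (map fst zs, map snd zs)) (replicate_pmf (Suc n) ?J)
      = bind_pmf ?J (\<lambda>z. map_pmf (\<lambda>(xs, us). (fst z # xs, snd z # us))
          (map_pmf (\<lambda>zs. (map fst zs, map snd zs)) (replicate_pmf n ?J)))"
    by (simp add: replicate_pmf.simps map_bind_pmf map_pmf_comp flip: map_pmf_def)
  also have "\<dots> = bind_pmf p (\<lambda>a. bind_pmf (W (f a)) (\<lambda>u. bind_pmf (replicate_pmf n p)
      (\<lambda>as. map_pmf (\<lambda>us. (a # as, u # us)) (kernel_list W (map f as)))))"
    unfolding Suc.IH by (simp add: bind_assoc_pmf bind_map_pmf map_bind_pmf map_pmf_comp)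
  also have "\<dots> = bind_pmf p (\<lambda>a. bind_pmf (replicate_pmf n p) (\<lambda>as. bind_pmf (W (f a))
      (\<lambda>u. map_pmf (\<lambda>us. (a # as, u # us)) (kernel_list W (map f as)))))"
    by (subst bind_commute_pmf) simp
  also have "\<dots> = joint (replicate_pmf (Suc n) p) (\<lambda>as. kernel_list W (map f as))"
    by (simp add: replicate_pmf.simps pair_pmf_def bind_assoc_pmf bind_return_pmf map_bind_pmf
        map_pmf_def)
  finally show ?case .
qed (simp add: bind_return_pmf)

lemma replicate_map_pmf: "replicate_pmf n (map_pmf f p) = map_pmf (map f) (replicate_pmf n p)"
  by (induction n) (simp_all add: replicate_pmf.simps map_pmf_def bind_assoc_pmf bind_return_pmf)

definition info_density :: "('a \<times> 'b) pmf \<Rightarrow> 'a \<times> 'b \<Rightarrow> real" where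
  "info_density J z = ln (pmf J z / (pmf (map_pmf fst J) (fst z) * pmf (map_pmf snd J) (snd z)))"

definition minfo :: "('a \<times> 'b) pmf \<Rightarrow> real" where
  "minfo J = expect J (info_density J)"

lemma mutual_info_eq_minfo: "mutual_info J = ereal (minfo J)"
  unfolding mutual_info_eq minfo_def by (auto simp: info_density_def intro!: expectation_cong_set)

text \<open>The reverse channel from \<open>u\<close> to \<open>y\<close>. At \<open>b\<close> of
  probability zero it is some unspecified law, which is harmless: the false alarm bound uses only
  that it is a probability law.\<close>

definition cond_law :: "('a \<times> 'b) pmf \<Rightarrow> 'b \<Rightarrow> 'a pmf" where
  "cond_law J b = map_pmf fst (cond_pmf J {z. snd z = b})"

lemma pmf_marginal_pos:
  assumes "z \<in> set_pmf J"
  shows "pmf (map_pmf fst J) (fst z) > 0" "pmf (map_pmf snd J) (snd z) > 0"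
  using assms by (auto simp: pmf_positive_iff)

lemma exp_info_density:
  assumes "z \<in> set_pmf J"
  shows "exp (info_density J z) = pmf J z / (pmf (map_pmf fst J) (fst z) * pmf (map_pmf snd J) (snd z))"
  using assms pmf_marginal_pos[OF assms] by (simp add: info_density_def pmf_positive)

lemma pmf_cond_law:
  assumes "z \<in> set_pmf J"
  shows "pmf (cond_law J (snd z)) (fst z) = exp (info_density J z) * pmf (map_pmf fst J) (fst z)"
proof -
  let ?S = "{z'. snd z' = snd z}"
  have ne: "set_pmf J \<inter> ?S \<noteq> {}" using assms by auto
  have "pmf (cond_law J (snd z)) (fst z) = Pr (cond_pmf J ?S) (fst -` {fst z})"
    by (simp add: cond_law_def pmf_map)
  also have "\<dots> = Pr (cond_pmf J ?S) {z}"
    by (intro antisym prob_mono_set) (auto simp: set_cond_pmf[OF ne] prod_eq_iff)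
  also have "\<dots> = pmf J z / Pr J ?S"
    by (simp add: measure_pmf_single pmf_cond[OF ne])
  also have "Pr J ?S = pmf (map_pmf snd J) (snd z)"
    by (simp add: pmf_map vimage_def)
  finally show ?thesis
    using pmf_marginal_pos[OF assms] by (simp add: exp_info_density[OF assms])
qed

definition accept_set :: "('a \<times> 'b) pmf \<Rightarrow> nat \<Rightarrow> real \<Rightarrow> ('a list \<times> 'b list) set" where
  "accept_set J n c = {(ys, us). exp c * pmf (replicate_pmf n (map_pmf fst J)) ys
     \<le> pmf (kernel_list (cond_law J) us) ys}"

text \<open>Markov's inequality for a likelihood ratio, valid for each fixed \<open>us\<close>. As
  no randomness of \<open>us\<close> enters, the bound survives an arbitrary choice of
  codeword.\<close>

lemma accept_set_prob:
  "Pr (replicate_pmf n (map_pmf fst J)) {ys. (ys, us) \<in> accept_set J n c} \<le> exp (- c)"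
proof -
  have "Pr (replicate_pmf n (map_pmf fst J)) {ys. (ys, us) \<in> accept_set J n c}
      \<le> exp (- c) * Pr (kernel_list (cond_law J) us) {ys. (ys, us) \<in> accept_set J n c}"
    by (rule prob_le_ratio) (auto simp: accept_set_def exp_minus field_simps)
  also have "\<dots> \<le> exp (- c) * 1" by (intro mult_left_mono) auto
  finally show ?thesis by simp
qed

lemma accept_setI:
  assumes "set zs \<subseteq> set_pmf J" "length zs = n" "c \<le> (\<Sum>z\<leftarrow>zs. info_density J z)"
  shows "(map fst zs, map snd zs) \<in> accept_set J n c"
proof -
  have "pmf (kernel_list (cond_law J) (map snd zs)) (map fst zs)
      = exp (\<Sum>z\<leftarrow>zs. info_density J z) * (\<Prod>y\<leftarrow>map fst zs. pmf (map_pmf fst J) y)"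
    using assms(1)
    by (induction zs) (auto simp: pmf_kernel_list_Cons pmf_cond_law exp_add mult_ac simp del: kernel_list.simps(2))
  also have "\<dots> \<ge> exp c * (\<Prod>y\<leftarrow>map fst zs. pmf (map_pmf fst J) y)"
    using assms(3) by (intro mult_right_mono prod_list_nonneg) auto
  finally show ?thesis using assms(2) by (simp add: accept_set_def pmf_replicate_pmf)
qed

lemma pmf_joint: "pmf (joint s W) (x, u) = pmf s x * pmf (W x) u"
proof -
  have "pmf (map_pmf (Pair a) (W a)) (x, u) = (if a = x then pmf (W x) u else 0)" for a
    using pmf_map_inj'[of "Pair a" "W a" u]
    by (auto simp: inj_def pmf_map_outside intro!: pmf_map_outside)
  then have "pmf (joint s W) (x, u) = expect s (\<lambda>a. if a = x then pmf (W x) u else 0)"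
    by (simp add: pmf_bind)
  also have "\<dots> = pmf (W x) u * pmf s x"
    by (subst integral_measure_pmf_real[where A = "{x}"]) (auto split: if_splits)
  finally show ?thesis by simp
qed

lemma map_fst_joint: "map_pmf fst (joint s W) = s"
  by (simp add: map_bind_pmf map_pmf_comp bind_return_pmf')

lemma pmf_kernel_list_density:
  assumes "set zs \<subseteq> set_pmf (joint s W)"
  shows "pmf (kernel_list W (map fst zs)) (map snd zs)
      = exp (\<Sum>z\<leftarrow>zs. info_density (joint s W) z) * (\<Prod>u\<leftarrow>map snd zs. pmf (map_pmf snd (joint s W)) u)"
  using assms
proof (induction zs)
  case (Cons z zs)
  have z: "z \<in> set_pmf (joint s W)" using Cons.prems by simp
  have "pmf (W (fst z)) (snd z) = exp (info_density (joint s W) z) * pmf (map_pmf snd (joint s W)) (snd z)"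
    using pmf_marginal_pos[OF z] pmf_joint[of s W "fst z" "snd z"]
    by (simp add: exp_info_density[OF z] map_fst_joint del: map_bind_pmf)
  then show ?case using Cons
    by (simp add: pmf_kernel_list_Cons exp_add mult_ac del: kernel_list.simps(2) map_bind_pmf)
qed simp

lemma law_XU_eq: "law_XU s W = joint s W"
  by (simp add: law_XU_def)

lemma law_YU_eq: "law_YU p W = map_pmf (\<lambda>(z, u). (fst z, u)) (joint p (\<lambda>z. W (snd z)))"
  unfolding law_YU_def map_bind_pmf map_pmf_comp by (intro bind_pmf_cong) auto

lemma map_fst_law_YU: "map_pmf fst (law_YU p W) = map_pmf fst p"
  by (simp add: law_YU_def map_bind_pmf map_pmf_comp case_prod_beta flip: map_pmf_def)

lemma iid_pairs_snd: "map_pmf snd (iid_pairs n p) = replicate_pmf n (map_pmf snd p)"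
  by (simp add: iid_pairs_def map_pmf_comp replicate_map_pmf)

lemma iid_pairs_fst: "map_pmf fst (iid_pairs n p) = replicate_pmf n (map_pmf fst p)"
  by (simp add: iid_pairs_def map_pmf_comp replicate_map_pmf)

lemma joint_iid_pairs:
  "joint (iid_pairs n p) (\<lambda>z. kernel_list W (snd z))
   = map_pmf (\<lambda>zs. ((map (fst \<circ> fst) zs, map (snd \<circ> fst) zs), map snd zs))
       (replicate_pmf n (joint p (\<lambda>z. W (snd z))))"
proof -
  have "joint (iid_pairs n p) (\<lambda>z. kernel_list W (snd z))
      = map_pmf (\<lambda>(as, us). ((map fst as, map snd as), us))
          (joint (replicate_pmf n p) (\<lambda>as. kernel_list W (map snd as)))"
    by (simp add: iid_pairs_def bind_map_pmf map_bind_pmf map_pmf_comp)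
  also have "\<dots> = map_pmf (\<lambda>(as, us). ((map fst as, map snd as), us))
      (map_pmf (\<lambda>zs. (map fst zs, map snd zs)) (replicate_pmf n (joint p (\<lambda>z. W (snd z)))))"
    by (simp only: replicate_joint)
  finally show ?thesis by (simp add: map_pmf_comp comp_def)
qed

lemma eventually_real_ge: "\<forall>\<^sub>F n in sequentially. real n \<ge> x"
  by (rule eventually_sequentiallyI[of "nat \<lceil>x\<rceil>"]) linarith

text \<open>A missed detection forces an atypically small sum of information densities. The weak law
  is applied to triples \<open>((y, x), u)\<close> with the density evaluated at
  \<open>(y, u)\<close>; its mean is then the mutual information of
  \<open>law_YU p W\<close>.\<close>

lemma accept_set_converse_prob:
  assumes fin: "finite (set_pmf p)" "\<And>x. finite (set_pmf (W x))" and "\<delta> > 0"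
  shows "(\<lambda>n. Pr (joint (iid_pairs n p) (\<lambda>z. kernel_list W (snd z)))
    {(z, us). (fst z, us) \<notin> accept_set (law_YU p W) n (real n * (minfo (law_YU p W) - \<delta>))}) \<longlonglongrightarrow> 0"
proof -
  let ?L = "law_YU p W" and ?J = "joint p (\<lambda>z. W (snd z))"
  let ?h = "\<lambda>z. info_density ?L (fst (fst z), snd z)"
  have fJ: "finite (set_pmf ?J)" using fin by simp
  have mean: "expect ?J ?h = minfo ?L"
    unfolding minfo_def by (subst (2) law_YU_eq) (simp add: case_prod_beta)
  have lim: "(\<lambda>n. Pr (replicate_pmf n ?J)
      {zs. (\<Sum>z\<leftarrow>zs. ?h z) \<le> real n * (minfo ?L - \<delta>)}) \<longlonglongrightarrow> 0"
    using iid_weak_law[OF fJ \<open>\<delta> > 0\<close>, of ?h] unfolding mean .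
  have le: "Pr (joint (iid_pairs n p) (\<lambda>z. kernel_list W (snd z)))
      {(z, us). (fst z, us) \<notin> accept_set ?L n (real n * (minfo ?L - \<delta>))}
    \<le> Pr (replicate_pmf n ?J) {zs. (\<Sum>z\<leftarrow>zs. ?h z) \<le> real n * (minfo ?L - \<delta>)}" for n
    unfolding joint_iid_pairs measure_map_pmf
  proof (rule prob_mono_set)
    fix zs assume zs: "zs \<in> set_pmf (replicate_pmf n ?J)"
      and bad: "zs \<in> (\<lambda>zs. ((map (fst \<circ> fst) zs, map (snd \<circ> fst) zs), map snd zs)) -`
         {(z, us). (fst z, us) \<notin> accept_set ?L n (real n * (minfo ?L - \<delta>))}"
    show "zs \<in> {zs. (\<Sum>z\<leftarrow>zs. ?h z) \<le> real n * (minfo ?L - \<delta>)}"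
    proof (rule ccontr)
      assume neg: "\<not> ?thesis"
      let ?zs = "map (\<lambda>z. (fst (fst z), snd z)) zs"
      have "set ?zs \<subseteq> set_pmf ?L"
        using zs unfolding law_YU_eq by (auto simp: set_replicate_pmf lists_eq_set image_iff) force
      moreover have "length ?zs = n" using zs by (auto simp: set_replicate_pmf)
      moreover have "real n * (minfo ?L - \<delta>) \<le> (\<Sum>z\<leftarrow>?zs. info_density ?L z)"
        using neg by (simp add: comp_def)
      ultimately have "(map fst ?zs, map snd ?zs) \<in> accept_set ?L n (real n * (minfo ?L - \<delta>))"
        by (rule accept_setI)
      then show False using bad by (simp add: comp_def)
    qed
  qed
  show ?thesis
    by (rule tendsto_sandwich[OF _ _ tendsto_const lim]) (use le in auto)
qed

text \<open>The weak law for source and codeword, with the opposite sign: it bounds the density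
  ratio from above, which is what covering at rate \<open>minfo (joint s W) + \<delta>\<close>
  requires.\<close>

lemma kernel_list_converse_prob:
  assumes fin: "finite (set_pmf s)" "\<And>x. finite (set_pmf (W x))" and "\<delta> > 0"
  shows "(\<lambda>n. Pr (joint (replicate_pmf n s) (kernel_list W))
    {(xs, us). pmf (kernel_list W xs) us > exp (real n * (minfo (joint s W) + \<delta>))
        * pmf (replicate_pmf n (map_pmf snd (joint s W))) us}) \<longlonglongrightarrow> 0"
proof -
  let ?J = "joint s W"
  let ?h = "\<lambda>z. - info_density ?J z"
  have fJ: "finite (set_pmf ?J)" using fin by simp
  have mean: "expect ?J ?h = - minfo ?J"
    unfolding minfo_def by simp
  have lim: "(\<lambda>n. Pr (replicate_pmf n ?J)
      {zs. (\<Sum>z\<leftarrow>zs. ?h z) \<le> real n * (- minfo ?J - \<delta>)}) \<longlonglongrightarrow> 0"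
    using iid_weak_law[OF fJ \<open>\<delta> > 0\<close>, of ?h] unfolding mean .
  have eq: "joint (replicate_pmf n s) (kernel_list W) = map_pmf (\<lambda>zs. (map fst zs, map snd zs)) (replicate_pmf n ?J)" for n
    using replicate_joint[of n s W "\<lambda>x. x"] by simp
  have le: "Pr (joint (replicate_pmf n s) (kernel_list W))
    {(xs, us). pmf (kernel_list W xs) us > exp (real n * (minfo ?J + \<delta>)) * pmf (replicate_pmf n (map_pmf snd ?J)) us}
    \<le> Pr (replicate_pmf n ?J) {zs. (\<Sum>z\<leftarrow>zs. ?h z) \<le> real n * (- minfo ?J - \<delta>)}" for n
    unfolding eq measure_map_pmf
  proof (rule prob_mono_set)
    fix zs assume zs: "zs \<in> set_pmf (replicate_pmf n ?J)"
      and bad: "zs \<in> (\<lambda>zs. (map fst zs, map snd zs)) -`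
         {(xs, us). pmf (kernel_list W xs) us > exp (real n * (minfo ?J + \<delta>)) * pmf (replicate_pmf n (map_pmf snd ?J)) us}"
    have sub: "set zs \<subseteq> set_pmf ?J" and len: "length zs = n"
      using zs by (auto simp only: set_replicate_pmf lists_eq_set)
    let ?q = "\<Prod>u\<leftarrow>map snd zs. pmf (map_pmf snd ?J) u"
    have "?q \<ge> 0" by (intro prod_list_nonneg) auto
    moreover have "exp (\<Sum>z\<leftarrow>zs. info_density ?J z) * ?q > exp (real n * (minfo ?J + \<delta>)) * ?q"
      using bad len unfolding pmf_kernel_list_density[OF sub, symmetric] by (simp add: pmf_replicate_pmf)
    ultimately have "exp (\<Sum>z\<leftarrow>zs. info_density ?J z) > exp (real n * (minfo ?J + \<delta>))"
      by (simp only: mult_less_cancel_right)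
    then have "real n * (minfo ?J + \<delta>) \<le> (\<Sum>z\<leftarrow>zs. info_density ?J z)" by simp
    moreover have "(\<Sum>z\<leftarrow>zs. ?h z) = - (\<Sum>z\<leftarrow>zs. info_density ?J z)" by (induction zs) auto
    ultimately show "zs \<in> {zs. (\<Sum>z\<leftarrow>zs. ?h z) \<le> real n * (- minfo ?J - \<delta>)}"
      by (simp add: algebra_simps)
  qed
  show ?thesis
    by (rule tendsto_sandwich[OF _ _ tendsto_const lim]) (use le in auto)
qed

text \<open>One codebook serves all \<open>i\<close> in \<open>F\<close>. Besides the density ratio,
  the good set demands that for each \<open>i\<close> the conditional probability of a missed
  detection given \<open>x\<close> be at most \<open>\<eta>\<close>. This is a property of the pair
  \<open>(x, u)\<close> alone, so it can be imposed before the codeword is chosen.\<close>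

lemma source_code:
  fixes P :: "'i \<Rightarrow> ('y \<times> 'x) pmf" and W :: "'x \<Rightarrow> nat pmf"
  assumes F: "finite F" "\<And>i. i \<in> F \<Longrightarrow> finite (set_pmf (P i))" "\<And>i. i \<in> F \<Longrightarrow> map_pmf snd (P i) = s"
    and fin: "finite (set_pmf s)" "\<And>x. finite (set_pmf (W x))"
    and pos: "\<delta> > 0" "\<eta> > 0"
  defines "A \<equiv> \<lambda>i n. accept_set (law_YU (P i) W) n (real n * (minfo (law_YU (P i) W) - \<delta>))"
  shows "\<forall>\<^sub>F n in sequentially. \<exists>B \<phi> C. finite B \<and> real (card B) \<le> exp (real n * (minfo (law_XU s W) + \<delta>)) + 1 \<and>
    (\<forall>x\<in>C. \<phi> x \<in> B) \<and> Pr (replicate_pmf n s) (- C) \<le> \<eta> \<and>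
    (\<forall>i\<in>F. Pr (iid_pairs n (P i)) {(y, x). x \<in> C \<and> (y, \<phi> x) \<notin> A i n} \<le> \<eta>)"
proof -
  \<comment> \<open>Thirds for the density condition, the conditional failure conditions and the
    finite codebook. In \<open>\<gamma>\<close> the factor \<open>\<eta>\<close> is lost again in
    \<open>markov_split\<close>, and the union over \<open>F\<close> costs
    \<open>card F\<close>.\<close>
  define \<kappa> where "\<kappa> = \<eta> / 3"
  define \<gamma> where "\<gamma> = \<eta> * \<kappa> / (real (card F) + 1)"
  have kg: "\<kappa> > 0" "\<gamma> > 0" using pos by (auto simp: \<kappa>_def \<gamma>_def)
  let ?J = "joint s W"
  let ?I = "minfo ?J"
  have "\<forall>\<^sub>F n in sequentially. Pr (joint (replicate_pmf n s) (kernel_list W))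
    {(xs, us). pmf (kernel_list W xs) us > exp (real n * (?I + \<delta> / 2))
        * pmf (replicate_pmf n (map_pmf snd ?J)) us} < \<kappa>"
    using kernel_list_converse_prob[OF fin, of "\<delta> / 2"] pos kg by (intro order_tendstoD) auto
  moreover have "\<forall>\<^sub>F n in sequentially. \<forall>i\<in>F. Pr (joint (iid_pairs n (P i)) (\<lambda>z. kernel_list W (snd z)))
    {(z, us). (fst z, us) \<notin> A i n} < \<gamma>"
  proof (intro eventually_ball_finite ballI F(1))
    fix i assume "i \<in> F"
    then show "\<forall>\<^sub>F n in sequentially. Pr (joint (iid_pairs n (P i)) (\<lambda>z. kernel_list W (snd z)))
      {(z, us). (fst z, us) \<notin> A i n} < \<gamma>"
      unfolding A_def by (intro order_tendstoD(2)[OF _ kg(2)] accept_set_converse_prob F fin pos)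
  qed
  moreover have "\<forall>\<^sub>F n in sequentially. real n \<ge> - ln \<kappa> * 2 / \<delta>" by (rule eventually_real_ge)
  ultimately show ?thesis
  proof eventually_elim
    case (elim n)
    define M where "M = nat \<lceil>exp (real n * (?I + \<delta>))\<rceil>"
    define c where "c = exp (real n * (?I + \<delta> / 2))"
    let ?R = "\<lambda>i. iid_pairs n (P i)" and ?sn = "replicate_pmf n s" and ?Wn = "kernel_list W"
    \<comment> \<open>\<open>b i x u\<close> is the joint probability of \<open>x\<close> and a
      missed detection; comparing it with \<open>\<eta> * pmf ?sn x\<close> bounds the conditional
      one by \<open>\<eta>\<close>.\<close>
    define b where "b i x u = Pr (?R i) {(y, x'). x' = x \<and> (y, u) \<in> - A i n}" for i x u
    define G where "G = {(x, u). pmf (?Wn x) u \<le> c * pmf (replicate_pmf n (map_pmf snd ?J)) u \<and> (\<forall>i\<in>F. b i x u \<le> \<eta> * pmf ?sn x)}"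
    have fs: "finite (set_pmf ?sn)" using fin by simp
    have fR: "finite (set_pmf (?R i))" if "i \<in> F" for i using F that by (simp add: iid_pairs_def)
    have sR: "map_pmf snd (?R i) = ?sn" if "i \<in> F" for i using F that by (simp add: iid_pairs_snd)
    have fW: "finite (set_pmf (?Wn x))" for x using fin by (intro finite_set_kernel_list)
    have fU: "finite (set_pmf (replicate_pmf n (map_pmf snd ?J)))" using fin by simp
    have c0: "c > 0" by (simp add: c_def)
    obtain B where B: "finite B" "card B \<le> M"
      "Pr ?sn {x. \<forall>u\<in>B. (x, u) \<notin> G} \<le> Pr (joint ?sn ?Wn) (- G) + exp (- (real M / c))"
      by (rule covering[where W = ?Wn and G = G and M = M, OF fs fU fW c0]) (auto simp: G_def)
    \<comment> \<open>The exponent of \<open>M\<close> has slack \<open>\<delta>\<close> and that of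
      \<open>c\<close> only \<open>\<delta> / 2\<close>, so \<open>M / c\<close> grows
      exponentially.\<close>
    have "exp (- (real M / c)) \<le> \<kappa>"
    proof -
      have "real n * \<delta> / 2 \<le> exp (real n * \<delta> / 2)" using exp_ge_add_one_self[of "real n * \<delta> / 2"] by linarith
      also have "\<dots> = exp (real n * (?I + \<delta>)) / c"
        unfolding c_def exp_diff[symmetric] by (simp add: algebra_simps)
      also have "\<dots> \<le> real M / c" unfolding M_def using c0 by (intro divide_right_mono real_nat_ceiling_ge) auto
      finally have "exp (- (real M / c)) \<le> exp (- (real n * \<delta> / 2))" by simp
      also have "\<dots> \<le> exp (ln \<kappa>)" using elim(3) pos by (simp add: field_simps)
      finally show ?thesis using kg by simp
    qed
    moreover have "Pr (joint ?sn ?Wn) (- G) \<le> \<kappa> + \<kappa>"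
    proof -
      let ?G1 = "{(xs, us). pmf (?Wn xs) us > c * pmf (replicate_pmf n (map_pmf snd ?J)) us}"
      let ?G2 = "\<lambda>i. {(x, u). b i x u > \<eta> * pmf ?sn x}"
      have "Pr (joint ?sn ?Wn) (- G) \<le> Pr (joint ?sn ?Wn) (?G1 \<union> (\<Union>i\<in>F. ?G2 i))"
        by (intro measure_pmf.finite_measure_mono) (auto simp: G_def not_le)
      also have "\<dots> \<le> Pr (joint ?sn ?Wn) ?G1 + Pr (joint ?sn ?Wn) (\<Union>i\<in>F. ?G2 i)"
        by (intro measure_Un_le) auto
      also have "Pr (joint ?sn ?Wn) (\<Union>i\<in>F. ?G2 i) \<le> (\<Sum>i\<in>F. Pr (joint ?sn ?Wn) (?G2 i))"
        using F by (intro measure_UNION_le) auto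
      also have "\<dots> \<le> (\<Sum>i\<in>F. \<gamma> / \<eta>)"
      proof (rule sum_mono)
        fix i assume i: "i \<in> F"
        have "Pr (joint ?sn ?Wn) (?G2 i)
            \<le> Pr (joint (?R i) (\<lambda>z. ?Wn (snd z))) {(z, u). (fst z, u) \<in> - A i n} / \<eta>"
          using markov_split[where W = ?Wn and N = "- A i n", OF fR[OF i] fW pos(2)] unfolding sR[OF i] b_def .
        also have "\<dots> \<le> \<gamma> / \<eta>" using elim(2) i pos by (intro divide_right_mono) (auto intro: less_imp_le)
        finally show "Pr (joint ?sn ?Wn) (?G2 i) \<le> \<gamma> / \<eta>" .
      qed
      also have "\<dots> = real (card F) * (\<kappa> / (real (card F) + 1))" using pos by (simp add: \<gamma>_def)
      also have "\<dots> \<le> \<kappa>" using kg by (simp add: field_simps)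
      finally show ?thesis using elim(1) by (simp add: c_def)
    qed
    ultimately have cover: "Pr ?sn {x. \<forall>u\<in>B. (x, u) \<notin> G} \<le> \<eta>"
      using B(3) by (simp add: \<kappa>_def)
    define C where "C = {x. \<exists>u\<in>B. (x, u) \<in> G}"
    define \<phi> where "\<phi> x = (SOME u. u \<in> B \<and> (x, u) \<in> G)" for x
    have \<phi>: "\<phi> x \<in> B \<and> (x, \<phi> x) \<in> G" if "x \<in> C" for x
    proof -
      have "\<exists>u. u \<in> B \<and> (x, u) \<in> G" using that by (simp add: C_def Bex_def)
      then show ?thesis unfolding \<phi>_def by (rule someI_ex)
    qed
    have "Pr (?R i) {(y, x). x \<in> C \<and> (y, \<phi> x) \<notin> A i n} \<le> \<eta>" if i: "i \<in> F" for i
    proof -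
      \<comment> \<open>Split by the value of \<open>x\<close>: the codeword is then fixed, and the
        condition in \<open>G\<close> applies to it.\<close>
      have "Pr (?R i) {(y, x). x \<in> C \<and> (y, \<phi> x) \<notin> A i n}
          \<le> Pr (?R i) (\<Union>x\<in>C \<inter> set_pmf ?sn. {(y, x'). x' = x \<and> (y, \<phi> x) \<in> - A i n})"
        unfolding sR[OF i, symmetric] by (rule prob_mono_set) force
      also have "\<dots> \<le> (\<Sum>x\<in>C \<inter> set_pmf ?sn. b i x (\<phi> x))"
        unfolding b_def using fs by (intro measure_UNION_le) auto
      also have "\<dots> \<le> (\<Sum>x\<in>C \<inter> set_pmf ?sn. \<eta> * pmf ?sn x)"
        using \<phi> i by (intro sum_mono) (auto simp: G_def)
      also have "\<dots> \<le> (\<Sum>x\<in>set_pmf ?sn. \<eta> * pmf ?sn x)"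
        using fs pos by (intro sum_mono2) auto
      also have "\<dots> = \<eta>" using sum_pmf_eq_1[OF fs, of ?sn] by (simp flip: sum_distrib_left)
      finally show ?thesis .
    qed
    moreover have "real (card B) \<le> exp (real n * (?I + \<delta>)) + 1"
    proof -
      have "real (card B) \<le> real M" using B(2) by simp
      also have "real M = of_int \<lceil>exp (real n * (?I + \<delta>))\<rceil>"
        unfolding M_def by (intro of_nat_nat) (simp add: less_trans[OF _ exp_gt_zero])
      also have "\<dots> \<le> exp (real n * (?I + \<delta>)) + 1"
        by (rule of_int_ceiling_le_add_one)
      finally show ?thesis .
    qed
    moreover have "- C = {x. \<forall>u\<in>B. (x, u) \<notin> G}" by (auto simp: C_def)
    ultimately show ?case
      using B(1) cover \<phi> by (intro exI[of _ B] exI[of _ \<phi>] exI[of _ C]) (auto simp: law_XU_eq)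
  qed
qed

section \<open>Achievability\<close>

text \<open>\<open>K n\<close> is the largest index up to \<open>n\<close> for which this and all
  earlier thresholds have been passed, so it grows, but slowly enough.\<close>

lemma diagonal_sequence:
  fixes A :: "nat \<Rightarrow> nat \<Rightarrow> bool"
  assumes "\<And>k. \<forall>\<^sub>F n in sequentially. A k n"
  obtains K :: "nat \<Rightarrow> nat" where "filterlim K at_top sequentially" "\<forall>\<^sub>F n in sequentially. A (K n) n"
proof -
  have "\<forall>k. \<exists>N. \<forall>n\<ge>N. A k n" using assms by (simp add: eventually_sequentially)
  then obtain N where N: "\<And>k n. n \<ge> N k \<Longrightarrow> A k n" by (auto dest!: choice)
  define S where "S n = {k. k \<le> n \<and> (\<forall>j\<le>k. N j \<le> n)}" for n
  define K where "K n = Max (insert 0 (S n))" for n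
  have fin: "finite (S n)" for n
    by (rule finite_subset[of _ "{..n}"]) (auto simp: S_def)
  have "\<forall>\<^sub>F n in sequentially. k \<le> K n" for k
  proof (rule eventually_sequentiallyI)
    fix n assume n: "max k (Max (N ` {..k})) \<le> n"
    then have "k \<in> S n" by (auto simp: S_def)
    then show "k \<le> K n" unfolding K_def using fin by (intro Max_ge) auto
  qed
  then have 1: "filterlim K at_top sequentially" by (simp add: filterlim_at_top)
  have "A (K n) n" if "N 0 \<le> n" for n
  proof -
    have "K n \<in> insert 0 (S n)" unfolding K_def using fin by (intro Max_in) auto
    then have "N (K n) \<le> n" using that by (auto simp: S_def)
    then show ?thesis by (rule N)
  qed
  then have 2: "\<forall>\<^sub>F n in sequentially. A (K n) n" by (intro eventually_sequentiallyI[of "N 0"])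
  show thesis using that 1 2 .
qed

text \<open>Letting the slack \<open>\<eta>\<close> shrink with \<open>n\<close> merges the
  approximate schemes into a single sequence whose first error tends to 0 and whose limiting rate is
  at most \<open>R\<close>, without loss.\<close>

lemma achievableI:
  fixes \<alpha> \<beta> :: "('y, 'x) error"
  assumes nonneg: "\<And>n \<phi> \<psi>. \<beta> n \<phi> \<psi> \<ge> 0"
    and scheme: "\<And>\<eta>. \<eta> > 0 \<Longrightarrow> \<forall>\<^sub>F n in sequentially. \<exists>M \<phi> \<psi>. finite M \<and> (\<forall>xs. length xs = n \<longrightarrow> \<phi> xs \<in> M) \<and>
       real (card M) \<le> exp (real n * (R + \<eta>)) \<and> \<alpha> n \<phi> \<psi> \<le> \<eta> \<and> \<beta> n \<phi> \<psi> \<le> exp (- (real n * E))"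
  shows "achievable \<alpha> \<beta> 0 R E"
proof -
  define good where "good \<eta> n S \<longleftrightarrow> (case S of (M, \<phi>, \<psi>) \<Rightarrow> finite M \<and> (\<forall>xs. length xs = n \<longrightarrow> \<phi> xs \<in> M) \<and>
       real (card M) \<le> exp (real n * (R + \<eta>)) \<and> \<alpha> n \<phi> \<psi> \<le> \<eta> \<and> \<beta> n \<phi> \<psi> \<le> exp (- (real n * E)))" for \<eta> n S
  obtain K where K: "filterlim K at_top sequentially"
    "\<forall>\<^sub>F n in sequentially. \<exists>S. good (1 / real (Suc (K n))) n S"
  proof (rule diagonal_sequence[of "\<lambda>k n. \<exists>S. good (1 / real (Suc k)) n S"])
    show "\<forall>\<^sub>F n in sequentially. \<exists>S. good (1 / real (Suc k)) n S" for k
      using scheme[of "1 / real (Suc k)"] by (simp add: good_def)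
  qed
  \<comment> \<open>The default serves the finitely many block lengths without a good scheme; it
    only has to be a legitimate encoder.\<close>
  define S where "S n = (if \<exists>S. good (1 / real (Suc (K n))) n S then SOME S. good (1 / real (Suc (K n))) n S
      else ({0}, \<lambda>_. 0, undefined))" for n
  define M where "M n = fst (S n)" for n
  define \<phi> where "\<phi> n = fst (snd (S n))" for n
  define \<psi> where "\<psi> n = snd (snd (S n))" for n
  have S: "good (1 / real (Suc (K n))) n (S n)" if "\<exists>S. good (1 / real (Suc (K n))) n S" for n
    using someI_ex[OF that] that by (simp add: S_def)
  have MS: "finite (M n) \<and> (\<forall>xs. length xs = n \<longrightarrow> \<phi> n xs \<in> M n)" for n
  proof (cases "\<exists>S. good (1 / real (Suc (K n))) n S")
    case True
    from S[OF this] show ?thesis by (simp add: good_def M_def \<phi>_def case_prod_beta)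
  qed (simp add: S_def M_def \<phi>_def)
  have ev: "\<forall>\<^sub>F n in sequentially. real (card (M n)) \<le> exp (real n * (R + 1 / real (Suc (K n)))) \<and>
      \<alpha> n (\<phi> n) (\<psi> n) \<le> 1 / real (Suc (K n)) \<and> \<beta> n (\<phi> n) (\<psi> n) \<le> exp (- (real n * E))"
    using K(2)
  proof eventually_elim
    case (elim n)
    from S[OF this] show ?case by (simp add: good_def M_def \<phi>_def \<psi>_def case_prod_beta)
  qed
  have K0: "(\<lambda>n. 1 / real (Suc (K n))) \<longlonglongrightarrow> 0"
    using filterlim_compose[OF lim_1_over_n filterlim_compose[OF filterlim_Suc K(1)]] by (simp add: comp_def)
  have "limsup (\<lambda>n. ereal (\<alpha> n (\<phi> n) (\<psi> n))) \<le> ereal 0"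
  proof -
    have "limsup (\<lambda>n. ereal (\<alpha> n (\<phi> n) (\<psi> n))) \<le> limsup (\<lambda>n. ereal (1 / real (Suc (K n))))"
      using ev by (intro Limsup_mono) (auto elim: eventually_mono)
    also have "\<dots> = ereal 0" using K0 by (intro lim_imp_Limsup) (auto simp: tendsto_ereal)
    finally show ?thesis .
  qed
  moreover have "ereal E \<le> liminf (\<lambda>n. ereal (1 / real n) * log_recip (\<beta> n (\<phi> n) (\<psi> n)))"
  proof (rule Liminf_bounded)
    show "\<forall>\<^sub>F n in sequentially. ereal E \<le> ereal (1 / real n) * log_recip (\<beta> n (\<phi> n) (\<psi> n))"
      using ev eventually_gt_at_top[of 0]
    proof eventually_elim
      case (elim n)
      let ?b = "\<beta> n (\<phi> n) (\<psi> n)"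
      show ?case
      proof (cases "?b = 0")
        case True
        then show ?thesis using elim by (simp add: log_recip_def)
      next
        case False
        then have b: "?b > 0" using nonneg[of n "\<phi> n" "\<psi> n"] by simp
        then have "ln ?b \<le> ln (exp (- (real n * E)))" using elim by (intro ln_mono) auto
        then have "ln ?b \<le> - (real n * E)" by simp
        then show ?thesis using b elim by (simp add: log_recip_def ln_div field_simps)
      qed
    qed
  qed
  moreover have "limsup (\<lambda>n. ereal (1 / real n * ln (real (card (M n))))) \<le> ereal R"
  proof -
    have "limsup (\<lambda>n. ereal (1 / real n * ln (real (card (M n))))) \<le> limsup (\<lambda>n. ereal (R + 1 / real (Suc (K n))))"
    proof (rule Limsup_mono)
      show "\<forall>\<^sub>F n in sequentially. ereal (1 / real n * ln (real (card (M n)))) \<le> ereal (R + 1 / real (Suc (K n)))"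
        using ev eventually_gt_at_top[of 0]
      proof eventually_elim
        case (elim n)
        have "\<phi> n (replicate n undefined) \<in> M n" using MS[of n] by simp
        then have "M n \<noteq> {}" by blast
        then have "card (M n) > 0" using MS[of n] by (simp add: card_gt_0_iff)
        then have "ln (real (card (M n))) \<le> ln (exp (real n * (R + 1 / real (Suc (K n)))))"
          using elim by (intro ln_mono) auto
        then show ?case using elim by (simp add: field_simps)
      qed
    qed
    also have "\<dots> = ereal R"
    proof (intro lim_imp_Limsup)
      have "(\<lambda>n. R + 1 / real (Suc (K n))) \<longlonglongrightarrow> R + 0" by (intro tendsto_intros K0)
      then show "(\<lambda>n. ereal (R + 1 / real (Suc (K n)))) \<longlonglongrightarrow> ereal R" by (simp add: tendsto_ereal)
    qed simp
    finally show ?thesis .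
  qed
  ultimately show ?thesis
    unfolding achievable_def using MS by blast
qed

section \<open>The scheme for the compound problem\<close>

lemma accept_prob_deterministic:
  "accept_prob L (\<lambda>z. return_pmf (if z \<in> Acc then Accept_Null else Reject_Null)) = Pr L Acc"
  unfolding accept_prob_def pmf_bind prob_eq_expectation
  by (intro expectation_cong_set) (auto simp: indicator_def)

lemma accept_prob_nonneg: "0 \<le> accept_prob L \<psi>"
  by (simp add: accept_prob_def)

text \<open>Integrate over \<open>y\<close> first: for a fixed \<open>x\<close> the codeword is
  fixed too, and the false alarm bound applies.\<close>

lemma prob_pair_le:
  assumes "c \<ge> 0" "\<And>x. x \<in> T \<Longrightarrow> Pr p (N x) \<le> c"
  shows "Pr (pair_pmf p q) {(y, x). x \<in> T \<and> y \<in> N x} \<le> c * Pr q T"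
proof -
  let ?S = "{(y, x). x \<in> T \<and> y \<in> N x}"
  have "emeasure (pair_pmf p q) ?S = (\<integral>\<^sup>+ x. \<integral>\<^sup>+ y. indicator ?S (y, x) \<partial>p \<partial>q)"
    by (subst pair_commute_pmf) (simp add: nn_integral_pair_pmf' indicator_def flip: nn_integral_indicator)
  also have "\<dots> \<le> (\<integral>\<^sup>+ x. ennreal c * indicator T x \<partial>q)"
  proof (rule nn_integral_mono)
    fix x
    have "(\<integral>\<^sup>+ y. indicator ?S (y, x) \<partial>p) = (\<integral>\<^sup>+ y. indicator (N x) y * indicator T x \<partial>p)"
      by (intro nn_integral_cong) (auto simp: indicator_def)
    also have "\<dots> = emeasure p (N x) * indicator T x"
      by (subst nn_integral_multc) auto
    also have "\<dots> \<le> ennreal c * indicator T x"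
      using assms by (auto simp: indicator_def measure_pmf.emeasure_eq_measure intro!: ennreal_leI)
    finally show "(\<integral>\<^sup>+ y. indicator ?S (y, x) \<partial>p) \<le> ennreal c * indicator T x" .
  qed
  also have "\<dots> = ennreal c * emeasure q T"
    by (subst nn_integral_cmult) auto
  finally have "ennreal (Pr (pair_pmf p q) ?S) \<le> ennreal (c * Pr q T)"
    using \<open>c \<ge> 0\<close> by (simp add: measure_pmf.emeasure_eq_measure ennreal_mult)
  then show ?thesis using \<open>c \<ge> 0\<close> by simp
qed

text \<open>A union bound. Leaving out \<open>n = 0\<close> matters for
  \<open>likelihood_separation\<close>, where \<open>exp (- (n * D)) < 1\<close> is used
  strictly.\<close>

lemma prob_UN_tendsto_0:
  assumes "finite I" "\<And>i. i \<in> I \<Longrightarrow> (\<lambda>n. Pr (p n) (B i n)) \<longlonglongrightarrow> 0"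
    and sub: "\<And>n x. n > 0 \<Longrightarrow> x \<in> set_pmf (p n) \<Longrightarrow> x \<in> C n \<Longrightarrow> \<exists>i\<in>I. x \<in> B i n"
  shows "(\<lambda>n. Pr (p n) (C n)) \<longlonglongrightarrow> 0"
proof -
  have lim: "(\<lambda>n. \<Sum>i\<in>I. Pr (p n) (B i n)) \<longlonglongrightarrow> 0"
    using tendsto_sum[of I "\<lambda>i n. Pr (p n) (B i n)" "\<lambda>_. 0" sequentially] assms(2) by simp
  have "\<forall>\<^sub>F n in sequentially. Pr (p n) (C n) \<le> (\<Sum>i\<in>I. Pr (p n) (B i n))"
    using eventually_gt_at_top[of 0]
  proof eventually_elim
    case (elim n)
    have "Pr (p n) (C n) \<le> Pr (p n) (\<Union>i\<in>I. B i n)"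
      using sub[OF elim] by (intro prob_mono_set) auto
    also have "\<dots> \<le> (\<Sum>i\<in>I. Pr (p n) (B i n))"
      using assms(1) by (intro measure_UNION_le) auto
    finally show ?case .
  qed
  then show ?thesis by (intro tendsto_sandwich[OF _ _ tendsto_const lim]) auto
qed

text \<open>Any positive \<open>D\<close> below the divergence of the two laws will do: with high
  probability the likelihood under \<open>s'\<close> is smaller by the factor
  \<open>exp (- (n * D))\<close>.\<close>

lemma likelihood_separation:
  assumes fin: "finite (set_pmf s)" and ne: "s \<noteq> s'"
  shows "(\<lambda>n. Pr (replicate_pmf n s)
    {xs. pmf (replicate_pmf n s') xs \<ge> pmf (replicate_pmf n s) xs}) \<longlonglongrightarrow> 0"
proof -
  have "rel_entropy s s' > 0"
    using kl_pos[OF fin _ ne] by (simp add: rel_entropy_eq)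
  then obtain D where D: "ereal D < rel_entropy s s'" "D > 0"
    using ereal_dense2[of 0 "rel_entropy s s'"] by auto
  show ?thesis
  proof (rule prob_UN_tendsto_0[of "{()}"])
    show "(\<lambda>n. Pr (replicate_pmf n s) {xs. pmf (replicate_pmf n s') xs > exp (- (real n * D)) * pmf (replicate_pmf n s) xs}) \<longlonglongrightarrow> 0" for i :: unit
      using memoryless_aep_lower[OF fin, of "\<lambda>n. replicate_pmf n s'" s'] D unfolding aep_lower_def by blast
    fix n xs assume "(n :: nat) > 0" "xs \<in> set_pmf (replicate_pmf n s)"
      "xs \<in> {xs. pmf (replicate_pmf n s') xs \<ge> pmf (replicate_pmf n s) xs}"
    then have "exp (- (real n * D)) * pmf (replicate_pmf n s) xs < 1 * pmf (replicate_pmf n s) xs"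
      using D by (intro mult_strict_right_mono) (auto simp: pmf_positive_iff)
    then show "\<exists>i\<in>{()}. xs \<in> {xs. pmf (replicate_pmf n s') xs > exp (- (real n * D)) * pmf (replicate_pmf n s) xs}"
      using \<open>xs \<in> {xs. pmf (replicate_pmf n s') xs \<ge> pmf (replicate_pmf n s) xs}\<close> by simp
  qed simp
qed

text \<open>The class index travels with the codeword, so the decoder knows which kernel was used.
  On the acceptance region the laws \<open>QY j\<close> and \<open>QX t\<close> are compared with
  product laws, which gives the exponents \<open>dy i\<close> and \<open>dx s\<close>; under the
  product law of \<open>y\<close> the test against \<open>u\<close> adds the mutual information. All
  three estimates are uniform in \<open>j\<close> and \<open>t\<close>.\<close>

lemma compound_scheme:
  fixes P :: "nat \<Rightarrow> ('y::finite \<times> 'x::finite) pmf" and W :: "'x pmf \<Rightarrow> 'x \<Rightarrow> nat pmf"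
  assumes m: "m \<ge> 1" and k: "k \<ge> 1" and r: "r \<ge> 1" and "R \<ge> 0" "\<eta> > 0"
    and fin: "\<And>s x. finite (set_pmf (W s x))"
    and aepY: "\<And>i j D. i \<in> {1..m} \<Longrightarrow> j \<in> {1..k} \<Longrightarrow> D < dy i \<Longrightarrow>
      (\<lambda>n. Pr (replicate_pmf n (margY P i))
        {ys. pmf (QY j n) ys > exp (- (real n * D)) * pmf (replicate_pmf n (margY P i)) ys}) \<longlonglongrightarrow> 0"
    and aepX: "\<And>s t D. s \<in> PXs P m \<Longrightarrow> t \<in> {1..r} \<Longrightarrow> D < dx s \<Longrightarrow>
      (\<lambda>n. Pr (replicate_pmf n s)
        {xs. pmf (QX t n) xs > exp (- (real n * D)) * pmf (replicate_pmf n s) xs}) \<longlonglongrightarrow> 0"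
    and rate: "\<And>s. s \<in> PXs P m \<Longrightarrow> minfo (law_XU s (W s)) \<le> R"
    and E: "\<And>i. i \<in> {1..m} \<Longrightarrow> E < minfo (law_YU (P i) (W (margX P i))) + dy i + dx (margX P i)"
  shows "\<forall>\<^sub>F n in sequentially. \<exists>M \<phi> \<psi>. finite M \<and> (\<forall>xs. length xs = n \<longrightarrow> \<phi> xs \<in> M) \<and>
       real (card M) \<le> exp (real n * (R + \<eta>)) \<and> compound_alpha m P n \<phi> \<psi> \<le> \<eta> \<and>
       compound_beta k r QY QX n \<phi> \<psi> \<le> exp (- (real n * E))"
proof -
  let ?S = "PXs P m" and ?X = "margX P" and ?Y = "margY P"
  define I where "I i = minfo (law_YU (P i) (W (?X i)))" for i
  have finS: "finite ?S" by (simp add: PXs_def)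
  have X_S: "?X i \<in> ?S" if "i \<in> {1..m}" for i using that by (simp add: PXs_def)
  \<comment> \<open>The exponent loses \<open>\<delta>\<close> for each of the two divergences and
    for the mutual information, and once more for the union over \<open>i\<close>; the rate loses
    \<open>2 * \<delta>\<close>.\<close>
  have "\<exists>\<delta>>0. \<delta> \<le> \<eta> / 2 \<and> (\<forall>i\<in>{1..m}. E + 4 * \<delta> \<le> I i + dy i + dx (?X i))"
  proof -
    define g where "g i = (I i + dy i + dx (?X i) - E) / 4" for i
    have g: "g i > 0" if "i \<in> {1..m}" for i using E[OF that] by (simp add: g_def I_def)
    let ?d = "Min (insert (\<eta> / 2) (g ` {1..m}))"
    have "?d > 0" using g \<open>\<eta> > 0\<close> by (subst Min_gr_iff) auto
    moreover have "?d \<le> \<eta> / 2" by (intro Min_le) auto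
    moreover have "E + 4 * ?d \<le> I i + dy i + dx (?X i)" if "i \<in> {1..m}" for i
    proof -
      have "?d \<le> g i" using that by (intro Min_le) auto
      then show ?thesis unfolding g_def by (simp add: field_simps)
    qed
    ultimately show ?thesis by blast
  qed
  then obtain \<delta> where \<delta>: "\<delta> > 0" "\<delta> \<le> \<eta> / 2" "\<And>i. i \<in> {1..m} \<Longrightarrow> E + 4 * \<delta> \<le> I i + dy i + dx (?X i)"
    by auto
  define TY where "TY i n = {ys. \<forall>j\<in>{1..k}. pmf (QY j n) ys \<le> exp (- (real n * (dy i - \<delta>))) * pmf (replicate_pmf n (?Y i)) ys}" for i n
  \<comment> \<open>The strict comparison with all other classes makes the sets
    \<open>DX s n\<close> disjoint for different \<open>s\<close>, so at most one class claims a
    given block.\<close>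
  define DX where "DX s n = {xs. (\<forall>t\<in>{1..r}. pmf (QX t n) xs \<le> exp (- (real n * (dx s - \<delta>))) * pmf (replicate_pmf n s) xs)
      \<and> (\<forall>s'\<in>?S - {s}. pmf (replicate_pmf n s') xs < pmf (replicate_pmf n s) xs)}" for s n
  have TY: "(\<lambda>n. Pr (replicate_pmf n (?Y i)) (- TY i n)) \<longlonglongrightarrow> 0" if "i \<in> {1..m}" for i
  proof (rule prob_UN_tendsto_0[of "{1..k}"])
    show "(\<lambda>n. Pr (replicate_pmf n (margY P i))
        {ys. pmf (QY j n) ys > exp (- (real n * (dy i - \<delta>))) * pmf (replicate_pmf n (margY P i)) ys}) \<longlonglongrightarrow> 0"
      if "j \<in> {1..k}" for j
      using aepY[OF \<open>i \<in> {1..m}\<close> that, of "dy i - \<delta>"] \<delta> by simp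
  qed (auto simp: TY_def not_le)
  have DX: "(\<lambda>n. Pr (replicate_pmf n s) (- DX s n)) \<longlonglongrightarrow> 0" if s: "s \<in> ?S" for s
  proof (rule prob_UN_tendsto_0[of "Inl ` {1..r} \<union> Inr ` (?S - {s})"])
    show "(\<lambda>n. Pr (replicate_pmf n s) (case z of
         Inl t \<Rightarrow> {xs. pmf (QX t n) xs > exp (- (real n * (dx s - \<delta>))) * pmf (replicate_pmf n s) xs}
       | Inr s' \<Rightarrow> {xs. pmf (replicate_pmf n s') xs \<ge> pmf (replicate_pmf n s) xs})) \<longlonglongrightarrow> 0"
      if z: "z \<in> Inl ` {1..r} \<union> Inr ` (?S - {s})" for z :: "nat + 'x pmf"
    proof (cases z)
      case (Inl t)
      then show ?thesis using z aepX[OF s, of t "dx s - \<delta>"] \<delta> by auto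
    next
      case (Inr s')
      then show ?thesis using z likelihood_separation[of s s'] by auto
    qed
    fix n xs assume "xs \<in> - DX s n"
    then show "\<exists>z\<in>Inl ` {1..r} \<union> Inr ` (?S - {s}). xs \<in> (case z of
         Inl t \<Rightarrow> {xs. pmf (QX t n) xs > exp (- (real n * (dx s - \<delta>))) * pmf (replicate_pmf n s) xs}
       | Inr s' \<Rightarrow> {xs. pmf (replicate_pmf n s') xs \<ge> pmf (replicate_pmf n s) xs})"
      unfolding DX_def bex_Un bex_simps by (auto simp: not_le not_less)
  qed (use finS in auto)
  define A' where "A' s i n = accept_set (law_YU (P i) (W s)) n (real n * (minfo (law_YU (P i) (W s)) - \<delta>))" for s i n
  define A where "A i n = A' (?X i) i n" for i n
  \<comment> \<open>Four failure events share \<open>\<eta>\<close>: \<open>x\<close> outside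
    \<open>DX\<close>, \<open>x\<close> not covered, \<open>y\<close> outside \<open>TY\<close>, and
    the pair \<open>(y, u)\<close> rejected.\<close>
  have \<eta>4: "\<eta> / 4 > 0" using \<open>\<eta> > 0\<close> by simp
  have "\<forall>\<^sub>F n in sequentially. \<forall>s\<in>?S. \<exists>B \<phi> C. finite B \<and> real (card B) \<le> exp (real n * (minfo (law_XU s (W s)) + \<delta>)) + 1 \<and>
    (\<forall>x\<in>C. \<phi> x \<in> B) \<and> Pr (replicate_pmf n s) (- C) \<le> \<eta> / 4 \<and>
    (\<forall>i\<in>cls P m s. Pr (iid_pairs n (P i)) {(y, x). x \<in> C \<and> (y, \<phi> x) \<notin> A' s i n} \<le> \<eta> / 4)"
    unfolding A'_def using fin \<delta>(1) \<eta>4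
    by (intro eventually_ball_finite ballI finS source_code) (auto simp: cls_def margX_def)
  moreover have "\<forall>\<^sub>F n in sequentially. \<forall>i\<in>{1..m}. Pr (replicate_pmf n (?Y i)) (- TY i n) < \<eta> / 4"
    using TY \<eta>4 by (intro eventually_ball_finite ballI order_tendstoD(2)) auto
  moreover have "\<forall>\<^sub>F n in sequentially. \<forall>s\<in>?S. Pr (replicate_pmf n s) (- DX s n) < \<eta> / 4"
    using DX \<eta>4 finS by (intro eventually_ball_finite ballI order_tendstoD(2)) auto
  moreover have "\<forall>\<^sub>F n in sequentially. real n \<ge> ln (1 + 2 * real m) / \<delta>" by (rule eventually_real_ge)
  ultimately show ?thesis
  proof eventually_elim
    case (elim n)
    \<comment> \<open>One flag and at most \<open>m\<close> codebooks of size at most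
      \<open>2 * exp (n * (R + \<delta>))\<close>, the 2 absorbing the rounding of the codebook
      size.\<close>
    have mexp: "1 + 2 * real m \<le> exp (real n * \<delta>)"
    proof -
      have "ln (1 + 2 * real m) \<le> real n * \<delta>" using elim(4) \<delta>(1) by (simp add: field_simps)
      then have "exp (ln (1 + 2 * real m)) \<le> exp (real n * \<delta>)" by (rule exp_le_cancel_iff[THEN iffD2])
      then show ?thesis by simp
    qed
    define code_ok where "code_ok s B \<phi> C \<longleftrightarrow> finite B \<and> real (card B) \<le> exp (real n * (minfo (law_XU s (W s)) + \<delta>)) + 1 \<and>
      (\<forall>x\<in>C. \<phi> x \<in> B) \<and> Pr (replicate_pmf n s) (- C) \<le> \<eta> / 4 \<and>
      (\<forall>i\<in>cls P m s. Pr (iid_pairs n (P i)) {(y, x). x \<in> C \<and> (y, \<phi> x) \<notin> A' s i n} \<le> \<eta> / 4)" for s B \<phi> C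
    have "\<forall>s\<in>?S. \<exists>T. code_ok s (fst T) (fst (snd T)) (snd (snd T))"
      using elim(1) by (simp add: code_ok_def)
    from bchoice[OF this] obtain T
      where T: "\<And>s. s \<in> ?S \<Longrightarrow> code_ok s (fst (T s)) (fst (snd (T s))) (snd (snd (T s)))" by blast
    define B where "B s = fst (T s)" for s
    define \<phi> where "\<phi> s = fst (snd (T s))" for s
    define C where "C s = snd (snd (T s))" for s
    have code: "finite (B s) \<and> real (card (B s)) \<le> exp (real n * (minfo (law_XU s (W s)) + \<delta>)) + 1 \<and>
      (\<forall>x\<in>C s. \<phi> s x \<in> B s) \<and> Pr (replicate_pmf n s) (- C s) \<le> \<eta> / 4 \<and>
      (\<forall>i\<in>cls P m s. Pr (iid_pairs n (P i)) {(y, x). x \<in> C s \<and> (y, \<phi> s x) \<notin> A' s i n} \<le> \<eta> / 4)"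
      if "s \<in> ?S" for s
      using T[OF that] unfolding code_ok_def B_def \<phi>_def C_def .
    obtain idx :: "'x pmf \<Rightarrow> nat" where idx: "inj_on idx ?S"
      using inj_on_to_nat_on[OF countable_finite[OF finS]] by blast
    define enc where "enc s u = to_nat (Some (idx s, u))" for s and u :: "nat list"
    \<comment> \<open>The error flag differs from every coded pair and is never accepted, so only
      blocks in some \<open>DX s n\<close> contribute to the second error.\<close>
    define nil where "nil = to_nat (None :: (nat \<times> nat list) option)"
    have enc_nil: "enc s u \<noteq> nil" for s u by (simp add: enc_def nil_def)
    have enc_eq: "s = s' \<and> u = u'" if "enc s u = enc s' u'" "s \<in> ?S" "s' \<in> ?S" for s s' u u'
      using that idx by (auto simp: enc_def inj_on_def)
    define ok where "ok x s \<longleftrightarrow> s \<in> ?S \<and> x \<in> DX s n \<and> x \<in> C s" for x s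
    have ok_unique: "s = s'" if "ok x s" "ok x s'" for x s s'
    proof (rule ccontr)
      assume "s \<noteq> s'"
      then have "pmf (replicate_pmf n s') x < pmf (replicate_pmf n s) x" "pmf (replicate_pmf n s) x < pmf (replicate_pmf n s') x"
        using that by (auto simp: ok_def DX_def)
      then show False by simp
    qed
    define \<Phi> where "\<Phi> x = (if \<exists>s. ok x s then enc (THE s. ok x s) (\<phi> (THE s. ok x s) x) else nil)" for x
    have \<Phi>_ok: "\<Phi> x = enc s (\<phi> s x)" if "ok x s" for x s
    proof -
      have "(THE s. ok x s) = s" using that ok_unique by blast
      then show ?thesis using that by (auto simp: \<Phi>_def)
    qed
    define Acc where "Acc = {(y, msg). \<exists>i\<in>{1..m}. \<exists>u. msg = enc (?X i) u \<and> y \<in> TY i n \<and> (y, u) \<in> A i n}"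
    define \<psi> where "\<psi> = (\<lambda>z. return_pmf (if z \<in> Acc then Accept_Null else Reject_Null))"
    define M where "M = insert nil (\<Union>s\<in>?S. enc s ` B s)"
    have finM: "finite M" using finS code by (auto simp: M_def)
    have \<Phi>M: "\<Phi> x \<in> M" for x
    proof (cases "\<exists>s. ok x s")
      case True
      then obtain s where s: "ok x s" by blast
      then have "s \<in> ?S" "\<phi> s x \<in> B s" using code by (auto simp: ok_def)
      then show ?thesis using \<Phi>_ok[OF s] by (auto simp: M_def)
    qed (simp add: \<Phi>_def M_def)
    have cardM: "real (card M) \<le> exp (real n * (R + \<eta>))"
    proof -
      have eR: "exp (real n * (R + \<delta>)) \<ge> 1" using \<open>R \<ge> 0\<close> \<delta>(1) by simp
      have "card M \<le> 1 + card (\<Union>s\<in>?S. enc s ` B s)"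
        unfolding M_def using card_insert_le_m1 by (simp add: card_insert_if finS code)
      also have "card (\<Union>s\<in>?S. enc s ` B s) \<le> (\<Sum>s\<in>?S. card (enc s ` B s))" by (rule card_UN_le[OF finS])
      also have "\<dots> \<le> (\<Sum>s\<in>?S. card (B s))" using code by (intro sum_mono card_image_le) auto
      finally have "real (card M) \<le> 1 + (\<Sum>s\<in>?S. real (card (B s)))" by (simp flip: of_nat_sum)
      also have "\<dots> \<le> 1 + (\<Sum>s\<in>?S. 2 * exp (real n * (R + \<delta>)))"
      proof (intro add_left_mono sum_mono)
        fix s assume s: "s \<in> ?S"
        have "exp (real n * (minfo (law_XU s (W s)) + \<delta>)) \<le> exp (real n * (R + \<delta>))"
          using rate[OF s] by (simp add: mult_left_mono)
        then show "real (card (B s)) \<le> 2 * exp (real n * (R + \<delta>))" using code[OF s] eR by linarith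
      qed
      also have "\<dots> = 1 + 2 * real (card ?S) * exp (real n * (R + \<delta>))" by simp
      also have "\<dots> \<le> exp (real n * (R + \<delta>)) + 2 * real m * exp (real n * (R + \<delta>))"
      proof -
        have "card ?S \<le> m" unfolding PXs_def using card_image_le[of "{1..m}" "?X"] by simp
        then have "2 * real (card ?S) * exp (real n * (R + \<delta>)) \<le> 2 * real m * exp (real n * (R + \<delta>))"
          by (intro mult_right_mono) auto
        then show ?thesis using eR by linarith
      qed
      also have "\<dots> = (1 + 2 * real m) * exp (real n * (R + \<delta>))" by (simp add: algebra_simps)
      also have "\<dots> \<le> exp (real n * \<delta>) * exp (real n * (R + \<delta>))" using mexp by (intro mult_right_mono) auto
      also have "\<dots> = exp (real n * (R + 2 * \<delta>))" by (simp add: algebra_simps flip: exp_add)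
      also have "\<dots> \<le> exp (real n * (R + \<eta>))" using \<delta>(2) by (simp add: mult_left_mono)
      finally show ?thesis .
    qed
    have alpha: "1 - accept_prob (compressed \<Phi> (iid_pairs n (P i))) \<psi> \<le> \<eta>" if i: "i \<in> {1..m}" for i
    proof -
      let ?R = "iid_pairs n (P i)" and ?s = "?X i"
      have s: "?s \<in> ?S" "i \<in> cls P m ?s" using i X_S by (auto simp: cls_def)
      let ?V = "{(y, x). (y, \<Phi> x) \<in> Acc}"
      have "accept_prob (compressed \<Phi> ?R) \<psi> = Pr ?R ?V"
        unfolding \<psi>_def accept_prob_deterministic compressed_def by (auto simp: vimage_def intro!: arg_cong[where f = "Pr ?R"])
      then have "1 - accept_prob (compressed \<Phi> ?R) \<psi> = Pr ?R (- ?V)"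
        using measure_pmf.prob_compl[of ?V ?R] by (simp add: Compl_eq_Diff_UNIV)
      also have "\<dots> \<le> Pr ?R (((snd -` (- DX ?s n)) \<union> (snd -` (- C ?s))) \<union> ((fst -` (- TY i n)) \<union> {(y, x). x \<in> C ?s \<and> (y, \<phi> ?s x) \<notin> A i n}))"
      proof (rule prob_mono_set)
        fix z assume "z \<in> - ?V"
        then obtain y x where z: "z = (y, x)" "(y, \<Phi> x) \<notin> Acc" by (cases z) auto
        show "z \<in> ((snd -` (- DX ?s n)) \<union> (snd -` (- C ?s))) \<union> ((fst -` (- TY i n)) \<union> {(y, x). x \<in> C ?s \<and> (y, \<phi> ?s x) \<notin> A i n})"
        proof (rule ccontr)
          assume "\<not> ?thesis"
          then have "ok x ?s" "y \<in> TY i n" "(y, \<phi> ?s x) \<in> A i n" using z s by (auto simp: ok_def)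
          then have "(y, \<Phi> x) \<in> Acc" using i \<Phi>_ok unfolding Acc_def by blast
          then show False using z by simp
        qed
      qed
      also have "\<dots> \<le> (Pr ?R (snd -` (- DX ?s n)) + Pr ?R (snd -` (- C ?s)))
          + (Pr ?R (fst -` (- TY i n)) + Pr ?R {(y, x). x \<in> C ?s \<and> (y, \<phi> ?s x) \<notin> A i n})"
        by (intro order_trans[OF measure_Un_le] add_mono) auto
      also have "\<dots> \<le> (\<eta> / 4 + \<eta> / 4) + (\<eta> / 4 + \<eta> / 4)"
      proof (intro add_mono)
        have "Pr ?R (snd -` V) = Pr (replicate_pmf n ?s) V" for V
          unfolding measure_map_pmf[symmetric] iid_pairs_snd by (simp add: margX_def)
        then show "Pr ?R (snd -` (- DX ?s n)) \<le> \<eta> / 4" "Pr ?R (snd -` (- C ?s)) \<le> \<eta> / 4"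
          using elim(3) code s by (auto intro: less_imp_le)
        have "Pr ?R (fst -` V) = Pr (replicate_pmf n (?Y i)) V" for V
          unfolding measure_map_pmf[symmetric] iid_pairs_fst by (simp add: margY_def)
        then show "Pr ?R (fst -` (- TY i n)) \<le> \<eta> / 4"
          using elim(2) i by (auto intro: less_imp_le)
        show "Pr ?R {(y, x). x \<in> C ?s \<and> (y, \<phi> ?s x) \<notin> A i n} \<le> \<eta> / 4"
          using code[OF s(1)] s(2) by (simp add: A_def)
      qed
      finally show ?thesis by simp
    qed
    have beta: "accept_prob (pair_pmf (QY j n) (map_pmf \<Phi> (QX t n))) \<psi> \<le> exp (- (real n * E))"
      if j: "j \<in> {1..k}" and t: "t \<in> {1..r}" for j t
    proof -
      let ?Q = "pair_pmf (QY j n) (QX t n)"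
      let ?N = "\<lambda>i x. {y. y \<in> TY i n \<and> (y, \<phi> (?X i) x) \<in> A i n}"
      have "accept_prob (pair_pmf (QY j n) (map_pmf \<Phi> (QX t n))) \<psi> = Pr ?Q (apsnd \<Phi> -` Acc)"
        unfolding \<psi>_def accept_prob_deterministic pair_map_pmf2 by simp
      also have "\<dots> \<le> Pr ?Q (\<Union>i\<in>{1..m}. {(y, x). x \<in> DX (?X i) n \<and> y \<in> ?N i x})"
      proof (rule prob_mono_set)
        fix z assume "z \<in> apsnd \<Phi> -` Acc"
        then obtain y x where z: "z = (y, x)" "(y, \<Phi> x) \<in> Acc" by (cases z) auto
        then obtain i u where i: "i \<in> {1..m}" "\<Phi> x = enc (?X i) u" "y \<in> TY i n" "(y, u) \<in> A i n"
          unfolding Acc_def by blast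
        then obtain s where s: "ok x s" using enc_nil[of "?X i" u] unfolding \<Phi>_def by metis
        then have "s = ?X i \<and> \<phi> s x = u"
          using \<Phi>_ok[OF s] i X_S by (intro enc_eq) (auto simp: ok_def)
        then show "z \<in> (\<Union>i\<in>{1..m}. {(y, x). x \<in> DX (?X i) n \<and> y \<in> ?N i x})"
          using i s z by (auto simp: ok_def)
      qed
      also have "\<dots> \<le> (\<Sum>i\<in>{1..m}. Pr ?Q {(y, x). x \<in> DX (?X i) n \<and> y \<in> ?N i x})"
        by (intro measure_UNION_le) auto
      also have "\<dots> \<le> (\<Sum>i\<in>{1..m}. exp (- (real n * (E + \<delta>))))"
      proof (rule sum_mono)
        fix i assume i: "i \<in> {1..m}"
        let ?ey = "exp (- (real n * (dy i - \<delta>)))" and ?ei = "exp (- (real n * (I i - \<delta>)))"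
          and ?ex = "exp (- (real n * (dx (?X i) - \<delta>)))"
        \<comment> \<open>First change measure from \<open>QY j n\<close> to the product law, as
          \<open>TY i n\<close> permits; then use the false alarm bound for the codeword of this
          \<open>x\<close>.\<close>
        have Ni: "Pr (QY j n) (?N i x) \<le> ?ey * ?ei" for x
        proof -
          have "Pr (QY j n) (?N i x) \<le> ?ey * Pr (replicate_pmf n (?Y i)) (?N i x)"
            using j by (intro prob_le_ratio) (auto simp: TY_def)
          also have "Pr (replicate_pmf n (?Y i)) (?N i x)
              \<le> Pr (replicate_pmf n (?Y i)) {y. (y, \<phi> (?X i) x) \<in> A i n}"
            by (intro prob_mono_set) auto
          also have "\<dots> \<le> ?ei"
            using accept_set_prob[of n "law_YU (P i) (W (?X i))"] by (simp add: A_def A'_def I_def map_fst_law_YU margY_def)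
          finally show ?thesis by simp
        qed
        have "Pr ?Q {(y, x). x \<in> DX (?X i) n \<and> y \<in> ?N i x} \<le> (?ey * ?ei) * Pr (QX t n) (DX (?X i) n)"
          using Ni by (intro prob_pair_le) auto
        also have "Pr (QX t n) (DX (?X i) n) \<le> ?ex * Pr (replicate_pmf n (?X i)) (DX (?X i) n)"
          using t by (intro prob_le_ratio) (auto simp: DX_def)
        also have "\<dots> \<le> ?ex * 1" by (intro mult_left_mono) auto
        also have "(?ey * ?ei) * (?ex * 1) = exp (- (real n * (I i + dy i + dx (?X i) - 3 * \<delta>)))"
          by (simp add: algebra_simps flip: exp_add)
        also have "\<dots> \<le> exp (- (real n * (E + \<delta>)))"
          using \<delta>(3)[OF i] by (simp add: mult_left_mono)
        finally show "Pr ?Q {(y, x). x \<in> DX (?X i) n \<and> y \<in> ?N i x} \<le> exp (- (real n * (E + \<delta>)))"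
          by simp
      qed
      also have "\<dots> = real m * exp (- (real n * (E + \<delta>)))" by simp
      also have "\<dots> \<le> exp (real n * \<delta>) * exp (- (real n * (E + \<delta>)))"
        using mexp by (intro mult_right_mono) auto
      also have "\<dots> = exp (- (real n * E))" by (simp add: algebra_simps flip: exp_add)
      finally show ?thesis .
    qed
    have "compound_alpha m P n \<Phi> \<psi> \<le> \<eta>"
      unfolding compound_alpha_def using alpha m by (subst Max_le_iff) auto
    moreover have "compound_beta k r QY QX n \<Phi> \<psi> \<le> exp (- (real n * E))"
      unfolding compound_beta_def using beta k r by (subst Max_le_iff) auto
    ultimately show ?case
      using finM \<Phi>M cardM by (intro exI[of _ M] exI[of _ \<Phi>] exI[of _ \<psi>]) auto
  qed
qed

section \<open>The rate region\<close>

text \<open>More unknowns than equations: Gaussian elimination by induction, where an equation with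
  a nonzero coefficient at \<open>v\<close> is used to eliminate that unknown.\<close>

lemma homogeneous_system:
  fixes a :: "'c \<Rightarrow> 'b \<Rightarrow> real"
  assumes "finite C" "finite S" "card C < card S"
  shows "\<exists>\<mu>. (\<exists>u\<in>S. \<mu> u \<noteq> 0) \<and> (\<forall>c\<in>C. (\<Sum>u\<in>S. \<mu> u * a c u) = 0)"
  using assms
proof (induction C arbitrary: S a rule: finite_induct)
  case empty
  then have "S \<noteq> {}" by auto
  then show ?case by (intro exI[of _ "\<lambda>_. 1"]) auto
next
  case (insert c C)
  show ?case
  proof (cases "\<forall>u\<in>S. a c u = 0")
    case True
    have "card C < card S" using insert by simp
    then obtain \<mu> where "\<exists>u\<in>S. \<mu> u \<noteq> 0" "\<forall>c\<in>C. (\<Sum>u\<in>S. \<mu> u * a c u) = 0"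
      using insert.IH[OF insert.prems(1), of a] by blast
    then show ?thesis using True by (intro exI[of _ \<mu>]) auto
  next
    case False
    then obtain v where v: "v \<in> S" "a c v \<noteq> 0" by blast
    let ?S = "S - {v}"
    have "card C < card ?S" "finite ?S" using insert v by auto
    then obtain \<mu> where \<mu>: "\<exists>u\<in>?S. \<mu> u \<noteq> 0"
      "\<forall>d\<in>C. (\<Sum>u\<in>?S. \<mu> u * (a d u - a c u / a c v * a d v)) = 0"
      using insert.IH[of ?S "\<lambda>d u. a d u - a c u / a c v * a d v"] by blast
    define \<mu>' where "\<mu>' u = (if u = v then - (\<Sum>u\<in>?S. \<mu> u * a c u) / a c v else \<mu> u)" for u
    have split: "(\<Sum>u\<in>S. \<mu>' u * a d u) = \<mu>' v * a d v + (\<Sum>u\<in>?S. \<mu> u * a d u)" for d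
    proof -
      have "(\<Sum>u\<in>?S. \<mu>' u * a d u) = (\<Sum>u\<in>?S. \<mu> u * a d u)"
        by (intro sum.cong) (auto simp: \<mu>'_def)
      then show ?thesis using insert.prems(1) v by (simp add: sum.remove)
    qed
    have "(\<Sum>u\<in>S. \<mu>' u * a d u) = 0" if "d \<in> insert c C" for d
    proof (cases "d = c")
      case True
      show ?thesis unfolding True split using v by (simp add: \<mu>'_def)
    next
      case False
      then have "(\<Sum>u\<in>?S. \<mu> u * (a d u - a c u / a c v * a d v)) = 0" using \<mu>(2) that by auto
      moreover have "(\<Sum>u\<in>?S. \<mu> u * (a d u - a c u / a c v * a d v))
          = (\<Sum>u\<in>?S. \<mu> u * a d u) - (\<Sum>u\<in>?S. \<mu> u * a c u) / a c v * a d v"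
        by (simp add: right_diff_distrib sum_subtractf sum_distrib_left sum_distrib_right sum_divide_distrib mult_ac)
      ultimately show ?thesis unfolding split by (simp add: \<mu>'_def)
    qed
    moreover have "\<exists>u\<in>S. \<mu>' u \<noteq> 0" using \<mu>(1) by (auto simp: \<mu>'_def)
    ultimately show ?thesis by blast
  qed
qed

text \<open>Among all admissible weights take one of smallest support. If the support exceeded the
  number of constraints, its points would satisfy a nontrivial linear relation, and moving along
  this relation would bring one more weight to zero without violating a constraint.\<close>

lemma caratheodory_weights:
  fixes a :: "'c \<Rightarrow> 'b \<Rightarrow> real"
  assumes "finite C" "finite A"
  obtains l :: "'b \<Rightarrow> real" where "\<And>u. l u \<ge> 0" "card {u \<in> A. l u \<noteq> 0} \<le> card C"
    "\<And>c. c \<in> C \<Longrightarrow> (\<Sum>u\<in>A. l u * a c u) = (\<Sum>u\<in>A. a c u)"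
proof -
  define ok where "ok l \<longleftrightarrow> (\<forall>u. l u \<ge> 0) \<and> (\<forall>c\<in>C. (\<Sum>u\<in>A. l u * a c u) = (\<Sum>u\<in>A. a c u))" for l :: "'b \<Rightarrow> real"
  let ?card = "\<lambda>l :: 'b \<Rightarrow> real. card {u \<in> A. l u \<noteq> 0}"
  have "ok (\<lambda>_. 1)" by (simp add: ok_def)
  then obtain l where l: "ok l" and min: "\<And>l'. ok l' \<Longrightarrow> ?card l \<le> ?card l'"
    using ex_has_least_nat[of ok "\<lambda>_. 1" ?card] by blast
  have "?card l \<le> card C"
  proof (rule ccontr)
    let ?S = "{u \<in> A. l u \<noteq> 0}"
    assume "\<not> ?thesis"
    moreover have fS: "finite ?S" using assms by simp
    ultimately obtain \<mu>0 where \<mu>0: "\<exists>u\<in>?S. \<mu>0 u \<noteq> 0" "\<And>c. c \<in> C \<Longrightarrow> (\<Sum>u\<in>?S. \<mu>0 u * a c u) = 0"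
      using homogeneous_system[OF assms(1), of ?S a] by auto
    \<comment> \<open>A change of sign, if necessary, provides a positive coefficient, so that
      moving along \<open>- \<mu>\<close> must hit the boundary.\<close>
    obtain \<mu> where \<mu>: "\<exists>u\<in>?S. \<mu> u > 0" "\<And>c. c \<in> C \<Longrightarrow> (\<Sum>u\<in>?S. \<mu> u * a c u) = 0"
    proof (cases "\<exists>u\<in>?S. \<mu>0 u > 0")
      case True
      show thesis by (rule that[OF True \<mu>0(2)])
    next
      case False
      then have "\<exists>u\<in>?S. - \<mu>0 u > 0" using \<mu>0(1) by (force simp: not_less)
      moreover have "(\<Sum>u\<in>?S. - \<mu>0 u * a c u) = 0" if "c \<in> C" for c
        using \<mu>0(2)[OF that] by (simp add: sum_negf)
      ultimately show thesis by (rule that)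
    qed
    let ?T = "{u \<in> ?S. \<mu> u > 0}"
    \<comment> \<open>The largest step that keeps all weights nonnegative; the weight of the
      minimiser \<open>u0\<close> becomes zero.\<close>
    define t where "t = Min ((\<lambda>u. l u / \<mu> u) ` ?T)"
    have "finite ?T" by (rule finite_subset[OF _ fS]) auto
    then have fT: "finite ((\<lambda>u. l u / \<mu> u) ` ?T)" "(\<lambda>u. l u / \<mu> u) ` ?T \<noteq> {}" using \<mu>(1) by (auto intro: finite_imageI)
    obtain u0 where u0: "u0 \<in> ?T" "t = l u0 / \<mu> u0" using Min_in[OF fT] unfolding t_def by blast
    have t0: "t \<ge> 0" using u0 l by (simp add: ok_def)
    define l' where "l' u = (if u \<in> ?S then l u - t * \<mu> u else if u \<in> A then 0 else l u)" for u
    have "l' u \<ge> 0" for u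
    proof (cases "u \<in> ?T")
      case True
      then have "t \<le> l u / \<mu> u" unfolding t_def using fT by (intro Min_le) auto
      then show ?thesis using True by (simp add: l'_def field_simps)
    next
      case False
      have l0: "l u \<ge> 0" using l by (simp add: ok_def)
      show ?thesis
      proof (cases "u \<in> ?S")
        case True
        then have "\<mu> u \<le> 0" using False by (auto simp: not_less)
        then have "t * \<mu> u \<le> 0" using t0 by (simp add: mult_nonneg_nonpos)
        then show ?thesis using l0 True by (simp add: l'_def)
      qed (use l0 in \<open>auto simp: l'_def\<close>)
    qed
    moreover have "(\<Sum>u\<in>A. l' u * a c u) = (\<Sum>u\<in>A. a c u)" if c: "c \<in> C" for c
    proof -
      have "(\<Sum>u\<in>A. l' u * a c u) = (\<Sum>u\<in>?S. l' u * a c u)"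
        using assms by (intro sum.mono_neutral_right) (auto simp: l'_def)
      also have "\<dots> = (\<Sum>u\<in>?S. l u * a c u - t * (\<mu> u * a c u))"
        by (intro sum.cong) (auto simp: l'_def algebra_simps)
      also have "\<dots> = (\<Sum>u\<in>?S. l u * a c u) - t * (\<Sum>u\<in>?S. \<mu> u * a c u)"
        by (simp add: sum_subtractf sum_distrib_left)
      also have "\<dots> = (\<Sum>u\<in>?S. l u * a c u)" using \<mu>(2)[OF c] by simp
      also have "\<dots> = (\<Sum>u\<in>A. l u * a c u)"
        using assms by (intro sum.mono_neutral_left) auto
      also have "\<dots> = (\<Sum>u\<in>A. a c u)" using l c by (simp add: ok_def)
      finally show ?thesis .
    qed
    ultimately have "ok l'" by (simp add: ok_def)
    moreover have "?card l' < ?card l"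
    proof (rule psubset_card_mono[OF fS])
      have "l' u0 = 0" using u0 by (simp add: l'_def)
      then have "u0 \<in> ?S" "u0 \<notin> {u \<in> A. l' u \<noteq> 0}" using u0(1) by auto
      moreover have "{u \<in> A. l' u \<noteq> 0} \<subseteq> ?S" by (auto simp: l'_def)
      ultimately show "{u \<in> A. l' u \<noteq> 0} \<subset> ?S" by blast
    qed
    ultimately show False using min[of l'] by simp
  qed
  then show thesis using that[of l] l by (simp add: ok_def)
qed

text \<open>Bolzano--Weierstrass, one coordinate at a time.\<close>

lemma finite_family_subsequence:
  fixes f :: "'j \<Rightarrow> nat \<Rightarrow> real"
  assumes "finite J" "\<And>j k. j \<in> J \<Longrightarrow> f j k \<in> {lo..hi}"
  obtains q and g where "strict_mono (q :: nat \<Rightarrow> nat)" "\<And>j. j \<in> J \<Longrightarrow> (\<lambda>k. f j (q k)) \<longlonglongrightarrow> g j"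
proof -
  have "\<exists>q g. strict_mono (q :: nat \<Rightarrow> nat) \<and> (\<forall>j\<in>J. (\<lambda>k. f j (q k)) \<longlonglongrightarrow> g j)"
    using assms
  proof (induction J rule: finite_induct)
    case empty
    show ?case by (intro exI[of _ id]) (auto simp: strict_mono_def)
  next
    case (insert j J)
    then obtain q g where q: "strict_mono (q :: nat \<Rightarrow> nat)" "\<forall>j\<in>J. (\<lambda>k. f j (q k)) \<longlonglongrightarrow> g j" by auto
    have "seq_compact {lo..hi}" using compact_Icc compact_imp_seq_compact by blast
    moreover have "\<forall>k. f j (q k) \<in> {lo..hi}" using insert.prems by blast
    ultimately obtain x q' where q': "strict_mono (q' :: nat \<Rightarrow> nat)" "((\<lambda>k. f j (q k)) \<circ> q') \<longlonglongrightarrow> x"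
      by (rule seq_compactE)
    show ?case
    proof (intro exI[of _ "q \<circ> q'"] exI[of _ "g(j := x)"] conjI ballI)
      show "strict_mono (q \<circ> q')" using q q' by (simp add: strict_mono_o)
      fix i assume i: "i \<in> insert j J"
      show "(\<lambda>k. f i ((q \<circ> q') k)) \<longlonglongrightarrow> (g(j := x)) i"
      proof (cases "i = j")
        case True
        then show ?thesis using q'(2) by (simp add: comp_def)
      next
        case False
        then have "(\<lambda>k. f i (q k)) \<longlonglongrightarrow> g i" using i q(2) by auto
        from LIMSEQ_subseq_LIMSEQ[OF this q'(1)] show ?thesis using False by (simp add: comp_def)
      qed
    qed
  qed
  then show thesis using that by blast
qed

section \<open>Mutual information as a sum over the values of U\<close>

definition xlnx :: "real \<Rightarrow> real" where "xlnx t = t * ln t"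

lemma xlnx_mult: "c \<ge> 0 \<Longrightarrow> t \<ge> 0 \<Longrightarrow> xlnx (c * t) = c * xlnx t + t * xlnx c"
  by (cases "c = 0"; cases "t = 0") (auto simp: xlnx_def ln_mult_pos algebra_simps)

text \<open>Limits of joint tables may acquire zero entries, so continuity at 0 is the point. There
  \<open>ln 0 = 0\<close> gives the right value, and the convergence follows from
  \<open>\<bar>t * ln t\<bar> <= 2 * sqrt t\<close> on the unit interval.\<close>

lemma tendsto_xlnx:
  assumes "\<And>k. f k \<ge> 0" "f \<longlonglongrightarrow> a"
  shows "(\<lambda>k. xlnx (f k)) \<longlonglongrightarrow> xlnx a"
proof (cases "a = 0")
  case False
  then show ?thesis using assms unfolding xlnx_def by (intro tendsto_intros) auto
next
  case True
  have bound: "\<bar>xlnx t\<bar> \<le> 2 * sqrt t" if "0 \<le> t" "t \<le> 1" for t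
  proof (cases "t = 0")
    case False
    then have t: "t > 0" using that by simp
    have "ln (1 / sqrt t) \<le> 1 / sqrt t" using t ln_le_minus_one[of "1 / sqrt t"] by simp
    then have "- ln t \<le> 2 / sqrt t" using t by (simp add: ln_div ln_sqrt)
    then have "t * - ln t \<le> t * (2 / sqrt t)" using t by (intro mult_left_mono) auto
    also have "\<dots> = 2 * sqrt t" using t by (simp add: field_simps)
    finally have "- xlnx t \<le> 2 * sqrt t" by (simp add: xlnx_def)
    moreover have "xlnx t \<le> 0" using t that by (simp add: xlnx_def mult_nonneg_nonpos)
    ultimately show ?thesis by simp
  qed (simp add: xlnx_def)
  have "\<forall>\<^sub>F k in sequentially. f k < 1" using assms(2) True by (intro order_tendstoD) auto
  then have "\<forall>\<^sub>F k in sequentially. norm (xlnx (f k)) \<le> 2 * sqrt (f k)"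
    using bound assms(1) by (auto elim!: eventually_mono)
  moreover have "(\<lambda>k. 2 * sqrt (f k)) \<longlonglongrightarrow> 2 * sqrt a" by (intro tendsto_intros assms)
  ultimately show ?thesis
    using True Lim_null_comparison[of "\<lambda>k. xlnx (f k)" "\<lambda>k. 2 * sqrt (f k)" sequentially] by (simp add: xlnx_def)
qed

text \<open>
  A column \<open>v\<close> stands for \<open>x \<mapsto> Pr[X = x, U = u]\<close> at a fixed \<open>u\<close>, and \<open>col_info s V v\<close> is the
  contribution of this \<open>u\<close> to the mutual information between \<open>U\<close> and the output of the channel
  \<open>V\<close>. It is homogeneous of degree one, so columns need not be normalised.
\<close>

definition col_info :: "'x::finite pmf \<Rightarrow> ('z::finite \<Rightarrow> 'x \<Rightarrow> real) \<Rightarrow> ('x \<Rightarrow> real) \<Rightarrow> real" where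
  "col_info s V v = (\<Sum>z\<in>UNIV. xlnx (\<Sum>x\<in>UNIV. V z x * v x)) - xlnx (\<Sum>x\<in>UNIV. v x)
     - (\<Sum>z\<in>UNIV. (\<Sum>x\<in>UNIV. V z x * v x) * ln (\<Sum>x\<in>UNIV. V z x * pmf s x))"

definition stochastic :: "('z::finite \<Rightarrow> 'x \<Rightarrow> real) \<Rightarrow> bool" where
  "stochastic V \<longleftrightarrow> (\<forall>z x. V z x \<ge> 0) \<and> (\<forall>x. (\<Sum>z\<in>UNIV. V z x) = 1)"

lemma stochastic_sum:
  fixes V :: "'z::finite \<Rightarrow> 'x::finite \<Rightarrow> real"
  assumes "stochastic V"
  shows "(\<Sum>z\<in>UNIV. \<Sum>x\<in>UNIV. V z x * v x) = (\<Sum>x\<in>UNIV. v x)"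
proof -
  have "(\<Sum>z\<in>UNIV. \<Sum>x\<in>UNIV. V z x * v x) = (\<Sum>x\<in>UNIV. \<Sum>z\<in>UNIV. V z x * v x)" by (rule sum.swap)
  also have "\<dots> = (\<Sum>x\<in>UNIV. v x)" using assms by (simp add: stochastic_def flip: sum_distrib_right)
  finally show ?thesis .
qed

text \<open>The terms in \<open>xlnx c\<close> cancel because a stochastic matrix preserves the
  total mass of a column.\<close>

lemma col_info_scale:
  assumes V: "stochastic V" and c: "c \<ge> 0" and v: "\<And>x. v x \<ge> 0"
  shows "col_info s V (\<lambda>x. c * v x) = c * col_info s V v"
proof -
  let ?o = "\<lambda>z. \<Sum>x\<in>UNIV. V z x * v x"
  have o0: "?o z \<ge> 0" for z using V v by (intro sum_nonneg) (auto simp: stochastic_def)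
  have o: "(\<Sum>x\<in>UNIV. V z x * (c * v x)) = c * ?o z" for z by (simp add: sum_distrib_left mult_ac)
  have v': "(\<Sum>x\<in>UNIV. c * v x) = c * (\<Sum>x\<in>UNIV. v x)" by (simp add: sum_distrib_left)
  have "col_info s V (\<lambda>x. c * v x) = (\<Sum>z\<in>UNIV. c * xlnx (?o z) + ?o z * xlnx c)
      - (c * xlnx (\<Sum>x\<in>UNIV. v x) + (\<Sum>x\<in>UNIV. v x) * xlnx c)
      - (\<Sum>z\<in>UNIV. c * (?o z * ln (\<Sum>x\<in>UNIV. V z x * pmf s x)))"
    unfolding col_info_def o v' using c v o0 by (simp add: xlnx_mult sum_nonneg mult_ac)
  also have "\<dots> = c * col_info s V v"
    unfolding col_info_def sum.distrib sum_distrib_left[symmetric] sum_distrib_right[symmetric] stochastic_sum[OF V]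
    by (simp add: algebra_simps)
  finally show ?thesis .
qed

lemma col_info_tendsto:
  assumes V: "stochastic V" and v: "\<And>k x. v k x \<ge> 0" "\<And>x. (\<lambda>k. v k x) \<longlonglongrightarrow> v' x"
  shows "(\<lambda>k. col_info s V (v k)) \<longlonglongrightarrow> col_info s V v'"
  unfolding col_info_def using V v
  by (intro tendsto_intros tendsto_xlnx sum_nonneg) (auto simp: stochastic_def)

text \<open>The noiseless channel, through which I(X; U) becomes an instance of
  \<open>col_info\<close>.\<close>

definition id_chan :: "'x \<Rightarrow> 'x \<Rightarrow> real" where "id_chan z x = (if z = x then 1 else 0)"

lemma stochastic_id_chan: "stochastic (id_chan :: 'x::finite \<Rightarrow> _)"
  by (simp add: stochastic_def id_chan_def)

lemma id_chan_sum: "(\<Sum>x\<in>UNIV. id_chan z x * f x) = f (z :: 'x::finite)"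
  by (simp add: id_chan_def if_distrib[of "\<lambda>c. c * _"] cong: if_cong)

text \<open>Uniform at letters \<open>x\<close> of probability zero, so that the channel is stochastic everywhere.\<close>

definition chan :: "('y::finite \<times> 'x) pmf \<Rightarrow> 'y \<Rightarrow> 'x \<Rightarrow> real" where
  "chan p y x = (if pmf (map_pmf snd p) x = 0 then 1 / real CARD('y) else pmf p (y, x) / pmf (map_pmf snd p) x)"

lemma pmf_map_snd_sum:
  fixes p :: "('y::finite \<times> 'x) pmf"
  shows "pmf (map_pmf snd p) x = (\<Sum>y\<in>UNIV. pmf p (y, x))"
proof -
  have "pmf (map_pmf snd p) x = Pr p ((\<lambda>y. (y, x)) ` UNIV)"
    unfolding pmf_map by (rule arg_cong[where f = "Pr p"]) (auto simp: image_iff)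
  also have "\<dots> = (\<Sum>y\<in>UNIV. pmf p (y, x))"
    by (subst measure_measure_pmf_finite) (auto simp: sum.reindex inj_on_def)
  finally show ?thesis .
qed

lemma pmf_map_fst_sum:
  fixes p :: "('y \<times> 'x) pmf"
  assumes "finite A" "set_pmf (map_pmf snd p) \<subseteq> A"
  shows "pmf (map_pmf fst p) y = (\<Sum>x\<in>A. pmf p (y, x))"
proof -
  have "pmf (map_pmf fst p) y = Pr p ((\<lambda>x. (y, x)) ` A)"
    unfolding pmf_map using assms(2) by (intro antisym prob_mono_set; force simp: image_iff)
  also have "\<dots> = (\<Sum>x\<in>A. pmf p (y, x))"
    using assms(1) by (subst measure_measure_pmf_finite) (auto simp: sum.reindex inj_on_def)
  finally show ?thesis .
qed

lemma stochastic_chan: "stochastic (chan p)"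
  unfolding stochastic_def
proof (intro conjI allI)
  fix x show "(\<Sum>z\<in>UNIV. chan p z x) = 1"
    by (cases "pmf (map_pmf snd p) x = 0")
      (simp_all add: chan_def pmf_map_snd_sum[symmetric] flip: sum_divide_distrib)
qed (simp add: chan_def)

lemma chan_mult: "chan p y x * pmf (map_pmf snd p) x = pmf p (y, x)"
proof (cases "pmf (map_pmf snd p) x = 0")
  case True
  then have "(y, x) \<notin> set_pmf p" by (force simp: pmf_eq_0_set_pmf)
  then have "pmf p (y, x) = 0" by (simp add: set_pmf_iff)
  then show ?thesis using True by simp
qed (simp add: chan_def)

text \<open>The logarithm of the density splits into three terms; summing over \<open>z\<close>
  first leaves one contribution for each \<open>u\<close>.\<close>

lemma minfo_columns:
  fixes L :: "('z::finite \<times> nat) pmf"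
  assumes V: "stochastic V" and A: "finite A" "set_pmf (map_pmf snd L) \<subseteq> A"
    and L: "\<And>z u. u \<in> A \<Longrightarrow> pmf L (z, u) = (\<Sum>x\<in>UNIV. V z x * w u x)"
    and s: "\<And>z. pmf (map_pmf fst L) z = (\<Sum>x\<in>UNIV. V z x * pmf s x)"
  shows "minfo L = (\<Sum>u\<in>A. col_info s V (w u))"
proof -
  let ?z = "pmf (map_pmf fst L)" and ?u = "pmf (map_pmf snd L)"
  have setL: "set_pmf L \<subseteq> UNIV \<times> A" using A(2) by force
  have "minfo L = (\<Sum>(z, u)\<in>UNIV \<times> A. info_density L (z, u) * pmf L (z, u))"
    unfolding minfo_def using A setL by (subst integral_measure_pmf_real[where A = "UNIV \<times> A"]) auto
  also have "\<dots> = (\<Sum>(z, u)\<in>UNIV \<times> A. xlnx (pmf L (z, u)) - pmf L (z, u) * ln (?u u) - pmf L (z, u) * ln (?z z))"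
  proof (rule sum.cong, simp, clarify)
    fix z u
    show "info_density L (z, u) * pmf L (z, u) = xlnx (pmf L (z, u)) - pmf L (z, u) * ln (?u u) - pmf L (z, u) * ln (?z z)"
    proof (cases "(z, u) \<in> set_pmf L")
      case True
      then have "pmf L (z, u) > 0" "?z z > 0" "?u u > 0"
        using pmf_marginal_pos[OF True] by (auto simp: pmf_positive)
      then show ?thesis by (simp add: info_density_def xlnx_def ln_div ln_mult_pos algebra_simps)
    qed (simp add: set_pmf_iff xlnx_def)
  qed
  also have "\<dots> = (\<Sum>u\<in>A. \<Sum>z\<in>UNIV. xlnx (pmf L (z, u)) - pmf L (z, u) * ln (?u u) - pmf L (z, u) * ln (?z z))"
    by (subst sum.cartesian_product[symmetric]) (rule sum.swap)
  also have "\<dots> = (\<Sum>u\<in>A. col_info s V (w u))"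
  proof (rule sum.cong)
    fix u assume u: "u \<in> A"
    have us: "?u u = (\<Sum>x\<in>UNIV. w u x)"
      unfolding pmf_map_snd_sum L[OF u] by (rule stochastic_sum[OF V])
    have "(\<Sum>z\<in>UNIV. pmf L (z, u) * ln (?u u)) = xlnx (\<Sum>x\<in>UNIV. w u x)"
      unfolding sum_distrib_right[symmetric] pmf_map_snd_sum[symmetric] us[symmetric] xlnx_def ..
    then show "(\<Sum>z\<in>UNIV. xlnx (pmf L (z, u)) - pmf L (z, u) * ln (?u u) - pmf L (z, u) * ln (?z z)) = col_info s V (w u)"
      unfolding col_info_def sum_subtractf s L[OF u] by simp
  qed simp
  finally show ?thesis .
qed

text \<open>Read \<open>T\<close> as a number of letters, \<open>a\<close> as their rate budget and
  \<open>b i\<close> as the information guaranteed about the i-th output. Lists of unnormalised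
  columns, in place of kernels, make the set closed under addition and scaling: pieces with
  different alphabets for U are combined by concatenation, which does the work of a time-sharing
  variable.\<close>

definition region ::
  "'x::finite pmf \<Rightarrow> ('i \<Rightarrow> ('y::finite \<times> 'x) pmf) \<Rightarrow> 'i set \<Rightarrow> real \<Rightarrow> real \<Rightarrow> ('i \<Rightarrow> real) \<Rightarrow> bool" where
  "region s P F T a b \<longleftrightarrow> (\<exists>vs. (\<forall>v\<in>set vs. \<forall>x. v x \<ge> 0) \<and> (\<forall>x. (\<Sum>v\<leftarrow>vs. v x) = T * pmf s x) \<and>
     (\<Sum>v\<leftarrow>vs. col_info s id_chan v) \<le> a \<and> (\<forall>i\<in>F. (\<Sum>v\<leftarrow>vs. col_info s (chan (P i)) v) \<ge> b i))"

lemma region_mono: "region s P F T a b \<Longrightarrow> a \<le> a' \<Longrightarrow> (\<And>i. i \<in> F \<Longrightarrow> b' i \<le> b i) \<Longrightarrow> region s P F T a' b'"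
  unfolding region_def by (meson order_trans)

lemma region_zero: "region s P F 0 0 (\<lambda>_. 0)"
  unfolding region_def by (intro exI[of _ "[]"]) simp

lemma region_add:
  assumes "region s P F T a b" "region s P F T' a' b'"
  shows "region s P F (T + T') (a + a') (\<lambda>i. b i + b' i)"
proof -
  obtain vs ws where "\<forall>v\<in>set vs. \<forall>x. v x \<ge> 0" "\<forall>x. (\<Sum>v\<leftarrow>vs. v x) = T * pmf s x"
    "(\<Sum>v\<leftarrow>vs. col_info s id_chan v) \<le> a" "\<forall>i\<in>F. (\<Sum>v\<leftarrow>vs. col_info s (chan (P i)) v) \<ge> b i"
    "\<forall>v\<in>set ws. \<forall>x. v x \<ge> 0" "\<forall>x. (\<Sum>v\<leftarrow>ws. v x) = T' * pmf s x"
    "(\<Sum>v\<leftarrow>ws. col_info s id_chan v) \<le> a'" "\<forall>i\<in>F. (\<Sum>v\<leftarrow>ws. col_info s (chan (P i)) v) \<ge> b' i"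
    using assms unfolding region_def by blast
  then show ?thesis
    unfolding region_def by (intro exI[of _ "vs @ ws"]) (auto simp: ring_distribs intro: add_mono)
qed

lemma col_info_scale_list:
  assumes "stochastic V" "c \<ge> 0" "\<forall>v\<in>set vs. \<forall>x. v x \<ge> 0"
  shows "(\<Sum>v\<leftarrow>map (\<lambda>v x. c * v x) vs. col_info s V v) = c * (\<Sum>v\<leftarrow>vs. col_info s V v)"
  using assms(3) by (induction vs) (auto simp: col_info_scale[OF assms(1,2)] distrib_left)

lemma region_scale:
  assumes "region s P F T a b" "c \<ge> 0"
  shows "region s P F (c * T) (c * a) (\<lambda>i. c * b i)"
proof -
  obtain vs where vs: "\<forall>v\<in>set vs. \<forall>x. v x \<ge> 0" "\<forall>x. (\<Sum>v\<leftarrow>vs. v x) = T * pmf s x"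
    "(\<Sum>v\<leftarrow>vs. col_info s id_chan v) \<le> a" "\<forall>i\<in>F. (\<Sum>v\<leftarrow>vs. col_info s (chan (P i)) v) \<ge> b i"
    using assms unfolding region_def by blast
  let ?ws = "map (\<lambda>v x. c * v x) vs"
  have "(\<Sum>v\<leftarrow>?ws. v x) = c * (\<Sum>v\<leftarrow>vs. v x)" for x
    by (simp add: comp_def sum_list_const_mult)
  then show ?thesis
    unfolding region_def using vs assms(2)
    by (intro exI[of _ ?ws])
      (auto simp: col_info_scale_list[OF stochastic_id_chan assms(2) vs(1)]
        col_info_scale_list[OF stochastic_chan assms(2) vs(1)] simp del: map_map intro: mult_left_mono)
qed

lemma region_sum:
  assumes "finite A" "\<And>x. x \<in> A \<Longrightarrow> region s P F (T x) (a x) (b x)"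
  shows "region s P F (\<Sum>x\<in>A. T x) (\<Sum>x\<in>A. a x) (\<lambda>i. \<Sum>x\<in>A. b x i)"
  using assms by (induction A rule: finite_induct) (auto simp: region_zero intro: region_add)

text \<open>The columns are those of the joint table of \<open>(X, U)\<close>, common to all
  \<open>i\<close>; the dependence on \<open>i\<close> sits in the channel.\<close>

lemma region_single:
  fixes L :: "('x::finite \<times> nat) pmf" and P :: "'i \<Rightarrow> ('y::finite \<times> 'x) pmf"
  assumes L: "finite A" "set_pmf (map_pmf snd L) \<subseteq> A" "map_pmf fst L = s"
    and P: "\<And>i. i \<in> F \<Longrightarrow> map_pmf snd (P i) = s"
    and K: "\<And>i y u. i \<in> F \<Longrightarrow> pmf (K i) (y, u) = (\<Sum>x\<in>UNIV. chan (P i) y x * pmf L (x, u))"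
    and KA: "\<And>i. i \<in> F \<Longrightarrow> set_pmf (map_pmf snd (K i)) \<subseteq> A"
  shows "region s P F 1 (minfo L) (\<lambda>i. minfo (K i))"
proof -
  let ?w = "\<lambda>u x. pmf L (x, u)"
  let ?vs = "map ?w (sorted_list_of_set A)"
  have sum: "(\<Sum>v\<leftarrow>?vs. f v) = (\<Sum>u\<in>A. f (?w u))" for f :: "_ \<Rightarrow> real"
    using L(1) by (simp add: comp_def sum_list_distinct_conv_sum_set)
  have Ls: "(\<Sum>u\<in>A. ?w u x) = pmf s x" for x
    using pmf_map_fst_sum[OF L(1,2), of x] L(3) by simp
  have "minfo L = (\<Sum>u\<in>A. col_info s id_chan (?w u))"
    using L by (intro minfo_columns[OF stochastic_id_chan L(1,2)]) (auto simp: id_chan_sum)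
  moreover have "minfo (K i) = (\<Sum>u\<in>A. col_info s (chan (P i)) (?w u))" if i: "i \<in> F" for i
  proof (intro minfo_columns[OF stochastic_chan L(1) KA[OF i] K[OF i]])
    fix z
    have "pmf (map_pmf fst (K i)) z = (\<Sum>u\<in>A. \<Sum>x\<in>UNIV. chan (P i) z x * ?w u x)"
      unfolding pmf_map_fst_sum[OF L(1) KA[OF i]] K[OF i] ..
    also have "\<dots> = (\<Sum>x\<in>UNIV. chan (P i) z x * (\<Sum>u\<in>A. ?w u x))"
      unfolding sum_distrib_left by (rule sum.swap)
    finally show "pmf (map_pmf fst (K i)) z = (\<Sum>x\<in>UNIV. chan (P i) z x * pmf s x)" by (simp add: Ls)
  qed
  ultimately show ?thesis
    unfolding region_def using L(1) Ls by (intro exI[of _ ?vs]) (auto simp: sum simp del: map_map)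
qed

text \<open>The Markov chain Y - X - U in matrix form; \<open>chan_mult\<close> handles letters of
  probability zero along with the others.\<close>

lemma pmf_law_YU:
  fixes p :: "('y::finite \<times> 'x::finite) pmf"
  shows "pmf (law_YU p W) (y, u) = (\<Sum>x\<in>UNIV. chan p y x * pmf (law_XU (map_pmf snd p) W) (x, u))"
proof -
  have "pmf (law_YU p W) (y, u) = expect p (\<lambda>z. if fst z = y then pmf (W (snd z)) u else 0)"
    unfolding law_YU_def pmf_bind
  proof (rule expectation_cong_set)
    fix z :: "'y \<times> 'x"
    show "pmf (case z of (y, x) \<Rightarrow> map_pmf (\<lambda>u. (y, u)) (W x)) (y, u) = (if fst z = y then pmf (W (snd z)) u else 0)"
      using pmf_map_inj'[of "Pair y" "W (snd z)" u] by (cases z) (auto simp: inj_def intro!: pmf_map_outside)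
  qed
  also have "\<dots> = (\<Sum>z\<in>UNIV \<times> UNIV. (if fst z = y then pmf (W (snd z)) u else 0) * pmf p z)"
    by (intro integral_measure_pmf_real) auto
  also have "\<dots> = (\<Sum>y'\<in>UNIV. \<Sum>x\<in>UNIV. if y' = y then pmf (W x) u * pmf p (y, x) else 0)"
    unfolding sum.cartesian_product by (intro sum.cong) auto
  also have "\<dots> = (\<Sum>x\<in>UNIV. pmf (W x) u * pmf p (y, x))"
    by (subst sum.swap) simp
  also have "\<dots> = (\<Sum>x\<in>UNIV. chan p y x * pmf (law_XU (map_pmf snd p) W) (x, u))"
    unfolding law_XU_eq pmf_joint by (simp add: chan_mult[symmetric] mult_ac)
  finally show ?thesis .
qed

definition finite_kernel :: "('x \<Rightarrow> nat pmf) \<Rightarrow> bool" where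
  "finite_kernel W \<longleftrightarrow> (\<exists>A. finite A \<and> (\<forall>x. set_pmf (W x) \<subseteq> A))"

lemma region_kernel:
  fixes P :: "'i \<Rightarrow> ('y::finite \<times> 'x::finite) pmf"
  assumes W: "finite_kernel W" and P: "\<And>i. i \<in> F \<Longrightarrow> map_pmf snd (P i) = s"
  shows "region s P F 1 (minfo (law_XU s W)) (\<lambda>i. minfo (law_YU (P i) W))"
proof -
  obtain A where A: "finite A" "\<And>x u. u \<in> set_pmf (W x) \<Longrightarrow> u \<in> A"
    using W by (auto simp: finite_kernel_def)
  show ?thesis
  proof (rule region_single[OF A(1)])
    show "set_pmf (map_pmf snd (law_XU s W)) \<subseteq> A" using A(2) by (auto simp: law_XU_def)
    show "map_pmf fst (law_XU s W) = s" by (simp add: law_XU_eq map_fst_joint del: map_bind_pmf)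
    show "pmf (law_YU (P i) W) (y, u) = (\<Sum>x\<in>UNIV. chan (P i) y x * pmf (law_XU s W) (x, u))" if "i \<in> F" for i y u
      using pmf_law_YU[of "P i" W] P[OF that] by simp
    show "set_pmf (map_pmf snd (law_YU (P i) W)) \<subseteq> A" for i using A(2) by (auto simp: law_YU_def)
  qed (rule P)
qed

text \<open>Bayes' rule turns columns back into a kernel. At a letter \<open>x\<close> of
  probability zero all entries vanish, so any kernel there gives the same joint table.\<close>

lemma kernel_of_columns:
  fixes w :: "nat \<Rightarrow> 'x::finite \<Rightarrow> real" and P :: "'i \<Rightarrow> ('y::finite \<times> 'x) pmf"
  assumes w: "\<And>u x. w u x \<ge> 0" "\<And>x. (\<Sum>u<N. w u x) = pmf s x" and P: "\<And>i. i \<in> F \<Longrightarrow> map_pmf snd (P i) = s"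
  obtains W where "finite_kernel W" "minfo (law_XU s W) = (\<Sum>u<N. col_info s id_chan (w u))"
    "\<And>i. i \<in> F \<Longrightarrow> minfo (law_YU (P i) W) = (\<Sum>u<N. col_info s (chan (P i)) (w u))"
proof -
  define f where "f x u = (if u < N then w u x / pmf s x else 0)" for x u
  define W where "W x = (if pmf s x = 0 then return_pmf 0 else embed_pmf (f x))" for x
  have W: "pmf (W x) u = f x u" if "pmf s x \<noteq> 0" for x u
  proof -
    have "(\<integral>\<^sup>+ u. ennreal (f x u) \<partial>count_space UNIV) = (\<Sum>u<N. ennreal (f x u))"
      by (intro nn_integral_count_space') (auto simp: f_def)
    also have "\<dots> = ennreal (\<Sum>u<N. w u x / pmf s x)"
      using w by (subst sum_ennreal) (auto simp: f_def)
    also have "\<dots> = 1" using that w(2)[of x] by (simp flip: sum_divide_distrib)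
    finally show ?thesis
      unfolding W_def using that w by (simp add: pmf_embed_pmf f_def)
  qed
  have Npos: "N > 0"
  proof (rule ccontr)
    assume "\<not> N > 0"
    then have "pmf s x = 0" for x using w(2)[of x] by simp
    then show False using set_pmf_not_empty[of s] by (auto simp: set_pmf_iff)
  qed
  have WN: "set_pmf (W x) \<subseteq> {..<N}" for x
    using Npos W[of x] by (cases "pmf s x = 0") (auto simp: W_def set_pmf_iff f_def split: if_splits)
  have XU: "pmf (law_XU s W) (x, u) = w u x" if "u < N" for x u
  proof (cases "pmf s x = 0")
    case True
    have "w u x \<le> (\<Sum>u<N. w u x)" using w that by (intro member_le_sum) auto
    then show ?thesis using True w(1)[of u x] w(2)[of x] by (simp add: law_XU_eq pmf_joint)
  next
    case False
    then show ?thesis using W[OF False, of u] that by (simp add: law_XU_eq pmf_joint f_def)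
  qed
  have WN': "u \<in> set_pmf (W x) \<Longrightarrow> u < N" for x u using WN by blast
  have setX: "set_pmf (map_pmf snd (law_XU s W)) \<subseteq> {..<N}"
    using WN' by (auto simp: law_XU_def)
  have setY: "set_pmf (map_pmf snd (law_YU p W)) \<subseteq> {..<N}" for p :: "('y \<times> 'x) pmf" using WN' by (auto simp: law_YU_def)
  show thesis
  proof (rule that[of W])
    show "finite_kernel W" unfolding finite_kernel_def using WN by blast
    show "minfo (law_XU s W) = (\<Sum>u<N. col_info s id_chan (w u))"
    proof (rule minfo_columns[OF stochastic_id_chan _ setX])
      show "pmf (map_pmf fst (law_XU s W)) z = (\<Sum>x\<in>UNIV. id_chan z x * pmf s x)" for z
        by (simp add: id_chan_sum law_XU_eq map_fst_joint del: map_bind_pmf)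
    qed (auto simp: id_chan_sum XU)
    fix i assume i: "i \<in> F"
    show "minfo (law_YU (P i) W) = (\<Sum>u<N. col_info s (chan (P i)) (w u))"
    proof (rule minfo_columns[OF stochastic_chan _ setY])
      show "pmf (law_YU (P i) W) (z, u) = (\<Sum>x\<in>UNIV. chan (P i) z x * w u x)" if "u \<in> {..<N}" for z u
        using pmf_law_YU[of "P i" W z u] P[OF i] that by (simp add: XU)
      show "pmf (map_pmf fst (law_YU (P i) W)) z = (\<Sum>x\<in>UNIV. chan (P i) z x * pmf s x)" for z
        unfolding map_fst_law_YU P[OF i, symmetric] chan_mult
        by (rule pmf_map_fst_sum) auto
    qed auto
  qed
qed

text \<open>By homogeneity of \<open>col_info\<close>, reweighting the columns acts linearly on
  every quantity of interest, so Caratheodory's argument applies. To be preserved are one constraint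
  for each letter \<open>x\<close>, one for I(X; U) and one for each I(Y_i; U), whence the number of
  columns.\<close>

lemma region_bounded_columns:
  fixes P :: "'i \<Rightarrow> ('y::finite \<times> 'x::finite) pmf"
  assumes F: "finite F" and reg: "region s P F 1 a b"
  obtains w :: "nat \<Rightarrow> 'x \<Rightarrow> real" where "\<And>u x. w u x \<ge> 0"
    "\<And>x. (\<Sum>u<CARD('x) + card F + 1. w u x) = pmf s x"
    "(\<Sum>u<CARD('x) + card F + 1. col_info s id_chan (w u)) \<le> a"
    "\<And>i. i \<in> F \<Longrightarrow> (\<Sum>u<CARD('x) + card F + 1. col_info s (chan (P i)) (w u)) \<ge> b i"
proof -
  let ?N = "CARD('x) + card F + 1"
  obtain vs where vs: "\<forall>v\<in>set vs. \<forall>x. v x \<ge> 0" "\<forall>x. (\<Sum>v\<leftarrow>vs. v x) = 1 * pmf s x"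
    "(\<Sum>v\<leftarrow>vs. col_info s id_chan v) \<le> a" "\<forall>i\<in>F. (\<Sum>v\<leftarrow>vs. col_info s (chan (P i)) v) \<ge> b i"
    using reg unfolding region_def by blast
  define A where "A = {..<length vs}"
  define v where "v u = vs ! u" for u
  have sum: "(\<Sum>v\<leftarrow>vs. f v) = (\<Sum>u\<in>A. f (v u))" for f :: "_ \<Rightarrow> real"
    by (simp add: sum_list_sum_nth A_def v_def atLeast0LessThan)
  have v0: "v u x \<ge> 0" if "u \<in> A" for u x using vs(1) that by (auto simp: A_def v_def)
  define C :: "('x + 'i option) set" where "C = range Inl \<union> Inr ` insert None (Some ` F)"
  have finC: "finite C" using F by (simp add: C_def)
  have cardC: "card C = ?N"
  proof -
    have "card (Inr ` insert None (Some ` F) :: ('x + 'i option) set) = card (insert None (Some ` F))"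
      by (intro card_image inj_onI) simp
    also have "\<dots> = Suc (card F)"
      using F by (subst card_insert_disjoint) (auto simp: card_image)
    finally show ?thesis
      unfolding C_def using F by (subst card_Un_disjoint) (auto simp: card_image image_image simp del: image_insert)
  qed
  define q where "q c u = (case c of Inl x \<Rightarrow> v u x | Inr None \<Rightarrow> col_info s id_chan (v u)
    | Inr (Some i) \<Rightarrow> col_info s (chan (P i)) (v u))" for c u
  obtain l :: "nat \<Rightarrow> real" where l: "\<And>u. l u \<ge> 0" "card {u \<in> A. l u \<noteq> 0} \<le> ?N"
    "\<And>c. c \<in> C \<Longrightarrow> (\<Sum>u\<in>A. l u * q c u) = (\<Sum>u\<in>A. q c u)"
    using caratheodory_weights[OF finC, of A q] cardC by (auto simp: A_def)
  let ?S = "{u \<in> A. l u \<noteq> 0}"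
  have finS: "finite ?S" by (simp add: A_def)
  obtain h where h: "bij_betw h {..<card ?S} ?S"
    using ex_bij_betw_nat_finite[OF finS] by (auto simp: atLeast0LessThan)
  define w where "w u = (if u < card ?S then (\<lambda>x. l (h u) * v (h u) x) else (\<lambda>_. 0))" for u
  have hA: "h u \<in> A" if "u < card ?S" for u using h that by (auto simp: bij_betw_def)
  have sumw: "(\<Sum>u<?N. g (w u)) = (\<Sum>u\<in>A. l u * g (v u))"
    if g: "g (\<lambda>_. 0) = 0" "\<And>u. u \<in> A \<Longrightarrow> g (\<lambda>x. l u * v u x) = l u * g (v u)" for g :: "_ \<Rightarrow> real"
  proof -
    have "(\<Sum>u<?N. g (w u)) = (\<Sum>u<card ?S. g (w u))"
      using l(2) g(1) by (intro sum.mono_neutral_right) (auto simp: w_def)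
    also have "\<dots> = (\<Sum>u<card ?S. l (h u) * g (v (h u)))"
      using g(2) hA by (intro sum.cong) (auto simp: w_def)
    also have "\<dots> = (\<Sum>u\<in>?S. l u * g (v u))"
      using sum.reindex_bij_betw[OF h, of "\<lambda>u. l u * g (v u)"] by simp
    also have "\<dots> = (\<Sum>u\<in>A. l u * g (v u))"
      by (intro sum.mono_neutral_left) (auto simp: A_def)
    finally show ?thesis .
  qed
  have zero: "col_info s V (\<lambda>_. 0) = 0" for V :: "'y \<Rightarrow> 'x \<Rightarrow> real"
    by (simp add: col_info_def xlnx_def)
  have zero': "col_info s V (\<lambda>_. 0) = 0" for V :: "'x \<Rightarrow> 'x \<Rightarrow> real"
    by (simp add: col_info_def xlnx_def)
  have sumc: "(\<Sum>u<?N. col_info s (chan (P i)) (w u)) = (\<Sum>u\<in>A. l u * col_info s (chan (P i)) (v u))" for i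
    by (rule sumw) (use l v0 in \<open>auto simp: zero col_info_scale[OF stochastic_chan]\<close>)
  have sumid: "(\<Sum>u<?N. col_info s id_chan (w u)) = (\<Sum>u\<in>A. l u * col_info s id_chan (v u))"
    by (rule sumw) (use l v0 in \<open>auto simp: zero' col_info_scale[OF stochastic_id_chan]\<close>)
  show thesis
  proof (rule that[of w])
    show "w u x \<ge> 0" for u x using l(1) v0 hA by (auto simp: w_def)
    show "(\<Sum>u<?N. w u x) = pmf s x" for x
    proof -
      have "(\<Sum>u<?N. w u x) = (\<Sum>u\<in>A. l u * v u x)" by (rule sumw) auto
      also have "\<dots> = (\<Sum>u\<in>A. v u x)" using l(3)[of "Inl x"] by (simp add: q_def C_def)
      finally show ?thesis using vs(2) sum[of "\<lambda>v. v x"] by simp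
    qed
    show "(\<Sum>u<?N. col_info s id_chan (w u)) \<le> a"
      using sumid l(3)[of "Inr None"] vs(3) sum[of "col_info s id_chan"]
      by (simp add: q_def C_def)
    show "(\<Sum>u<?N. col_info s (chan (P i)) (w u)) \<ge> b i" if "i \<in> F" for i
      using sumc[of i] l(3)[of "Inr (Some i)"] vs(4)[rule_format, OF that] sum[of "col_info s (chan (P i))"] that
      by (simp add: q_def C_def)
  qed
qed

text \<open>With the number of columns bounded, the tables range over a compact set: nearly optimal
  tables have a convergent subsequence, \<open>col_info\<close> is continuous along it, and the
  slack \<open>e\<close> disappears in the limit.\<close>

lemma region_closed:
  fixes P :: "'i \<Rightarrow> ('y::finite \<times> 'x::finite) pmf"
  assumes F: "finite F" and P: "\<And>i. i \<in> F \<Longrightarrow> map_pmf snd (P i) = s"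
    and reg: "\<And>e. e > 0 \<Longrightarrow> region s P F 1 (a + e) (\<lambda>i. b i - e)"
  obtains W where "finite_kernel W" "minfo (law_XU s W) \<le> a" "\<And>i. i \<in> F \<Longrightarrow> b i \<le> minfo (law_YU (P i) W)"
proof -
  let ?N = "CARD('x) + card F + 1"
  define e where "e k = 1 / real (Suc k)" for k
  have "\<exists>w. (\<forall>u x. w u x \<ge> 0) \<and> (\<forall>x. (\<Sum>u<?N. w u x) = pmf s x) \<and>
    (\<Sum>u<?N. col_info s id_chan (w u)) \<le> a + e k \<and> (\<forall>i\<in>F. (\<Sum>u<?N. col_info s (chan (P i)) (w u)) \<ge> b i - e k)" for k
  proof -
    have "e k > 0" by (simp add: e_def)
    from region_bounded_columns[OF F reg[OF this]] show ?thesis by metis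
  qed
  then obtain w where w: "\<And>k u x. w k u x \<ge> 0" "\<And>k x. (\<Sum>u<?N. w k u x) = pmf s x"
    "\<And>k. (\<Sum>u<?N. col_info s id_chan (w k u)) \<le> a + e k"
    "\<And>k i. i \<in> F \<Longrightarrow> (\<Sum>u<?N. col_info s (chan (P i)) (w k u)) \<ge> b i - e k"
    by metis
  have bd: "w k u x \<in> {0..1}" if "u < ?N" for k u x
  proof -
    have "w k u x \<le> (\<Sum>u<?N. w k u x)" using w that by (intro member_le_sum) auto
    then show ?thesis using w pmf_le_1[of s x] by auto
  qed
  obtain q g where q: "strict_mono (q :: nat \<Rightarrow> nat)"
    "\<And>j. j \<in> {..<?N} \<times> UNIV \<Longrightarrow> (\<lambda>k. w (q k) (fst j) (snd j)) \<longlonglongrightarrow> g j"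
    by (rule finite_family_subsequence[of "{..<?N} \<times> (UNIV :: 'x set)" "\<lambda>j k. w k (fst j) (snd j)" 0 1])
      (use bd in auto)
  define w' where "w' u x = (if u < ?N then g (u, x) else 0)" for u x
  have lim: "(\<lambda>k. w (q k) u x) \<longlonglongrightarrow> w' u x" if "u < ?N" for u x
    using q(2)[of "(u, x)"] that by (simp add: w'_def)
  have "w' u x \<ge> 0" for u x
  proof (cases "u < ?N")
    case True
    show ?thesis by (rule LIMSEQ_le_const[OF lim[OF True]]) (use w in auto)
  qed (simp add: w'_def)
  moreover have "(\<Sum>u<?N. w' u x) = pmf s x" for x
  proof -
    have "(\<lambda>k. \<Sum>u<?N. w (q k) u x) \<longlonglongrightarrow> (\<Sum>u<?N. w' u x)" using lim by (intro tendsto_sum) auto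
    then show ?thesis using w(2) by (simp add: LIMSEQ_const_iff)
  qed
  ultimately obtain W where W: "finite_kernel W" "minfo (law_XU s W) = (\<Sum>u<?N. col_info s id_chan (w' u))"
    "\<And>i. i \<in> F \<Longrightarrow> minfo (law_YU (P i) W) = (\<Sum>u<?N. col_info s (chan (P i)) (w' u))"
    using kernel_of_columns[of w' ?N s F P] P by blast
  have limc: "(\<lambda>k. \<Sum>u<?N. col_info s (chan (P i)) (w (q k) u)) \<longlonglongrightarrow> (\<Sum>u<?N. col_info s (chan (P i)) (w' u))" for i
    using lim w by (intro tendsto_sum col_info_tendsto stochastic_chan) auto
  have limid: "(\<lambda>k. \<Sum>u<?N. col_info s id_chan (w (q k) u)) \<longlonglongrightarrow> (\<Sum>u<?N. col_info s id_chan (w' u))"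
    using lim w by (intro tendsto_sum col_info_tendsto stochastic_id_chan) auto
  have e0: "(\<lambda>k. e (q k)) \<longlonglongrightarrow> 0"
    using LIMSEQ_subseq_LIMSEQ[OF LIMSEQ_inverse_real_of_nat q(1)] by (simp add: e_def comp_def inverse_eq_divide)
  show thesis
  proof (rule that[OF W(1)])
    have "(\<Sum>u<?N. col_info s id_chan (w' u)) \<le> a + 0"
      by (rule LIMSEQ_le[OF limid tendsto_add[OF tendsto_const e0]]) (use w(3) in auto)
    then show "minfo (law_XU s W) \<le> a" by (simp add: W(2))
    fix i assume i: "i \<in> F"
    have "b i - 0 \<le> (\<Sum>u<?N. col_info s (chan (P i)) (w' u))"
      by (rule LIMSEQ_le[OF tendsto_diff[OF tendsto_const e0] limc]) (use w(4) i in auto)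
    then show "b i \<le> minfo (law_YU (P i) W)" by (simp add: W(3)[OF i])
  qed
qed

section \<open>Converse\<close>

lemma pair_pmf_finite_expectation:
  fixes h :: "'a \<times> 'b \<Rightarrow> real"
  assumes "finite (set_pmf p)" "finite (set_pmf q)"
  shows "expect (pair_pmf p q) h
       = expect p (\<lambda>x. expect q (\<lambda>y. h (x, y)))"
  using assms by (simp add: pair_pmf_def expectation_bind_finite)

text \<open>
  \<open>I(Y, B; M) \<le> I(Y; M) + I(B; M, X)\<close> when \<open>(Y, X)\<close> is independent of \<open>(B, A)\<close> and \<open>M = g X A\<close>:
  given \<open>X\<close>, the letter \<open>Y\<close> tells nothing more about \<open>(B, M)\<close>. The map \<open>c\<close> merely encodes
  the pair \<open>(Y, B)\<close>.
\<close>

lemma minfo_chain: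
  fixes p :: "('y::finite \<times> 'x::finite) pmf" and R :: "('b \<times> 'a) pmf" and g :: "'x \<Rightarrow> 'a \<Rightarrow> nat"
    and c :: "'y \<times> 'b \<Rightarrow> 'd"
  assumes fin: "finite (set_pmf R)" and inj: "inj c"
  shows "minfo (map_pmf (\<lambda>(z, w). (c (fst z, fst w), g (snd z) (snd w))) (pair_pmf p R))
    \<le> minfo (map_pmf (\<lambda>(z, w). (fst z, g (snd z) (snd w))) (pair_pmf p R))
      + expect p (\<lambda>z. minfo (map_pmf (\<lambda>w. (fst w, g (snd z) (snd w))) R))"
proof -
  let ?E = expect and ?B = "pair_pmf p R"
  define J where "J = map_pmf (\<lambda>(z, w). (c (fst z, fst w), g (snd z) (snd w))) ?B"
  define L where "L = map_pmf (\<lambda>(z, w). (fst z, g (snd z) (snd w))) ?B"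
  define K where "K x = map_pmf (\<lambda>w. (fst w, g x (snd w))) R" for x
  have finp: "finite (set_pmf p)" by simp
  have finB: "finite (set_pmf ?B)" using fin by simp
  have sndJ: "map_pmf snd J = map_pmf snd L"
    by (simp add: J_def L_def map_pmf_comp case_prod_unfold)
  have "map_pmf fst J = map_pmf c (pair_pmf (map_pmf fst p) (map_pmf fst R))"
    unfolding J_def map_pair[symmetric] by (simp add: map_pmf_comp case_prod_unfold)
  then have fstJ: "pmf (map_pmf fst J) (c (y, b)) = pmf (map_pmf fst p) y * pmf (map_pmf fst R) b" for y b
    using pmf_map_inj'[OF inj, of _ "(y, b)"] by (simp add: pmf_pair)
  have fstL: "map_pmf fst L = map_pmf fst p"
  proof -
    have "map_pmf fst L = map_pmf fst (map_pmf fst ?B)" by (simp add: L_def map_pmf_comp case_prod_unfold)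
    then show ?thesis by (simp add: map_fst_pair_pmf)
  qed
  have fstK: "map_pmf fst (K x) = map_pmf fst R" for x by (simp add: K_def map_pmf_comp)
  let ?m = "\<lambda>z w. g (snd z) (snd w)"
  have minfoJ: "minfo J = ?E ?B (\<lambda>(z, w). info_density J (c (fst z, fst w), ?m z w))"
    unfolding minfo_def by (subst (1) J_def) (simp add: case_prod_unfold)
  have minfoL: "minfo L = ?E ?B (\<lambda>(z, w). info_density L (fst z, ?m z w))"
    unfolding minfo_def by (subst (1) L_def) (simp add: case_prod_unfold)
  have minfoK: "?E p (\<lambda>z. minfo (K (snd z))) = ?E ?B (\<lambda>(z, w). info_density (K (snd z)) (fst w, ?m z w))"
    unfolding minfo_def pair_pmf_finite_expectation[OF finp fin] by (subst (1) K_def) (simp add: case_prod_unfold)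
  \<comment> \<open>\<open>r\<close> divides the conditional probability of \<open>b\<close> given
    \<open>(y, m)\<close> by the one given \<open>(x, m)\<close>, where \<open>b\<close> is
    \<open>fst w\<close> and \<open>m\<close> the message. The latter is the true one even when
    \<open>y\<close> is known too, so \<open>r\<close> has mean at most one, and its expected
    logarithm is the nonpositive gap in the chain rule.\<close>
  define r where "r z w = pmf J (c (fst z, fst w), ?m z w) * pmf (map_pmf snd (K (snd z))) (?m z w)
      / (pmf L (fst z, ?m z w) * pmf (K (snd z)) (fst w, ?m z w))" for z w
  have pos: "pmf J (c (fst z, fst w), ?m z w) > 0" "pmf (map_pmf snd (K (snd z))) (?m z w) > 0"
    "pmf L (fst z, ?m z w) > 0" "pmf (K (snd z)) (fst w, ?m z w) > 0"
    "pmf (map_pmf fst p) (fst z) > 0" "pmf (map_pmf fst R) (fst w) > 0" "pmf (map_pmf snd L) (?m z w) > 0"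
    if "(z, w) \<in> set_pmf ?B" for z w
    using that by (force simp: pmf_positive_iff J_def L_def K_def)+
  have dens: "info_density J (c (fst z, fst w), ?m z w)
      = info_density L (fst z, ?m z w) + info_density (K (snd z)) (fst w, ?m z w) + ln (r z w)"
    if "(z, w) \<in> set_pmf ?B" for z w
    unfolding info_density_def fst_conv snd_conv fstJ sndJ fstL fstK r_def
    using pos[OF that] by (simp add: ln_div ln_mult_pos)
  have r_le: "?E ?B (\<lambda>(z, w). r z w) \<le> 1"
  proof -
    define Sb where "Sb = fst ` set_pmf R"
    define Sm where "Sm = (\<Union>x. g x ` snd ` set_pmf R)"
    have fS: "finite Sb" "finite Sm" using fin by (auto simp: Sb_def Sm_def)
    have K0: "set_pmf (K x) \<subseteq> Sb \<times> Sm" for x by (auto simp: K_def Sb_def Sm_def)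
    \<comment> \<open>Averaging over \<open>x\<close> recovers the law of \<open>(y, m)\<close>;
      this sum cancels the remaining denominator of \<open>r\<close> below.\<close>
    have L: "pmf L (y, u) = (\<Sum>x\<in>UNIV. pmf p (y, x) * pmf (map_pmf snd (K x)) u)" for y u
    proof -
      have "L = bind_pmf p (\<lambda>z. map_pmf (\<lambda>v. (fst z, v)) (map_pmf snd (K (snd z))))"
        unfolding L_def K_def pair_pmf_def
        by (simp add: map_bind_pmf map_pmf_comp flip: map_pmf_def)
      also have "\<dots> = bind_pmf p (\<lambda>(y, x). map_pmf (\<lambda>v. (y, v)) (map_pmf snd (K x)))"
        by (intro bind_pmf_cong) auto
      also have "\<dots> = law_YU p (\<lambda>x. map_pmf snd (K x))" by (simp add: law_YU_def)
      finally have L_eq: "L = law_YU p (\<lambda>x. map_pmf snd (K x))" .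
      show ?thesis
        unfolding L_eq pmf_law_YU law_XU_eq pmf_joint by (simp add: mult.assoc[symmetric] chan_mult)
    qed
    have "?E ?B (\<lambda>(z, w). r z w) = ?E p (\<lambda>z. ?E R (\<lambda>w. r z w))"
      using pair_pmf_finite_expectation[OF finp fin, of "\<lambda>(z, w). r z w"] by simp
    also have "\<dots> \<le> ?E p (\<lambda>z. \<Sum>(b, u)\<in>Sb \<times> Sm. pmf J (c (fst z, b), u) * pmf (map_pmf snd (K (snd z))) u / pmf L (fst z, u))"
    proof (intro expectation_mono_set finp)
      fix z
      have "?E R (\<lambda>w. r z w) = ?E (K (snd z)) (\<lambda>(b, u). pmf J (c (fst z, b), u) * pmf (map_pmf snd (K (snd z))) u / (pmf L (fst z, u) * pmf (K (snd z)) (b, u)))"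
        by (subst (1) K_def) (simp add: r_def[abs_def] case_prod_unfold)
      also have "\<dots> = (\<Sum>(b, u)\<in>Sb \<times> Sm. pmf J (c (fst z, b), u) * pmf (map_pmf snd (K (snd z))) u / (pmf L (fst z, u) * pmf (K (snd z)) (b, u)) * pmf (K (snd z)) (b, u))"
        using fS K0[of "snd z"] by (subst integral_measure_pmf_real[where A = "Sb \<times> Sm"]) (auto simp: case_prod_unfold)
      also have "\<dots> \<le> (\<Sum>(b, u)\<in>Sb \<times> Sm. pmf J (c (fst z, b), u) * pmf (map_pmf snd (K (snd z))) u / pmf L (fst z, u))"
      proof (rule sum_mono, clarify)
        fix b u
        show "pmf J (c (fst z, b), u) * pmf (map_pmf snd (K (snd z))) u / (pmf L (fst z, u) * pmf (K (snd z)) (b, u)) * pmf (K (snd z)) (b, u)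
          \<le> pmf J (c (fst z, b), u) * pmf (map_pmf snd (K (snd z))) u / pmf L (fst z, u)"
          by (cases "pmf (K (snd z)) (b, u) = 0") auto
      qed
      finally show "?E R (\<lambda>w. r z w) \<le> \<dots>" .
    qed
    also have "\<dots> = (\<Sum>(b, u)\<in>Sb \<times> Sm. ?E p (\<lambda>z. pmf J (c (fst z, b), u) * pmf (map_pmf snd (K (snd z))) u / pmf L (fst z, u)))"
      using finp by (simp add: case_prod_unfold expectation_sum_finite)
    also have "\<dots> \<le> (\<Sum>(b, u)\<in>Sb \<times> Sm. \<Sum>y\<in>UNIV. pmf J (c (y, b), u))"
    proof (rule sum_mono, clarify)
      fix b u
      let ?h = "\<lambda>y. pmf J (c (y, b), u) / pmf L (y, u)"
      have "?E p (\<lambda>z. pmf J (c (fst z, b), u) * pmf (map_pmf snd (K (snd z))) u / pmf L (fst z, u))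
          = (\<Sum>(y, x)\<in>UNIV \<times> UNIV. ?h y * (pmf p (y, x) * pmf (map_pmf snd (K x)) u))"
        by (subst integral_measure_pmf_real[where A = "UNIV \<times> UNIV"]) (auto simp: case_prod_unfold mult_ac)
      also have "\<dots> = (\<Sum>y\<in>UNIV. \<Sum>x\<in>UNIV. ?h y * (pmf p (y, x) * pmf (map_pmf snd (K x)) u))"
        by (simp only: sum.cartesian_product)
      also have "\<dots> = (\<Sum>y\<in>UNIV. ?h y * pmf L (y, u))"
        by (simp only: L sum_distrib_left[symmetric])
      also have "\<dots> \<le> (\<Sum>y\<in>UNIV. pmf J (c (y, b), u))"
      proof (rule sum_mono)
        fix y show "?h y * pmf L (y, u) \<le> pmf J (c (y, b), u)" by (cases "pmf L (y, u) = 0") auto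
      qed
      finally show "?E p (\<lambda>z. pmf J (c (fst z, b), u) * pmf (map_pmf snd (K (snd z))) u / pmf L (fst z, u)) \<le> \<dots>" .
    qed
    also have "\<dots> = (\<Sum>(q, y)\<in>(Sb \<times> Sm) \<times> UNIV. pmf J (c (y, fst q), snd q))"
      by (subst sum.cartesian_product[symmetric]) (simp add: case_prod_unfold)
    also have "\<dots> = (\<Sum>j\<in>(\<lambda>(q, y). (c (y, fst q), snd q)) ` ((Sb \<times> Sm) \<times> UNIV). pmf J j)"
      using inj by (subst sum.reindex) (auto simp: inj_on_def case_prod_unfold dest: injD)
    also have "\<dots> = Pr J ((\<lambda>(q, y). (c (y, fst q), snd q)) ` ((Sb \<times> Sm) \<times> UNIV))"
      using fS by (subst measure_measure_pmf_finite) auto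
    also have "\<dots> \<le> 1" by simp
    finally show ?thesis .
  qed
  have "minfo J = ?E ?B (\<lambda>(z, w). info_density L (fst z, ?m z w)) + ?E ?B (\<lambda>(z, w). info_density (K (snd z)) (fst w, ?m z w))
      + ?E ?B (\<lambda>q. ln (case q of (z, w) \<Rightarrow> r z w))"
    unfolding minfoJ expectation_add_finite[OF finB, symmetric]
    using dens by (intro expectation_cong_set) auto
  also have "?E ?B (\<lambda>q. ln (case q of (z, w) \<Rightarrow> r z w)) \<le> 0"
    using finB r_le pos by (intro expectation_ln_le_0) (auto simp: r_def)
  finally show ?thesis
    by (simp add: minfoL minfoK J_def[symmetric] L_def[symmetric] K_def[symmetric])
qed

section \<open>Entropy of the message and its letterwise decomposition\<close>

definition entropy_of :: "'a pmf \<Rightarrow> ('a \<Rightarrow> 'm) \<Rightarrow> real" where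
  "entropy_of p f = expect p (\<lambda>x. - ln (pmf (map_pmf f p) (f x)))"

text \<open>The gap is the relative entropy of the message with respect to the uniform law on
  \<open>M\<close>.\<close>

lemma entropy_of_le_ln_card:
  assumes fin: "finite (set_pmf p)" and M: "finite M" "\<And>x. x \<in> set_pmf p \<Longrightarrow> f x \<in> M"
  shows "entropy_of p f \<le> ln (real (card M))"
proof -
  have "set_pmf p \<noteq> {}" by (rule set_pmf_not_empty)
  then have c: "card M > 0" using M by (auto simp: card_gt_0_iff)
  let ?q = "map_pmf f p"
  have q: "pmf ?q (f x) > 0" if "x \<in> set_pmf p" for x using that by (auto simp: pmf_positive_iff)
  have "expect p (\<lambda>x. ln (1 / (pmf ?q (f x) * real (card M)))) \<le> 0"
  proof (rule expectation_ln_le_0[OF fin])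
    have "expect p (\<lambda>x. 1 / (pmf ?q (f x) * real (card M)))
        = expect ?q (\<lambda>u. 1 / (pmf ?q u * real (card M)))" by simp
    also have "\<dots> = (\<Sum>u\<in>M. 1 / (pmf ?q u * real (card M)) * pmf ?q u)"
      using M by (intro integral_measure_pmf_real) auto
    also have "\<dots> \<le> (\<Sum>u\<in>M. 1 / real (card M))"
    proof (rule sum_mono)
      fix u show "1 / (pmf ?q u * real (card M)) * pmf ?q u \<le> 1 / real (card M)"
        by (cases "pmf ?q u = 0") auto
    qed
    finally show "expect p (\<lambda>x. 1 / (pmf ?q (f x) * real (card M))) \<le> 1" using c by simp
  next
    fix x assume "x \<in> set_pmf p"
    from q[OF this] show "0 < 1 / (pmf ?q (f x) * real (card M))" using c by simp
  qed
  also have "expect p (\<lambda>x. ln (1 / (pmf ?q (f x) * real (card M))))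
      = expect p (\<lambda>x. - ln (pmf ?q (f x)) - ln (real (card M)))"
  proof (rule expectation_cong_set)
    fix x assume "x \<in> set_pmf p"
    from q[OF this] show "ln (1 / (pmf ?q (f x) * real (card M))) = - ln (pmf ?q (f x)) - ln (real (card M))"
      using c by (simp add: ln_div ln_mult_pos)
  qed
  finally show ?thesis using fin by (simp add: expectation_diff_finite entropy_of_def)
qed

lemma iid_pairs_Suc:
  "iid_pairs (Suc n) p = map_pmf (\<lambda>(z, w). (fst z # fst w, snd z # snd w)) (pair_pmf p (iid_pairs n p))"
  by (simp add: iid_pairs_def replicate_pmf.simps pair_pmf_def map_bind_pmf map_pmf_def bind_assoc_pmf bind_return_pmf)

text \<open>Induction on the block length, for all encoders at once: with the first letter frozen,
  \<open>?f x\<close> is an encoder for one letter less. The entropy obeys H(M) = I(X_1; M) + H(M |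
  X_1) exactly, the mutual informations obey an inequality in the right direction, and the
  first-letter terms of both come from the same kernel \<open>W\<close>.\<close>

lemma region_encoder:
  fixes P :: "'i \<Rightarrow> ('y::finite \<times> 'x::finite) pmf"
  assumes P: "\<And>i. i \<in> F \<Longrightarrow> map_pmf snd (P i) = s"
  shows "region s P F (real n) (entropy_of (replicate_pmf n s) f) (\<lambda>i. minfo (compressed f (iid_pairs n (P i))))"
proof (induction n arbitrary: f)
  case 0
  have "minfo (compressed f (iid_pairs 0 (P i))) = 0" for i
    by (simp add: minfo_def compressed_def iid_pairs_def info_density_def)
  moreover have "entropy_of (replicate_pmf 0 s) f = 0" by (simp add: entropy_of_def)
  ultimately show ?case using region_zero[of s P F] by simp
next
  case (Suc n)
  let ?E = expect and ?sn = "replicate_pmf n s"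
  let ?f = "\<lambda>x xs. f (x # xs)"
  \<comment> \<open>The kernel from the first letter to the message; the remaining letters serve as
    its randomness.\<close>
  define W where "W x = map_pmf (?f x) ?sn" for x
  have W: "finite_kernel W"
    unfolding finite_kernel_def by (intro exI[of _ "\<Union>x. set_pmf (W x)"]) (auto simp: W_def)
  have s1: "(\<Sum>x\<in>UNIV. pmf s x) = 1" by (rule sum_pmf_eq_1) auto
  have Es: "(\<Sum>x\<in>UNIV. pmf s x * h x) = ?E s h" for h :: "'x \<Rightarrow> real"
    by (subst integral_measure_pmf_real[where A = UNIV]) (auto simp: mult.commute)
  \<comment> \<open>One use of the induction hypothesis for each value of the first letter, averaged
    with weights \<open>pmf s x\<close>.\<close>
  have "region s P F (\<Sum>x\<in>UNIV. pmf s x * real n) (\<Sum>x\<in>UNIV. pmf s x * entropy_of ?sn (?f x))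
      (\<lambda>i. \<Sum>x\<in>UNIV. pmf s x * minfo (compressed (?f x) (iid_pairs n (P i))))"
    by (intro region_sum region_scale Suc.IH) auto
  then have reg: "region s P F (1 + real n) (minfo (law_XU s W) + ?E s (\<lambda>x. entropy_of ?sn (?f x)))
      (\<lambda>i. minfo (law_YU (P i) W) + ?E s (\<lambda>x. minfo (compressed (?f x) (iid_pairs n (P i)))))"
    using region_add[OF region_kernel[OF W P]] by (simp add: Es s1 flip: sum_distrib_right)
  have joint: "law_XU s W = map_pmf (\<lambda>(x, xs). (x, ?f x xs)) (pair_pmf s ?sn)"
    by (simp add: law_XU_eq W_def pair_pmf_def map_bind_pmf map_pmf_comp flip: map_pmf_def)
  have law: "map_pmf f (replicate_pmf (Suc n) s) = map_pmf snd (law_XU s W)"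
    unfolding joint by (simp add: replicate_pmf_Suc_map map_pmf_comp case_prod_unfold)
  have fst: "map_pmf fst (law_XU s W) = s" by (simp add: law_XU_eq map_fst_joint del: map_bind_pmf)
  have "entropy_of (replicate_pmf (Suc n) s) f = minfo (law_XU s W) + ?E s (\<lambda>x. entropy_of ?sn (?f x))"
  proof -
    let ?q = "pmf (map_pmf snd (law_XU s W))"
    have "entropy_of (replicate_pmf (Suc n) s) f = ?E s (\<lambda>x. ?E ?sn (\<lambda>xs. - ln (?q (?f x xs))))"
      unfolding entropy_of_def law by (simp add: replicate_pmf_Suc_map pair_pmf_finite_expectation case_prod_unfold)
    moreover have "minfo (law_XU s W) = ?E s (\<lambda>x. ?E ?sn (\<lambda>xs. info_density (law_XU s W) (x, ?f x xs)))"
      unfolding minfo_def by (subst (1) joint) (simp add: pair_pmf_finite_expectation case_prod_unfold)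
    moreover have "?E s (\<lambda>x. ?E ?sn (\<lambda>xs. info_density (law_XU s W) (x, ?f x xs)))
      = ?E s (\<lambda>x. ?E ?sn (\<lambda>xs. - ln (?q (?f x xs)) - - ln (pmf (W x) (?f x xs))))"
    proof (intro expectation_cong_set)
      fix x xs assume x: "x \<in> set_pmf s" and xs: "xs \<in> set_pmf ?sn"
      have W0: "pmf (W x) (?f x xs) > 0" using xs by (auto simp: W_def pmf_positive_iff)
      have "(x, ?f x xs) \<in> set_pmf (law_XU s W)" unfolding joint using x xs by auto
      from pmf_marginal_pos(2)[OF this] have q0: "?q (?f x xs) > 0" by simp
      have "info_density (law_XU s W) (x, ?f x xs) = ln (pmf (W x) (?f x xs) / ?q (?f x xs))"
        unfolding info_density_def fst_conv snd_conv fst using x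
        by (simp add: law_XU_eq pmf_joint set_pmf_iff del: map_bind_pmf)
      then show "info_density (law_XU s W) (x, ?f x xs) = - ln (?q (?f x xs)) - - ln (pmf (W x) (?f x xs))"
        using W0 q0 by (simp add: ln_div)
    qed
    ultimately show ?thesis by (simp add: expectation_diff_finite entropy_of_def W_def)
  qed
  moreover have "minfo (compressed f (iid_pairs (Suc n) (P i)))
      \<le> minfo (law_YU (P i) W) + ?E s (\<lambda>x. minfo (compressed (?f x) (iid_pairs n (P i))))" if i: "i \<in> F" for i
  proof -
    let ?R = "iid_pairs n (P i)" and ?c = "\<lambda>(y, ys). y # ys"
    have fR: "finite (set_pmf ?R)" by (simp add: iid_pairs_def)
    have inj: "inj (\<lambda>(y :: 'y, ys). y # ys)" by (auto simp: inj_def)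
    have 1: "compressed f (iid_pairs (Suc n) (P i)) = map_pmf (\<lambda>(z, w). (?c (fst z, fst w), ?f (snd z) (snd w))) (pair_pmf (P i) ?R)"
      by (simp add: compressed_def iid_pairs_Suc map_pmf_comp case_prod_unfold)
    have sn: "?sn = map_pmf snd ?R" using P[OF i] by (simp add: iid_pairs_snd)
    have 2: "law_YU (P i) W = map_pmf (\<lambda>(z, w). (fst z, ?f (snd z) (snd w))) (pair_pmf (P i) ?R)"
    proof -
      have "law_YU (P i) W = bind_pmf (P i) (\<lambda>z. map_pmf (\<lambda>w. (fst z, ?f (snd z) (snd w))) ?R)"
        unfolding law_YU_def W_def sn map_pmf_comp by (intro bind_pmf_cong) auto
      then show ?thesis by (simp add: pair_pmf_def map_bind_pmf map_pmf_comp flip: map_pmf_def)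
    qed
    have 3: "compressed (?f x) ?R = map_pmf (\<lambda>w. (fst w, ?f x (snd w))) ?R" for x
      by (simp add: compressed_def case_prod_unfold)
    have 4: "?E s h = ?E (P i) (\<lambda>z. h (snd z))" for h :: "'x \<Rightarrow> real"
      unfolding P[OF i, symmetric] by simp
    show ?thesis
      unfolding 1 2 3 4 by (rule minfo_chain[OF fR inj])
  qed
  ultimately show ?case using region_mono[OF reg] by simp
qed

section \<open>From error probabilities to mutual information\<close>

lemma kl_map_le:
  assumes fin: "finite (set_pmf p)" and sub: "set_pmf p \<subseteq> set_pmf q"
  shows "kl (map_pmf f p) (map_pmf f q) \<le> kl p q"
proof -
  let ?p = "map_pmf f p" and ?q = "map_pmf f q"
  let ?r = "\<lambda>x. pmf q x * pmf ?p (f x) / (pmf p x * pmf ?q (f x))"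
  have pos: "pmf p x > 0" "pmf q x > 0" "pmf ?p (f x) > 0" "pmf ?q (f x) > 0" if "x \<in> set_pmf p" for x
    using that sub by (auto simp: pmf_positive_iff)
  have "expect p ?r \<le> 1"
  proof -
    have "expect p ?r = (\<Sum>x\<in>set_pmf p. ?r x * pmf p x)"
      using fin by (intro integral_measure_pmf_real) auto
    also have "\<dots> = (\<Sum>x\<in>set_pmf p. pmf q x * (pmf ?p (f x) / pmf ?q (f x)))"
    proof (rule sum.cong)
      fix x assume "x \<in> set_pmf p"
      from pos[OF this] show "?r x * pmf p x = pmf q x * (pmf ?p (f x) / pmf ?q (f x))" by simp
    qed simp
    also have "\<dots> = (\<Sum>u\<in>f ` set_pmf p. \<Sum>x\<in>{x \<in> set_pmf p. f x = u}. pmf q x * (pmf ?p (f x) / pmf ?q (f x)))"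
      using sum.image_gen[OF fin] by blast
    also have "\<dots> = (\<Sum>u\<in>f ` set_pmf p. (\<Sum>x\<in>{x \<in> set_pmf p. f x = u}. pmf q x) * (pmf ?p u / pmf ?q u))"
      unfolding sum_distrib_right by (intro sum.cong) auto
    also have "\<dots> \<le> (\<Sum>u\<in>f ` set_pmf p. pmf ?q u * (pmf ?p u / pmf ?q u))"
    proof (intro sum_mono mult_right_mono)
      fix u
      have "(\<Sum>x\<in>{x \<in> set_pmf p. f x = u}. pmf q x) = Pr q {x \<in> set_pmf p. f x = u}"
        using fin by (subst measure_measure_pmf_finite) auto
      also have "\<dots> \<le> pmf ?q u" unfolding pmf_map by (intro prob_mono_set) auto
      finally show "(\<Sum>x\<in>{x \<in> set_pmf p. f x = u}. pmf q x) \<le> pmf ?q u" .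
    qed auto
    also have "\<dots> = (\<Sum>u\<in>f ` set_pmf p. pmf ?p u)"
    proof (rule sum.cong)
      fix u assume "u \<in> f ` set_pmf p"
      then obtain x where "x \<in> set_pmf p" "u = f x" by blast
      with pos(4)[of x] show "pmf ?q u * (pmf ?p u / pmf ?q u) = pmf ?p u" by simp
    qed simp
    also have "\<dots> = 1" using fin by (intro sum_pmf_eq_1) auto
    finally show ?thesis .
  qed
  then have "expect p (\<lambda>x. ln (?r x)) \<le> 0"
    using fin pos by (intro expectation_ln_le_0 divide_pos_pos mult_pos_pos) blast+
  also have "expect p (\<lambda>x. ln (?r x))
      = expect p (\<lambda>x. ln (pmf ?p (f x) / pmf ?q (f x)) - ln (pmf p x / pmf q x))"
  proof (rule expectation_cong_set)
    fix x assume "x \<in> set_pmf p"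
    from pos[OF this] show "ln (?r x) = ln (pmf ?p (f x) / pmf ?q (f x)) - ln (pmf p x / pmf q x)"
      by (simp add: ln_div ln_mult_pos)
  qed
  also have "\<dots> = kl ?p ?q - kl p q"
    using fin by (simp add: expectation_diff_finite kl_def)
  finally show ?thesis by simp
qed

lemma accept_prob_expectation: "accept_prob L \<psi> = expect L (\<lambda>z. pmf (\<psi> z) Accept_Null)"
  by (simp add: accept_prob_def pmf_bind)

text \<open>The Donsker--Varadhan inequality for the function \<open>z \<mapsto> c * Pr[\<psi> z = Accept_Null]\<close>.\<close>

lemma accept_prob_kl:
  assumes fin: "finite (set_pmf J)" and sub: "set_pmf J \<subseteq> set_pmf Q"
  shows "accept_prob J \<psi> * c \<le> kl J Q + ln (1 + accept_prob Q \<psi> * exp c)"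
proof -
  let ?a = "\<lambda>z. pmf (\<psi> z) Accept_Null" and ?E = expect
  define Z where "Z = 1 + accept_prob Q \<psi> * exp c"
  have Z: "Z > 0" unfolding Z_def using accept_prob_nonneg[of Q \<psi>] by (simp add: add_pos_nonneg)
  have pos: "pmf J z > 0" "pmf Q z > 0" if "z \<in> set_pmf J" for z using that sub by (auto simp: pmf_positive_iff)
  let ?r = "\<lambda>z. exp (?a z * c) * pmf Q z / (pmf J z * Z)"
  have "?E J ?r = (\<Sum>z\<in>set_pmf J. ?r z * pmf J z)" using fin by (intro integral_measure_pmf_real) auto
  also have "\<dots> = (\<Sum>z\<in>set_pmf J. exp (?a z * c) * pmf Q z) / Z"
    unfolding sum_divide_distrib
  proof (rule sum.cong)
    fix z assume "z \<in> set_pmf J"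
    from pos[OF this] show "?r z * pmf J z = exp (?a z * c) * pmf Q z / Z" using Z by simp
  qed simp
  also have "\<dots> \<le> (\<Sum>z\<in>set_pmf J. pmf Q z + (?a z * pmf Q z) * exp c) / Z"
  proof (intro divide_right_mono sum_mono)
    fix z
    \<comment> \<open>Convexity of \<open>exp\<close> between 0 and \<open>c\<close> gives
      \<open>exp (a * c) <= 1 + a * exp c\<close>, which is linear in the acceptance
      probability.\<close>
    have "exp (?a z * c) = exp ((1 - ?a z) *\<^sub>R 0 + ?a z *\<^sub>R c)" by simp
    also have "\<dots> \<le> (1 - ?a z) * exp 0 + ?a z * exp c"
      by (intro convex_onD[OF exp_convex]) (auto simp: pmf_le_1)
    also have "\<dots> \<le> 1 + ?a z * exp c" by simp
    finally have "exp (?a z * c) * pmf Q z \<le> (1 + ?a z * exp c) * pmf Q z" by (intro mult_right_mono) auto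
    then show "exp (?a z * c) * pmf Q z \<le> pmf Q z + (?a z * pmf Q z) * exp c" by (simp add: algebra_simps)
  qed (use Z in simp)
  also have "\<dots> \<le> 1"
  proof -
    have "(\<Sum>z\<in>set_pmf J. pmf Q z) \<le> 1" using fin by (simp flip: measure_measure_pmf_finite)
    moreover have "(\<Sum>z\<in>set_pmf J. ?a z * pmf Q z) \<le> accept_prob Q \<psi>"
    proof -
      have "(\<Sum>z\<in>set_pmf J. ?a z * pmf Q z) = ?E Q (\<lambda>z. if z \<in> set_pmf J then ?a z else 0)"
        using fin by (subst integral_measure_pmf_real[where A = "set_pmf J"]) (auto split: if_splits)
      also have "\<dots> \<le> ?E Q ?a"
        by (intro integral_mono measure_pmf.integrable_const_bound[where B = 1]) (auto simp: pmf_le_1)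
      finally show ?thesis by (simp add: accept_prob_expectation)
    qed
    ultimately have "(\<Sum>z\<in>set_pmf J. pmf Q z + (?a z * pmf Q z) * exp c) \<le> Z"
      unfolding Z_def sum.distrib sum_distrib_right[symmetric] by (intro add_mono mult_right_mono) auto
    then show ?thesis using Z by simp
  qed
  finally have "?E J (\<lambda>z. ln (?r z)) \<le> 0" using fin pos Z by (intro expectation_ln_le_0) auto
  also have "?E J (\<lambda>z. ln (?r z)) = ?E J (\<lambda>z. (?a z * c - ln (pmf J z / pmf Q z)) - ln Z)"
  proof (rule expectation_cong_set)
    fix z assume "z \<in> set_pmf J"
    from pos[OF this] show "ln (?r z) = (?a z * c - ln (pmf J z / pmf Q z)) - ln Z"
      using Z by (simp add: ln_div ln_mult_pos)
  qed
  also have "\<dots> = accept_prob J \<psi> * c - kl J Q - ln Z"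
    using fin by (simp add: expectation_diff_finite kl_def accept_prob_expectation)
  finally show ?thesis by (simp add: Z_def)
qed

text \<open>As the reference is a product, the divergence splits into the mutual information between
  \<open>y\<close> and the message plus two marginal divergences; data processing then replaces the
  message by \<open>x\<close> in the second.\<close>

lemma compressed_kl:
  assumes fin: "finite (set_pmf R)" and sub: "set_pmf (map_pmf fst R) \<subseteq> set_pmf QY" "set_pmf (map_pmf snd R) \<subseteq> set_pmf QX"
  shows "set_pmf (compressed \<phi> R) \<subseteq> set_pmf (pair_pmf QY (map_pmf \<phi> QX))"
    and "kl (compressed \<phi> R) (pair_pmf QY (map_pmf \<phi> QX))
      \<le> minfo (compressed \<phi> R) + kl (map_pmf fst R) QY + kl (map_pmf snd R) QX"
proof -
  let ?J = "compressed \<phi> R" and ?E = expect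
  have fst: "map_pmf fst ?J = map_pmf fst R" by (simp add: compressed_def map_pmf_comp case_prod_unfold)
  have snd: "map_pmf snd ?J = map_pmf \<phi> (map_pmf snd R)" by (simp add: compressed_def map_pmf_comp case_prod_unfold)
  have fJ: "finite (set_pmf ?J)" using fin by (simp add: compressed_def)
  show J: "set_pmf ?J \<subseteq> set_pmf (pair_pmf QY (map_pmf \<phi> QX))"
    using sub by (force simp: compressed_def)
  have "kl ?J (pair_pmf QY (map_pmf \<phi> QX)) = ?E ?J (\<lambda>z. info_density ?J z
      + ln (pmf (map_pmf fst ?J) (fst z) / pmf QY (fst z)) + ln (pmf (map_pmf snd ?J) (snd z) / pmf (map_pmf \<phi> QX) (snd z)))"
    unfolding kl_def
  proof (rule expectation_cong_set)
    fix z assume z: "z \<in> set_pmf ?J"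
    have "z \<in> set_pmf (pair_pmf QY (map_pmf \<phi> QX))" using J z by blast
    then have "pmf QY (fst z) > 0" "pmf (map_pmf \<phi> QX) (snd z) > 0" by (auto simp: pmf_positive_iff)
    then show "ln (pmf ?J z / pmf (pair_pmf QY (map_pmf \<phi> QX)) z) = info_density ?J z
      + ln (pmf (map_pmf fst ?J) (fst z) / pmf QY (fst z)) + ln (pmf (map_pmf snd ?J) (snd z) / pmf (map_pmf \<phi> QX) (snd z))"
      using pmf_marginal_pos[OF z] pmf_positive[OF z] pmf_pair[of QY "map_pmf \<phi> QX" "fst z" "snd z"]
      unfolding info_density_def by (simp add: ln_div ln_mult_pos)
  qed
  also have "\<dots> = minfo ?J + kl (map_pmf fst ?J) QY + kl (map_pmf snd ?J) (map_pmf \<phi> QX)"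
    using fJ by (simp add: expectation_add_finite minfo_def kl_def)
  also have "kl (map_pmf snd ?J) (map_pmf \<phi> QX) \<le> kl (map_pmf snd R) QX"
    unfolding snd using fin sub(2) by (intro kl_map_le) auto
  finally show "kl ?J (pair_pmf QY (map_pmf \<phi> QX)) \<le> minfo ?J + kl (map_pmf fst R) QY + kl (map_pmf snd R) QX"
    by (simp add: fst)
qed

text \<open>With \<open>c = n * E'\<close> in \<open>accept_prob_kl\<close> the term
  \<open>accept_prob Q \<psi> * exp c\<close> stays below \<open>\<kappa> i\<close>, so the
  divergence of the compressed laws is at least about \<open>n * E\<close>. Subtracting the marginal
  divergences leaves a lower bound on the mutual information. The factor \<open>\<kappa> i\<close>
  makes room for the weight of one component of a mixture.\<close>

lemma converse_region:
  fixes P :: "'i \<Rightarrow> ('y::finite \<times> 'x::finite) pmf"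
  assumes F: "finite F" and P: "\<And>i. i \<in> F \<Longrightarrow> map_pmf snd (P i) = s"
    and M: "\<And>n. finite (M n) \<and> (\<forall>xs. length xs = n \<longrightarrow> \<phi> n xs \<in> M n)"
    and alpha: "\<And>i. i \<in> F \<Longrightarrow> (\<lambda>n. accept_prob (compressed (\<phi> n) (iid_pairs n (P i))) (\<psi> n)) \<longlonglongrightarrow> 1"
    and beta: "\<And>i E'. i \<in> F \<Longrightarrow> E' < E \<Longrightarrow> \<forall>\<^sub>F n in sequentially.
       accept_prob (pair_pmf (QY i n) (map_pmf (\<phi> n) (QX n))) (\<psi> n) \<le> \<kappa> i * exp (- (real n * E'))"
    and \<kappa>: "\<And>i. i \<in> F \<Longrightarrow> \<kappa> i > 0"
    and rate: "\<And>e. e > 0 \<Longrightarrow> \<forall>\<^sub>F n in sequentially. ln (real (card (M n))) \<le> real n * (R + e)"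
    and dy: "\<And>i. i \<in> F \<Longrightarrow> kl_upper (map_pmf fst (P i)) (QY i) (dy i)" and dx: "kl_upper s QX dx"
    and "e > 0"
  shows "region s P F 1 (R + e) (\<lambda>i. (E - dy i - dx) - e)"
proof -
  \<comment> \<open>One quarter of \<open>e\<close> for the second error exponent, one for the
    acceptance probability falling short of 1, and one for the additive constants.\<close>
  define E' where "E' = E - e / 4"
  have e4: "e / 4 > 0" "E' < E" using \<open>e > 0\<close> by (auto simp: E'_def)
  have ev: "\<forall>\<^sub>F n in sequentially. minfo (compressed (\<phi> n) (iid_pairs n (P i))) \<ge> real n * (E - dy i - dx - e)" if i: "i \<in> F" for i
  proof -
    obtain Cy where Cy: "\<forall>\<^sub>F n in sequentially. set_pmf (replicate_pmf n (map_pmf fst (P i))) \<subseteq> set_pmf (QY i n) \<and>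
        kl (replicate_pmf n (map_pmf fst (P i))) (QY i n) \<le> real n * dy i + Cy"
      using dy[OF i] by (auto simp: kl_upper_def)
    obtain Cx where Cx: "\<forall>\<^sub>F n in sequentially. set_pmf (replicate_pmf n s) \<subseteq> set_pmf (QX n) \<and>
        kl (replicate_pmf n s) (QX n) \<le> real n * dx + Cx"
      using dx by (auto simp: kl_upper_def)
    have "(\<lambda>n. accept_prob (compressed (\<phi> n) (iid_pairs n (P i))) (\<psi> n) * E') \<longlonglongrightarrow> 1 * E'"
      by (intro tendsto_intros alpha i)
    then have "\<forall>\<^sub>F n in sequentially. accept_prob (compressed (\<phi> n) (iid_pairs n (P i))) (\<psi> n) * E' > E' - e / 4"
      using e4 by (intro order_tendstoD(1)) auto
    moreover have "\<forall>\<^sub>F n in sequentially. real n \<ge> (Cy + Cx + ln (1 + \<kappa> i)) / (e / 4)" by (rule eventually_real_ge)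
    ultimately show ?thesis
      using beta[OF i e4(2)] Cy Cx
    proof eventually_elim
      case (elim n)
      let ?R = "iid_pairs n (P i)" and ?c = "real n * E'"
      let ?p = "accept_prob (compressed (\<phi> n) ?R) (\<psi> n)"
        and ?b = "accept_prob (pair_pmf (QY i n) (map_pmf (\<phi> n) (QX n))) (\<psi> n)"
      have fR: "finite (set_pmf ?R)" by (simp add: iid_pairs_def)
      have fstR: "map_pmf fst ?R = replicate_pmf n (map_pmf fst (P i))" by (rule iid_pairs_fst)
      have sndR: "map_pmf snd ?R = replicate_pmf n s" using P[OF i] by (simp add: iid_pairs_snd)
      have sub: "set_pmf (map_pmf fst ?R) \<subseteq> set_pmf (QY i n)" "set_pmf (map_pmf snd ?R) \<subseteq> set_pmf (QX n)"
        unfolding fstR sndR using elim by auto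
      have "?p * ?c \<le> kl (compressed (\<phi> n) ?R) (pair_pmf (QY i n) (map_pmf (\<phi> n) (QX n))) + ln (1 + ?b * exp ?c)"
        using fR by (intro accept_prob_kl compressed_kl(1)[OF fR sub]) (simp add: compressed_def)
      also have "\<dots> \<le> (minfo (compressed (\<phi> n) ?R) + kl (map_pmf fst ?R) (QY i n) + kl (map_pmf snd ?R) (QX n)) + ln (1 + \<kappa> i)"
      proof (intro add_mono compressed_kl(2)[OF fR sub])
        have "?b * exp ?c \<le> \<kappa> i * exp (- ?c) * exp ?c" using elim by (intro mult_right_mono) auto
        also have "\<dots> = \<kappa> i" by (simp add: mult.assoc flip: exp_add)
        finally show "ln (1 + ?b * exp ?c) \<le> ln (1 + \<kappa> i)"
          using accept_prob_nonneg[of "pair_pmf (QY i n) (map_pmf (\<phi> n) (QX n))" "\<psi> n"]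
          by (intro ln_mono) (auto intro: add_pos_nonneg)
      qed
      also have "\<dots> \<le> minfo (compressed (\<phi> n) ?R) + (real n * dy i + Cy) + (real n * dx + Cx) + ln (1 + \<kappa> i)"
        unfolding fstR sndR using elim by (intro add_mono) auto
      also have "Cy + Cx + ln (1 + \<kappa> i) \<le> real n * (e / 4)"
        using elim(2) \<open>e > 0\<close> by (simp add: field_simps)
      then have "minfo (compressed (\<phi> n) ?R) + (real n * dy i + Cy) + (real n * dx + Cx) + ln (1 + \<kappa> i)
          \<le> minfo (compressed (\<phi> n) ?R) + real n * dy i + real n * dx + real n * (e / 4)" by linarith
      finally have "?p * ?c \<le> minfo (compressed (\<phi> n) ?R) + real n * dy i + real n * dx + real n * (e / 4)" .
      moreover have "real n * (E' - e / 4) \<le> ?p * ?c"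
      proof -
        have "real n * (E' - e / 4) \<le> real n * (?p * E')" using elim(1) by (intro mult_left_mono) auto
        then show ?thesis by (simp add: mult_ac)
      qed
      ultimately have "real n * (E' - e / 4) - real n * dy i - real n * dx - real n * (e / 4) \<le> minfo (compressed (\<phi> n) ?R)"
        by linarith
      moreover have "real n * (E - dy i - dx - e) \<le> real n * (E' - e / 4) - real n * dy i - real n * dx - real n * (e / 4)"
      proof -
        have "real n * (E - dy i - dx - e) \<le> real n * (E' - e / 4 - dy i - dx - e / 4)"
          using \<open>e > 0\<close> by (intro mult_left_mono) (auto simp: E'_def)
        then show ?thesis by (simp only: right_diff_distrib)
      qed
      ultimately show ?case by linarith
    qed
  qed
  have "\<forall>\<^sub>F n in sequentially. \<forall>i\<in>F. minfo (compressed (\<phi> n) (iid_pairs n (P i))) \<ge> real n * (E - dy i - dx - e)"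
    using ev F by (intro eventually_ball_finite) auto
  moreover note rate[OF \<open>e > 0\<close>] eventually_gt_at_top[of 0]
  ultimately have "\<forall>\<^sub>F n in sequentially. region s P F 1 (R + e) (\<lambda>i. (E - dy i - dx) - e)"
  proof eventually_elim
    case (elim n)
    have ent: "entropy_of (replicate_pmf n s) (\<phi> n) \<le> real n * (R + e)"
    proof (rule order_trans[OF entropy_of_le_ln_card[of _ "M n"] elim(2)])
      show "\<phi> n xs \<in> M n" if "xs \<in> set_pmf (replicate_pmf n s)" for xs
        using that M[of n] by (auto simp: set_replicate_pmf)
    qed (use M in auto)
    have "region s P F (real n) (real n * (R + e)) (\<lambda>i. real n * (E - dy i - dx - e))"
      by (rule region_mono[OF region_encoder[OF P] ent]) (use elim(1) in auto)
    \<comment> \<open>A single large block length suffices: after division by \<open>n\<close> the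
      claim no longer mentions it.\<close>
    from region_scale[OF this, of "1 / real n"] show ?case using elim(3) by simp
  qed
  then show ?thesis by (simp add: eventually_const)
qed

section \<open>Attainment of the rate function\<close>

text \<open>Makes the constant kernel feasible at every rate \<open>R >= 0\<close>, so the maximum
  in \<open>theta\<close> is over a nonempty set.\<close>

lemma minfo_const_kernel: "minfo (law_XU s (\<lambda>_. return_pmf 0)) = 0"
proof -
  have "minfo (law_XU s (\<lambda>_. return_pmf 0)) = expect (law_XU s (\<lambda>_. return_pmf 0)) (\<lambda>_. 0)"
    unfolding minfo_def
  proof (rule expectation_cong_set)
    fix z assume "z \<in> set_pmf (law_XU s (\<lambda>_. return_pmf (0 :: nat)))"
    then have z: "fst z \<in> set_pmf s" "snd z = 0" by (auto simp: law_XU_def)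
    have snd: "map_pmf snd (law_XU s (\<lambda>_. return_pmf (0 :: nat))) = return_pmf 0"
      by (simp add: law_XU_def map_bind_pmf)
    have "pmf (law_XU s (\<lambda>_. return_pmf (0 :: nat))) z = pmf s (fst z)"
      using z pmf_joint[of s "\<lambda>_. return_pmf (0 :: nat)" "fst z" "snd z"] by (cases z) (simp add: law_XU_eq)
    moreover have fst: "map_pmf fst (law_XU s (\<lambda>_. return_pmf (0 :: nat))) = s"
      unfolding law_XU_eq by (rule map_fst_joint)
    ultimately show "info_density (law_XU s (\<lambda>_. return_pmf 0)) z = 0"
      using z unfolding info_density_def snd fst by (simp add: set_pmf_iff)
  qed
  then show ?thesis by simp
qed

text \<open>Follows from P(y, u) <= P(u). The bound does not involve \<open>W\<close>, so the values
  competing in \<open>theta\<close> are bounded above.\<close>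

lemma minfo_le_entropy:
  fixes p :: "('y::finite \<times> 'x::finite) pmf"
  assumes W: "\<And>x. finite (set_pmf (W x))"
  shows "minfo (law_YU p W) \<le> entropy_of (map_pmf fst p) (\<lambda>y. y)"
proof -
  let ?L = "law_YU p W"
  have fL: "finite (set_pmf ?L)" using W by (auto simp: law_YU_def)
  have "minfo ?L \<le> expect ?L (\<lambda>z. - ln (pmf (map_pmf fst p) (fst z)))"
    unfolding minfo_def
  proof (rule expectation_mono_set[OF fL])
    fix z assume z: "z \<in> set_pmf ?L"
    note pos = pmf_marginal_pos[OF z] pmf_positive[OF z]
    have "pmf ?L z \<le> pmf (map_pmf snd ?L) (snd z)"
      unfolding pmf_map[of snd] measure_pmf_single[of ?L, symmetric] by (intro prob_mono_set) auto
    then have "pmf ?L z / (pmf (map_pmf fst ?L) (fst z) * pmf (map_pmf snd ?L) (snd z)) \<le> 1 / pmf (map_pmf fst ?L) (fst z)"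
      using pos by (simp add: field_simps)
    then have "info_density ?L z \<le> ln (1 / pmf (map_pmf fst ?L) (fst z))"
      unfolding info_density_def using pos by (intro ln_mono) auto
    then show "info_density ?L z \<le> - ln (pmf (map_pmf fst p) (fst z))"
      using pos by (simp add: ln_div map_fst_law_YU)
  qed
  also have "\<dots> = expect (map_pmf fst ?L) (\<lambda>y. - ln (pmf (map_pmf fst p) y))" by simp
  finally show ?thesis unfolding map_fst_law_YU by (simp add: entropy_of_def)
qed

text \<open>\<open>Greatest\<close> is informative only once the maximum is known to exist. The
  supremum \<open>v\<close> is approached by feasible kernels, so every slack around
  \<open>v\<close> lies in the region, and closedness yields a kernel attaining \<open>v\<close>.
  Later on, \<open>theta\<close> is used only through these conclusions.\<close>

lemma theta_attained:
  fixes P :: "nat \<Rightarrow> ('y::finite \<times> 'x::finite) pmf"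
  assumes s: "s \<in> PXs P m" and "R \<ge> 0"
    and d: "\<And>i. i \<in> cls P m s \<Longrightarrow> cY i (first_argmin k (cY i)) + cX s (first_argmin r (cX s)) = ereal (d i)"
  obtains W where "finite_kernel W" "minfo (law_XU s W) \<le> R"
    "\<And>i. i \<in> cls P m s \<Longrightarrow> theta m k r P cY cX s R \<le> ereal (minfo (law_YU (P i) W) + d i)"
    "\<And>W' v. finite_kernel W' \<Longrightarrow> minfo (law_XU s W') \<le> R \<Longrightarrow>
       (\<And>i. i \<in> cls P m s \<Longrightarrow> v \<le> minfo (law_YU (P i) W') + d i) \<Longrightarrow> ereal v \<le> theta m k r P cY cX s R"
proof -
  let ?F = "cls P m s"
  have F: "finite ?F" "?F \<noteq> {}" using s by (auto simp: cls_def PXs_def)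
  have P: "map_pmf snd (P i) = s" if "i \<in> ?F" for i using that by (simp add: cls_def margX_def)
  define val where "val W = Min ((\<lambda>i. minfo (law_YU (P i) W) + d i) ` ?F)" for W
  define feas where "feas W \<longleftrightarrow> finite_kernel W \<and> minfo (law_XU s W) \<le> R" for W
  have val_le: "val W \<le> minfo (law_YU (P i) W) + d i" if "i \<in> ?F" for W i
    unfolding val_def using F that by (intro Min_le) auto
  have val_ge: "v \<le> val W" if "\<And>i. i \<in> ?F \<Longrightarrow> v \<le> minfo (law_YU (P i) W) + d i" for v W
    unfolding val_def using F that by (subst Min_ge_iff) auto
  have feas0: "feas (\<lambda>_. return_pmf 0)"
    unfolding feas_def finite_kernel_def using \<open>R \<ge> 0\<close> by (auto simp: minfo_const_kernel intro: exI[of _ "{0}"])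
  obtain i0 where i0: "i0 \<in> ?F" using F by blast
  have bdd: "bdd_above (val ` {W. feas W})"
  proof (rule bdd_aboveI2)
    fix W assume "W \<in> {W. feas W}"
    then have fin: "\<And>x. finite (set_pmf (W x))" by (auto simp: feas_def finite_kernel_def intro: finite_subset)
    show "val W \<le> entropy_of (map_pmf fst (P i0)) (\<lambda>y. y) + d i0"
      using val_le[OF i0, of W] minfo_le_entropy[where W = W and p = "P i0", OF fin] by linarith
  qed
  define v where "v = Sup (val ` {W. feas W})"
  have v_upper: "val W \<le> v" if "feas W" for W unfolding v_def using bdd that by (intro cSup_upper) auto
  have "region s P ?F 1 (R + e) (\<lambda>i. v - d i - e)" if "e > 0" for e
  proof -
    have "v - e < Sup (val ` {W. feas W})" using that by (simp add: v_def)
    then obtain W where W: "feas W" "v - e < val W"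
      using less_cSup_iff[OF _ bdd] feas0 by auto
    show ?thesis
    proof (rule region_mono[OF region_kernel[OF _ P]])
      show "finite_kernel W" "minfo (law_XU s W) \<le> R + e" using W \<open>e > 0\<close> by (auto simp: feas_def)
      show "v - d i - e \<le> minfo (law_YU (P i) W)" if "i \<in> ?F" for i using val_le[OF that, of W] W by linarith
    qed
  qed
  from region_closed[OF F(1) P this] obtain W where W: "finite_kernel W" "minfo (law_XU s W) \<le> R"
    "\<And>i. i \<in> ?F \<Longrightarrow> v - d i \<le> minfo (law_YU (P i) W)" by blast
  have vW: "val W = v"
    using v_upper[of W] W by (intro antisym val_ge) (auto simp: feas_def field_simps)
  have obj: "Min ((\<lambda>i. mutual_info (law_YU (P i) W') + (cY i (first_argmin k (cY i)) + cX s (first_argmin r (cX s)))) ` ?F)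
      = ereal (val W')" for W'
  proof -
    have "(\<lambda>i. mutual_info (law_YU (P i) W') + (cY i (first_argmin k (cY i)) + cX s (first_argmin r (cX s)))) ` ?F
        = ereal ` (\<lambda>i. minfo (law_YU (P i) W') + d i) ` ?F"
      unfolding image_image using d by (intro image_cong) (auto simp: mutual_info_eq_minfo)
    then show ?thesis
      unfolding val_def using F by (simp add: mono_Min_commute[of ereal] mono_def)
  qed
  have theta: "theta m k r P cY cX s R = ereal v"
    unfolding theta_def obj
    unfolding mutual_info_eq_minfo finite_kernel_def[symmetric]
  proof (rule Greatest_equality)
    show "\<exists>W. finite_kernel W \<and> ereal (minfo (law_XU s W)) \<le> ereal R \<and> ereal v = ereal (val W)"
      using W vW by auto
    show "y \<le> ereal v" if "\<exists>W. finite_kernel W \<and> ereal (minfo (law_XU s W)) \<le> ereal R \<and> y = ereal (val W)" for y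
      using that v_upper by (auto simp: feas_def)
  qed
  show thesis
  proof (rule that[OF W(1,2)])
    show "theta m k r P cY cX s R \<le> ereal (minfo (law_YU (P i) W) + d i)" if "i \<in> ?F" for i
      unfolding theta using W(3)[OF that] by simp
    show "ereal v' \<le> theta m k r P cY cX s R"
      if "finite_kernel W'" "minfo (law_XU s W') \<le> R" "\<And>i. i \<in> ?F \<Longrightarrow> v' \<le> minfo (law_YU (P i) W') + d i" for W' v'
      unfolding theta using val_ge[OF that(3)] v_upper[of W'] that(1,2) by (auto simp: feas_def intro: order_trans)
  qed
qed

section \<open>Both settings under one interface, and the mixture\<close>

lemma first_argmin:
  assumes "k \<ge> 1"
  shows "first_argmin k f \<in> {1..k}" "\<And>j. j \<in> {1..k} \<Longrightarrow> f (first_argmin k f) \<le> f j"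
    "f (first_argmin k f) = Min (f ` {1..k})"
proof -
  have ne: "f ` {1..k} \<noteq> {}" "finite (f ` {1..k})" using assms by auto
  obtain j where j: "j \<in> {1..k}" "f j = Min (f ` {1..k})" using Min_in[OF ne(2,1)] by force
  then have "j \<in> {1..k} \<and> (\<forall>j'\<in>{1..k}. f j \<le> f j')" using ne by auto
  then have *: "first_argmin k f \<in> {1..k} \<and> (\<forall>j'\<in>{1..k}. f (first_argmin k f) \<le> f j')"
    unfolding first_argmin_def by (rule LeastI)
  then show "first_argmin k f \<in> {1..k}" "\<And>j. j \<in> {1..k} \<Longrightarrow> f (first_argmin k f) \<le> f j" by auto
  show "f (first_argmin k f) = Min (f ` {1..k})"
    using * ne by (intro Min_eqI[symmetric]) auto
qed

text \<open>The common interface of the two settings. The rate may be infinite, because finiteness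
  is guaranteed for the minimisers only; the linear bound is asked for in the finite case
  alone.\<close>

definition divergence_rate :: "'a pmf \<Rightarrow> (nat \<Rightarrow> 'a list pmf) \<Rightarrow> ereal \<Rightarrow> bool" where
  "divergence_rate p Q c \<longleftrightarrow> aep_lower p Q c \<and> c \<noteq> -\<infinity> \<and> (\<forall>c'. c = ereal c' \<longrightarrow> kl_upper p Q c')"

lemma divergence_rate_memoryless:
  assumes "finite (set_pmf p)" "\<And>n. Q n = replicate_pmf n q"
  shows "divergence_rate p Q (rel_entropy p q)"
  using memoryless_aep_lower[OF assms] memoryless_kl_upper[OF assms]
  by (auto simp: divergence_rate_def rel_entropy_eq)

lemma divergence_rate_markov:
  fixes Q :: "nat \<Rightarrow> 'a::finite list pmf"
  assumes "markov_marginals Q" "\<And>n. absolutely_continuous (measure_pmf (Q n)) (measure_pmf (replicate_pmf n p))"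
  shows "divergence_rate p Q (lim (divergence_increment p Q))"
proof -
  have "\<And>n. set_pmf (replicate_pmf n p) \<subseteq> set_pmf (Q n)" using assms(2) by (simp add: absolutely_continuous_pmf_iff)
  from markov_source[OF assms(1) this] obtain c where "lim (divergence_increment p Q) = ereal c"
    "aep_lower p Q (ereal c)" "kl_upper p Q c" by blast
  then show ?thesis by (simp add: divergence_rate_def)
qed

lemma setting_divergence_rate:
  fixes P :: "nat \<Rightarrow> ('y::finite \<times> 'x::finite) pmf"
  assumes "memoryless_setting m k r P QY QX cY cX \<or> markov_setting m k r P QY QX cY cX"
  shows "\<forall>i\<in>{1..m}. \<forall>j\<in>{1..k}. divergence_rate (margY P i) (QY j) (cY i j)"
    and "\<forall>s\<in>PXs P m. \<forall>t\<in>{1..r}. divergence_rate s (QX t) (cX s t)"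
    and "\<forall>i\<in>{1..m}. Min (cY i ` {1..k}) < \<infinity>" "\<forall>s\<in>PXs P m. Min (cX s ` {1..r}) < \<infinity>"
proof -
  have "(\<forall>i\<in>{1..m}. \<forall>j\<in>{1..k}. divergence_rate (margY P i) (QY j) (cY i j)) \<and>
    (\<forall>s\<in>PXs P m. \<forall>t\<in>{1..r}. divergence_rate s (QX t) (cX s t))"
    using assms
  proof
    assume "memoryless_setting m k r P QY QX cY cX"
    then obtain qY qX where q: "\<forall>j\<in>{1..k}. \<forall>n. QY j n = replicate_pmf n (qY j)"
      "\<forall>t\<in>{1..r}. \<forall>n. QX t n = replicate_pmf n (qX t)"
      "\<forall>i\<in>{1..m}. \<forall>j\<in>{1..k}. cY i j = rel_entropy (margY P i) (qY j)"
      "\<forall>s\<in>PXs P m. \<forall>t\<in>{1..r}. cX s t = rel_entropy s (qX t)"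
      unfolding memoryless_setting_def by blast
    then show ?thesis by (simp add: divergence_rate_memoryless)
  next
    assume "markov_setting m k r P QY QX cY cX"
    then show ?thesis unfolding markov_setting_def by (auto simp: divergence_rate_markov)
  qed
  then show "\<forall>i\<in>{1..m}. \<forall>j\<in>{1..k}. divergence_rate (margY P i) (QY j) (cY i j)"
    "\<forall>s\<in>PXs P m. \<forall>t\<in>{1..r}. divergence_rate s (QX t) (cX s t)" by auto
  show "\<forall>i\<in>{1..m}. Min (cY i ` {1..k}) < \<infinity>" "\<forall>s\<in>PXs P m. Min (cX s ` {1..r}) < \<infinity>"
    using assms by (auto simp: memoryless_setting_def markov_setting_def)
qed

lemma accept_prob_le_1: "accept_prob L \<psi> \<le> 1"
  by (simp add: accept_prob_def pmf_le_1)

lemma accept_prob_bind: "accept_prob (bind_pmf p L) \<psi> = expect p (\<lambda>i. accept_prob (L i) \<psi>)"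
  unfolding accept_prob_def bind_assoc_pmf pmf_bind ..

lemma simple_alpha_mixture:
  "simple_alpha (mixture_null \<nu> P) n \<phi> \<psi>
   = 1 - expect \<nu> (\<lambda>i. accept_prob (compressed \<phi> (iid_pairs n (P i))) \<psi>)"
  by (simp add: simple_alpha_def mixture_null_def compressed_def map_bind_pmf accept_prob_bind)

lemma compressed_pair: "compressed \<phi> (pair_pmf p q) = pair_pmf p (map_pmf \<phi> q)"
  unfolding compressed_def pair_map_pmf2 by (intro map_pmf_cong) auto

lemma simple_beta_mixture:
  "simple_beta (mixture_alt \<tau> QY QX) n \<phi> \<psi>
   = expect \<tau> (\<lambda>(j, t). accept_prob (pair_pmf (QY j n) (map_pmf \<phi> (QX t n))) \<psi>)"
proof -
  have "compressed \<phi> (mixture_alt \<tau> QY QX n) = bind_pmf \<tau> (\<lambda>(j, t). pair_pmf (QY j n) (map_pmf \<phi> (QX t n)))"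
    unfolding mixture_alt_def compressed_pair[symmetric] unfolding compressed_def map_bind_pmf
    by (intro bind_pmf_cong) auto
  then show ?thesis
    by (simp add: simple_beta_def accept_prob_bind case_prod_unfold)
qed

lemma weighted_term_le_expectation:
  fixes h :: "'a \<Rightarrow> real"
  assumes "finite (set_pmf p)" "\<And>x. h x \<ge> 0" "x \<in> set_pmf p"
  shows "pmf p x * h x \<le> expect p h"
proof -
  have "h x * pmf p x \<le> (\<Sum>x\<in>set_pmf p. h x * pmf p x)"
    using assms by (intro member_le_sum) auto
  also have "\<dots> = expect p h"
    using assms by (intro integral_measure_pmf_real[symmetric]) auto
  finally show ?thesis by (simp add: mult.commute)
qed

lemma log_recip_antimono:
  assumes "0 \<le> a" "a \<le> b"
  shows "log_recip b \<le> log_recip a"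
proof (cases "a = 0")
  case False
  then show ?thesis using assms by (auto simp: log_recip_def ln_div intro: ln_mono)
qed (simp add: log_recip_def)

lemma achievable_mono:
  assumes ach: "achievable \<alpha> \<beta> \<epsilon> R E" and "\<And>n \<phi> \<psi>. \<alpha>' n \<phi> \<psi> \<le> \<alpha> n \<phi> \<psi>"
    and "\<And>n \<phi> \<psi>. 0 \<le> \<beta>' n \<phi> \<psi>" "\<And>n \<phi> \<psi>. \<beta>' n \<phi> \<psi> \<le> \<beta> n \<phi> \<psi>"
  shows "achievable \<alpha>' \<beta>' \<epsilon> R E"
proof -
  obtain M \<phi> \<psi> where S: "\<forall>n. finite (M n) \<and> (\<forall>xs. length xs = n \<longrightarrow> \<phi> n xs \<in> M n)"
    "limsup (\<lambda>n. ereal (\<alpha> n (\<phi> n) (\<psi> n))) \<le> ereal \<epsilon>"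
    "liminf (\<lambda>n. ereal (1 / real n) * log_recip (\<beta> n (\<phi> n) (\<psi> n))) \<ge> ereal E"
    "limsup (\<lambda>n. ereal (1 / real n * ln (real (card (M n))))) \<le> ereal R"
    using ach unfolding achievable_def by blast
  have "limsup (\<lambda>n. ereal (\<alpha>' n (\<phi> n) (\<psi> n))) \<le> limsup (\<lambda>n. ereal (\<alpha> n (\<phi> n) (\<psi> n)))"
    using assms(2) by (intro Limsup_mono always_eventually) auto
  moreover have "liminf (\<lambda>n. ereal (1 / real n) * log_recip (\<beta> n (\<phi> n) (\<psi> n)))
      \<le> liminf (\<lambda>n. ereal (1 / real n) * log_recip (\<beta>' n (\<phi> n) (\<psi> n)))"
    using assms(3,4) by (intro Liminf_mono always_eventually allI ereal_mult_left_mono log_recip_antimono) auto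
  ultimately show ?thesis
    unfolding achievable_def using S by (meson order_trans)
qed

theorem theorem3:
  fixes m k r :: nat
    and P :: "nat \<Rightarrow> ('y::finite \<times> 'x::finite) pmf"
    and QY :: "nat \<Rightarrow> nat \<Rightarrow> 'y list pmf"
    and QX :: "nat \<Rightarrow> nat \<Rightarrow> 'x list pmf"
    and cY :: "nat \<Rightarrow> nat \<Rightarrow> ereal"
    and cX :: "'x pmf \<Rightarrow> nat \<Rightarrow> ereal"
    and \<nu> :: "nat pmf"
    and \<tau> :: "(nat \<times> nat) pmf"
    and Rc :: real
  assumes "memoryless_setting m k r P QY QX cY cX \<or> markov_setting m k r P QY QX cY cX"
    and "set_pmf \<nu> = {1..m}"
    and "set_pmf \<tau> \<subseteq> {1..k} \<times> {1..r}"
    and "\<And>s i. s \<in> PXs P m \<Longrightarrow> i \<in> cls P m s \<Longrightarrow>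
           pmf \<tau> (first_argmin k (cY i), first_argmin r (cX s)) > 0"
    and "Rc \<ge> 0"
  shows "mixture_exponent \<nu> P \<tau> QY QX 0 Rc = compound_exponent m P k r QY QX 0 Rc \<and>
         compound_exponent m P k r QY QX 0 Rc = Min ((\<lambda>s. theta m k r P cY cX s Rc) ` PXs P m)"
proof -
  note \<nu> = assms(2) and \<tau> = assms(3) and \<tau>_pos = assms(4)
  note rates = setting_divergence_rate[OF assms(1)]
  have m: "m \<ge> 1" using set_pmf_not_empty[of \<nu>] \<nu> by auto
  have "k \<ge> 1 \<and> r \<ge> 1" using set_pmf_not_empty[of \<tau>] \<tau> by force
  then have k: "k \<ge> 1" and r: "r \<ge> 1" by auto
  have fin\<nu>: "finite (set_pmf \<nu>)" using \<nu> by simp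
  have fin\<tau>: "finite (set_pmf \<tau>)" by (rule finite_subset[OF \<tau>]) simp
  let ?S = "PXs P m"
  have S: "finite ?S" "?S \<noteq> {}" using m by (auto simp: PXs_def)
  let ?j = "\<lambda>i. first_argmin k (cY i)" and ?t = "\<lambda>s. first_argmin r (cX s)"
  \<comment> \<open>Conversion to reals loses nothing: the minimum is finite by assumption from
    above, and divergence rates are never minus infinity.\<close>
  define dy where "dy i = real_of_ereal (cY i (?j i))" for i
  define dx where "dx s = real_of_ereal (cX s (?t s))" for s
  have dy: "cY i (?j i) = ereal (dy i)" if "i \<in> {1..m}" for i
  proof -
    have "cY i (?j i) < \<infinity>" using rates(3) that first_argmin(3)[OF k, of "cY i"] by simp
    moreover have "cY i (?j i) \<noteq> -\<infinity>" using rates(1) that first_argmin(1)[OF k, of "cY i"] by (auto simp: divergence_rate_def)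
    ultimately show ?thesis unfolding dy_def by (cases "cY i (?j i)") auto
  qed
  have dx: "cX s (?t s) = ereal (dx s)" if "s \<in> ?S" for s
  proof -
    have "cX s (?t s) < \<infinity>" using rates(4) that first_argmin(3)[OF r, of "cX s"] by simp
    moreover have "cX s (?t s) \<noteq> -\<infinity>" using rates(2) that first_argmin(1)[OF r, of "cX s"] by (auto simp: divergence_rate_def)
    ultimately show ?thesis unfolding dx_def by (cases "cX s (?t s)") auto
  qed
  have cls: "i \<in> {1..m}" "margX P i = s" if "i \<in> cls P m s" for i s using that by (auto simp: cls_def)
  let ?\<theta> = "\<lambda>s. theta m k r P cY cX s Rc"
  have d: "cY i (?j i) + cX s (?t s) = ereal (dy i + dx s)" if "s \<in> ?S" "i \<in> cls P m s" for s i
    using dy[OF cls(1)[OF that(2)]] dx[OF that(1)] by simp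
  have upper: "ereal E \<le> ?\<theta> s"
    if ach: "achievable (simple_alpha (mixture_null \<nu> P)) (simple_beta (mixture_alt \<tau> QY QX)) 0 Rc E" and s: "s \<in> ?S" for E s
  proof -
    let ?F = "cls P m s"
    have F: "finite ?F" by (simp add: cls_def)
    have P: "map_pmf snd (P i) = s" if "i \<in> ?F" for i using cls[OF that] by (simp add: margX_def)
    obtain M \<phi> \<psi> where scheme: "\<And>n. finite (M n) \<and> (\<forall>xs. length xs = n \<longrightarrow> \<phi> n xs \<in> M n)"
      and alpha: "limsup (\<lambda>n. ereal (simple_alpha (mixture_null \<nu> P) n (\<phi> n) (\<psi> n))) \<le> ereal 0"
      and beta: "liminf (\<lambda>n. ereal (1 / real n) * log_recip (simple_beta (mixture_alt \<tau> QY QX) n (\<phi> n) (\<psi> n))) \<ge> ereal E"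
      and rate: "limsup (\<lambda>n. ereal (1 / real n * ln (real (card (M n))))) \<le> ereal Rc"
      using ach unfolding achievable_def by blast
    let ?acc = "\<lambda>i n. accept_prob (compressed (\<phi> n) (iid_pairs n (P i))) (\<psi> n)"
    have acc_lim: "?acc i \<longlonglongrightarrow> 1" if i: "i \<in> ?F" for i
    proof -
      have \<nu>i: "i \<in> set_pmf \<nu>" "pmf \<nu> i > 0" using cls(1)[OF i] \<nu> by (auto simp: pmf_positive_iff)
      \<comment> \<open>The component errors are nonnegative, so each is at most the mixture error
        divided by its weight and vanishes with it.\<close>
      have le: "pmf \<nu> i * (1 - ?acc i n) \<le> simple_alpha (mixture_null \<nu> P) n (\<phi> n) (\<psi> n)" for n
      proof -
        have "\<And>i. 0 \<le> 1 - ?acc i n" using accept_prob_le_1 by simp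
        from weighted_term_le_expectation[where h = "\<lambda>i. 1 - ?acc i n", OF fin\<nu> this \<nu>i(1)] show ?thesis
          by (simp add: simple_alpha_mixture expectation_diff_finite[OF fin\<nu>])
      qed
      show ?thesis
      proof (rule order_tendstoI)
        fix a :: real assume "a < 1"
        then have "ereal 0 < ereal (pmf \<nu> i * (1 - a))" using \<nu>i by simp
        then have "limsup (\<lambda>n. ereal (simple_alpha (mixture_null \<nu> P) n (\<phi> n) (\<psi> n))) < ereal (pmf \<nu> i * (1 - a))"
          by (rule le_less_trans[OF alpha])
        from Limsup_lessD[OF this] show "\<forall>\<^sub>F n in sequentially. a < ?acc i n"
        proof eventually_elim
          case (elim n)
          then have "pmf \<nu> i * (1 - ?acc i n) < pmf \<nu> i * (1 - a)" using le[of n] by simp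
          then show ?case using \<nu>i by simp
        qed
      next
        fix a :: real assume "1 < a"
        then show "\<forall>\<^sub>F n in sequentially. ?acc i n < a"
          by (intro always_eventually allI le_less_trans[OF accept_prob_le_1])
      qed
    qed
    \<comment> \<open>The component at the minimisers has positive weight in the mixture; dividing
      by this weight costs a constant factor and no exponent.\<close>
    have beta_le: "\<forall>\<^sub>F n in sequentially. accept_prob (pair_pmf (QY (?j i) n) (map_pmf (\<phi> n) (QX (?t s) n))) (\<psi> n)
        \<le> 1 / pmf \<tau> (?j i, ?t s) * exp (- (real n * E'))" if i: "i \<in> ?F" and "E' < E" for i E'
    proof -
      have \<tau>i: "pmf \<tau> (?j i, ?t s) > 0" by (rule \<tau>_pos[OF s i])
      have "ereal E' < liminf (\<lambda>n. ereal (1 / real n) * log_recip (simple_beta (mixture_alt \<tau> QY QX) n (\<phi> n) (\<psi> n)))"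
        by (rule less_le_trans[OF _ beta]) (simp add: \<open>E' < E\<close>)
      from less_LiminfD[OF this] eventually_gt_at_top[of 0] show ?thesis
      proof eventually_elim
        case (elim n)
        let ?b = "simple_beta (mixture_alt \<tau> QY QX) n (\<phi> n) (\<psi> n)"
        have "?b \<ge> 0" by (simp add: simple_beta_def accept_prob_nonneg)
        have b: "?b \<le> exp (- (real n * E'))"
        proof (cases "?b = 0")
          case False
          then have b0: "?b > 0" using \<open>?b \<ge> 0\<close> by linarith
          then have "E' < (1 / real n) * - ln ?b" using elim(1) by (simp add: log_recip_def ln_div)
          then have "real n * E' < real n * ((1 / real n) * - ln ?b)" using elim(2) by (intro mult_strict_left_mono) auto
          then have "ln ?b \<le> - (real n * E')" using elim(2) by simp
          then have "exp (ln ?b) \<le> exp (- (real n * E'))" by (simp only: exp_le_cancel_iff)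
          then show ?thesis using b0 by simp
        qed simp
        have "pmf \<tau> (?j i, ?t s) * accept_prob (pair_pmf (QY (?j i) n) (map_pmf (\<phi> n) (QX (?t s) n))) (\<psi> n) \<le> ?b"
          using weighted_term_le_expectation[OF fin\<tau>, of "\<lambda>(j, t). accept_prob (pair_pmf (QY j n) (map_pmf (\<phi> n) (QX t n))) (\<psi> n)" "(?j i, ?t s)"] \<tau>i
          by (auto simp: simple_beta_mixture accept_prob_nonneg set_pmf_iff)
        then show ?case using b \<tau>i by (simp add: field_simps)
      qed
    qed
    have rate_le: "\<forall>\<^sub>F n in sequentially. ln (real (card (M n))) \<le> real n * (Rc + e)" if "e > 0" for e
    proof -
      have "limsup (\<lambda>n. ereal (1 / real n * ln (real (card (M n))))) < ereal (Rc + e)"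
        by (rule le_less_trans[OF rate]) (simp add: \<open>e > 0\<close>)
      from Limsup_lessD[OF this] eventually_gt_at_top[of 0] show ?thesis
        by eventually_elim (simp add: field_simps)
    qed
    have kly: "kl_upper (map_pmf fst (P i)) (QY (?j i)) (dy i)" if "i \<in> ?F" for i
      using rates(1) cls(1)[OF that] first_argmin(1)[OF k, of "cY i"] dy unfolding divergence_rate_def margY_def by blast
    have klx: "kl_upper s (QX (?t s)) (dx s)"
      using rates(2) s first_argmin(1)[OF r, of "cX s"] dx unfolding divergence_rate_def by blast
    have "region s P ?F 1 (Rc + e) (\<lambda>i. (E - dy i - dx s) - e)" if "e > 0" for e
      using \<tau>_pos[OF s]
      by (intro converse_region[where M = M and \<phi> = \<phi> and \<psi> = \<psi> and QY = "\<lambda>i. QY (?j i)" and QX = "QX (?t s)"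
            and \<kappa> = "\<lambda>i. 1 / pmf \<tau> (?j i, ?t s)"] F P scheme acc_lim beta_le rate_le kly klx that) auto
    from region_closed[OF F P this] obtain W where W: "finite_kernel W" "minfo (law_XU s W) \<le> Rc"
      "\<And>i. i \<in> ?F \<Longrightarrow> E - dy i - dx s \<le> minfo (law_YU (P i) W)" by blast
    obtain W0 where W0: "\<And>W' v. finite_kernel W' \<Longrightarrow> minfo (law_XU s W') \<le> Rc \<Longrightarrow>
       (\<And>i. i \<in> ?F \<Longrightarrow> v \<le> minfo (law_YU (P i) W') + (dy i + dx s)) \<Longrightarrow> ereal v \<le> ?\<theta> s"
      by (rule theta_attained[where P = P and m = m and k = k and r = r and cY = cY and cX = cX and d = "\<lambda>i. dy i + dx s", OF s assms(5) d[OF s]]) blast+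
    show ?thesis using W(3) by (intro W0[OF W(1,2)]) (simp add: algebra_simps)
  qed
  have lower: "achievable (compound_alpha m P) (compound_beta k r QY QX) 0 Rc E" if E: "ereal E < Min (?\<theta> ` ?S)" for E
  proof -
    have E_less: "ereal E < ?\<theta> s" if "s \<in> ?S" for s
    proof -
      have "Min (?\<theta> ` ?S) \<le> ?\<theta> s" using S that by (intro Min_le) auto
      with E show ?thesis by (rule less_le_trans)
    qed
    \<comment> \<open>Outside \<open>?S\<close> a constant kernel is supplied, since the scheme asks
      for finite supports at every \<open>s\<close>.\<close>
    have "\<exists>W. finite_kernel W \<and> (s \<in> ?S \<longrightarrow> minfo (law_XU s W) \<le> Rc \<and>
        (\<forall>i\<in>cls P m s. ?\<theta> s \<le> ereal (minfo (law_YU (P i) W) + (dy i + dx s))))" for s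
    proof (cases "s \<in> ?S")
      case True
      show ?thesis
        by (rule theta_attained[where P = P and m = m and k = k and r = r and cY = cY and cX = cX and d = "\<lambda>i. dy i + dx s", OF True assms(5) d[OF True]]) blast+
    next
      case False
      have "finite_kernel (\<lambda>_. return_pmf 0)" by (auto simp: finite_kernel_def intro: exI[of _ "{0}"])
      then show ?thesis using False by blast
    qed
    then obtain W where W: "\<And>s. finite_kernel (W s)" "\<And>s. s \<in> ?S \<Longrightarrow> minfo (law_XU s (W s)) \<le> Rc"
      "\<And>s i. s \<in> ?S \<Longrightarrow> i \<in> cls P m s \<Longrightarrow> ?\<theta> s \<le> ereal (minfo (law_YU (P i) (W s)) + (dy i + dx s))"
      by metis
    show ?thesis
    proof (rule achievableI)
      show "0 \<le> compound_beta k r QY QX n \<phi> \<psi>" for n \<phi> \<psi>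
        unfolding compound_beta_def using k r
        by (subst Max_ge_iff) (auto simp: accept_prob_nonneg)
      fix \<eta> :: real assume "\<eta> > 0"
      show "\<forall>\<^sub>F n in sequentially. \<exists>M \<phi> \<psi>. finite M \<and> (\<forall>xs. length xs = n \<longrightarrow> \<phi> xs \<in> M) \<and>
          real (card M) \<le> exp (real n * (Rc + \<eta>)) \<and> compound_alpha m P n \<phi> \<psi> \<le> \<eta> \<and>
          compound_beta k r QY QX n \<phi> \<psi> \<le> exp (- (real n * E))"
      proof (rule compound_scheme[OF m k r assms(5) \<open>\<eta> > 0\<close>, where W = W and dy = dy and dx = dx])
        show "finite (set_pmf (W s x))" for s x
          using W(1)[of s] by (auto simp: finite_kernel_def intro: finite_subset)
        show "minfo (law_XU s (W s)) \<le> Rc" if "s \<in> ?S" for s by (rule W(2)[OF that])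
        fix i assume i: "i \<in> {1..m}"
        let ?s = "margX P i"
        have s: "?s \<in> ?S" "i \<in> cls P m ?s" using i by (auto simp: PXs_def cls_def)
        have "ereal E < ereal (minfo (law_YU (P i) (W ?s)) + (dy i + dx ?s))"
          using E_less[OF s(1)] W(3)[OF s] by (rule less_le_trans)
        then show "E < minfo (law_YU (P i) (W ?s)) + dy i + dx ?s" by simp
      next
        \<comment> \<open>By minimality \<open>dy i\<close> is at most every \<open>cY i j\<close>,
          finite or not, so one threshold serves against all \<open>j\<close>.\<close>
        fix i j D assume "i \<in> {1..m}" "j \<in> {1..k}" "D < dy i"
        moreover from this have "ereal D < cY i j"
          using first_argmin(2)[OF k, of j "cY i"] dy[of i] by (auto elim: less_le_trans[rotated])
        ultimately show "(\<lambda>n. Pr (replicate_pmf n (margY P i))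
            {ys. exp (- (real n * D)) * pmf (replicate_pmf n (margY P i)) ys < pmf (QY j n) ys}) \<longlonglongrightarrow> 0"
          using rates(1) by (auto simp: divergence_rate_def aep_lower_def)
      next
        fix s t D assume "s \<in> ?S" "t \<in> {1..r}" "D < dx s"
        moreover from this have "ereal D < cX s t"
          using first_argmin(2)[OF r, of t "cX s"] dx[of s] by (auto elim: less_le_trans[rotated])
        ultimately show "(\<lambda>n. Pr (replicate_pmf n s)
            {xs. exp (- (real n * D)) * pmf (replicate_pmf n s) xs < pmf (QX t n) xs}) \<longlonglongrightarrow> 0"
          using rates(2) by (auto simp: divergence_rate_def aep_lower_def)
      qed
    qed
  qed
  have comp_mix: "achievable (simple_alpha (mixture_null \<nu> P)) (simple_beta (mixture_alt \<tau> QY QX)) 0 Rc E"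
    if "achievable (compound_alpha m P) (compound_beta k r QY QX) 0 Rc E" for E
  proof (rule achievable_mono[OF that])
    fix n and \<phi> :: "'x encoder" and \<psi> :: "'y test"
    let ?a = "\<lambda>i. accept_prob (compressed \<phi> (iid_pairs n (P i))) \<psi>"
    let ?b = "\<lambda>(j, t). accept_prob (pair_pmf (QY j n) (map_pmf \<phi> (QX t n))) \<psi>"
    have "expect \<nu> (\<lambda>_. 1 - compound_alpha m P n \<phi> \<psi>) \<le> expect \<nu> ?a"
    proof (rule expectation_mono_set[OF fin\<nu>])
      fix i assume "i \<in> set_pmf \<nu>"
      then have "1 - ?a i \<le> compound_alpha m P n \<phi> \<psi>"
        unfolding compound_alpha_def using \<nu> by (intro Max_ge) auto
      then show "1 - compound_alpha m P n \<phi> \<psi> \<le> ?a i" by linarith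
    qed
    then show "simple_alpha (mixture_null \<nu> P) n \<phi> \<psi> \<le> compound_alpha m P n \<phi> \<psi>"
      by (simp add: simple_alpha_mixture)
    show "0 \<le> simple_beta (mixture_alt \<tau> QY QX) n \<phi> \<psi>"
      by (simp add: simple_beta_def accept_prob_nonneg)
    have "expect \<tau> ?b \<le> expect \<tau> (\<lambda>_. compound_beta k r QY QX n \<phi> \<psi>)"
    proof (rule expectation_mono_set[OF fin\<tau>])
      fix q assume "q \<in> set_pmf \<tau>"
      then show "?b q \<le> compound_beta k r QY QX n \<phi> \<psi>"
        unfolding compound_beta_def using \<tau> by (intro Max_ge) auto
    qed
    then show "simple_beta (mixture_alt \<tau> QY QX) n \<phi> \<psi> \<le> compound_beta k r QY QX n \<phi> \<psi>"
      by (simp add: simple_beta_mixture)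
  qed
  have mix_le: "mixture_exponent \<nu> P \<tau> QY QX 0 Rc \<le> Min (?\<theta> ` ?S)"
    unfolding max_exponent_def
  proof (rule SUP_least)
    fix E assume "E \<in> {E. achievable (simple_alpha (mixture_null \<nu> P)) (simple_beta (mixture_alt \<tau> QY QX)) 0 Rc E}"
    then show "ereal E \<le> Min (?\<theta> ` ?S)" using S upper by (subst Min_ge_iff) auto
  qed
  have le_comp: "Min (?\<theta> ` ?S) \<le> compound_exponent m P k r QY QX 0 Rc"
  proof (rule dense_le)
    \<comment> \<open>\<open>lower\<close> covers only real exponents strictly below the minimum;
      density of the reals closes the gap.\<close>
    fix x assume x: "x < Min (?\<theta> ` ?S)"
    show "x \<le> compound_exponent m P k r QY QX 0 Rc"
    proof (rule ccontr)
      assume "\<not> ?thesis"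
      then obtain E where E: "compound_exponent m P k r QY QX 0 Rc < ereal E" "ereal E < x"
        using ereal_dense2[of "compound_exponent m P k r QY QX 0 Rc" x] by (auto simp: not_le)
      have "achievable (compound_alpha m P) (compound_beta k r QY QX) 0 Rc E"
        using E(2) x by (intro lower) (rule less_trans)
      then have "ereal E \<le> compound_exponent m P k r QY QX 0 Rc"
        unfolding max_exponent_def by (intro SUP_upper) simp
      then show False using E(1) by simp
    qed
  qed
  have comp_le: "compound_exponent m P k r QY QX 0 Rc \<le> mixture_exponent \<nu> P \<tau> QY QX 0 Rc"
    unfolding max_exponent_def using comp_mix by (intro SUP_subset_mono) auto
  show ?thesis using mix_le le_comp comp_le by (auto intro: antisym order_trans)
qed

end
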